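(* There is a deterministic algorithm that solves the $k$-range-medians problem on an array of $n$ elements in $O(n \log k + k \log k \log n)$ time. Furthermore, in the comparison model, any algorithm that solves the $k$-range-medians problem requires $\Omega(n \log k)$ comparisons.
   Context: The $k$-range-medians problem: the input is an unsorted array $S[1..n]$ of $n$ distinct elements from a totally ordered set and a sequence of $k$ queries $Q_1,\ldots,Q_k$, where each query $Q_j=[l_j,r_j]$ with $1\le l_j\le r_j\le n$ is an interval of array positions (the intervals may overlap). The output is $x_1,\ldots,x_k$, where $x_j$ is the median of $\{S[l_j],S[l_j+1],\ldots,S[r_j]\}$, i.e. its element of rank $\lceil (r_j-l_j+1)/2\rceil$ (the rank-$i$ element of a set is its $i$-th smallest element). In the comparison model elements can be accessed only through pairwise comparisons, and complexity is measured by the number of comparisons.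
   Formalization: The lower bound is proved for k at most n^d, with a constant depending on d: it fails for unbounded k (n = 2 needs one comparison for any k). The time bound is for n, k at least 2, since at k = 1 the stated formula is 0 and at n = 1 it is log k, less than the k outputs. *)

theory Defs
  imports Complex_Main
begin

section \<open>The \<open>k\<close>-range-medians problem\<close>

text \<open>
  An array \<open>S[1..n]\<close> of distinct elements is a distinct list of length \<open>n\<close> over a
  \<open>linorder\<close> type; array positions are counted from 1.
\<close>

definition arrays :: "nat \<Rightarrow> 'a list set" where
  "arrays n = {S. length S = n \<and> distinct S}"

definition queries :: "nat \<Rightarrow> nat \<Rightarrow> (nat \<times> nat) list set" where
  "queries n k = {Q. length Q = k \<and> (\<forall>(l, r) \<in> set Q. 1 \<le> l \<and> l \<le> r \<and> r \<le> n)}"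

definition elem :: "'a list \<Rightarrow> nat \<Rightarrow> 'a" where
  "elem S i = S ! (i - 1)"

definition rank_element :: "'a::linorder set \<Rightarrow> nat \<Rightarrow> 'a" where
  "rank_element A i = sorted_list_of_set A ! (i - 1)"

definition range_median :: "'a::linorder list \<Rightarrow> nat \<Rightarrow> nat \<Rightarrow> 'a" where
  "range_median S l r = rank_element (elem S ` {l..r}) (nat \<lceil>real (r - l + 1) / 2\<rceil>)"

text \<open>
  Algorithms can only compare elements, so an output element \<open>x\<^sub>j\<close> is named by its
  position in the array.
\<close>

definition solution :: "'a::linorder list \<Rightarrow> (nat \<times> nat) list \<Rightarrow> nat list \<Rightarrow> bool" where
  "solution S Q ps \<longleftrightarrow>
     list_all2 (\<lambda>(l, r) p. p \<in> {1..length S} \<and> elem S p = range_median S l r) Q ps"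


section \<open>Algorithms and running time: a unit-cost random access machine\<close>

text \<open>
  The machine has registers and an indirectly addressed memory, both holding natural
  numbers.  The array \<open>S\<close> is not stored in either of them: a program names an element by its
  position, and the only access to elements is the test \<open>LessElem\<close>.  A program is one fixed
  finite list of procedures without parameters; execution starts with procedure 0.
\<close>

datatype instr =
    Const nat nat      \<comment> \<open>\<open>R[i] := c\<close>\<close>
  | Add nat nat nat    \<comment> \<open>\<open>R[i] := R[j] + R[h]\<close>\<close>
  | Sub nat nat nat    \<comment> \<open>\<open>R[i] := R[j] - R[h]\<close>, truncated at 0\<close>
  | Half nat nat       \<comment> \<open>\<open>R[i] := R[j] div 2\<close>\<close>
  | Load nat nat       \<comment> \<open>\<open>R[i] := M[R[j]]\<close>\<close>
  | Store nat nat      \<comment> \<open>\<open>M[R[i]] := R[j]\<close>\<close>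

datatype test =
    Less nat nat       \<comment> \<open>\<open>R[i] < R[j]\<close>\<close>
  | LessElem nat nat   \<comment> \<open>\<open>S[R[i]] < S[R[j]]\<close>\<close>

datatype com =
    Instr instr
  | Seq com com
  | If test com com
  | While test com
  | Call nat

type_synonym program = "com list"

type_synonym state = "(nat \<Rightarrow> nat) \<times> (nat \<Rightarrow> nat)"  \<comment> \<open>registers, memory\<close>

fun step :: "instr \<Rightarrow> state \<Rightarrow> state" where
  "step (Const i c) (R, M) = (R(i := c), M)"
| "step (Add i j h) (R, M) = (R(i := R j + R h), M)"
| "step (Sub i j h) (R, M) = (R(i := R j - R h), M)"
| "step (Half i j) (R, M) = (R(i := R j div 2), M)"
| "step (Load i j) (R, M) = (R(i := M (R j)), M)"
| "step (Store i j) (R, M) = (R, M(R i := R j))"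

fun test_defined :: "'a list \<Rightarrow> test \<Rightarrow> state \<Rightarrow> bool" where
  "test_defined S (Less i j) (R, M) \<longleftrightarrow> True"
| "test_defined S (LessElem i j) (R, M) \<longleftrightarrow> R i \<in> {1..length S} \<and> R j \<in> {1..length S}"

fun test_val :: "'a::linorder list \<Rightarrow> test \<Rightarrow> state \<Rightarrow> bool" where
  "test_val S (Less i j) (R, M) \<longleftrightarrow> R i < R j"
| "test_val S (LessElem i j) (R, M) \<longleftrightarrow> elem S (R i) < elem S (R j)"

text \<open>
  \<open>exec P S c s t s'\<close>: with the procedures \<open>P\<close> and on the array \<open>S\<close>, command \<open>c\<close> started in
  state \<open>s\<close> terminates in state \<open>s'\<close> after \<open>t\<close> time units; every instruction, test and
  procedure call takes one unit.  Comparing elements at positions outside the array, or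
  calling a procedure that does not exist, has no execution.
\<close>

inductive exec ::
  "program \<Rightarrow> 'a::linorder list \<Rightarrow> com \<Rightarrow> state \<Rightarrow> nat \<Rightarrow> state \<Rightarrow> bool"
  for P :: program and S :: "'a list"
where
  Instr: "exec P S (Instr a) s 1 (step a s)"
| Seq: "exec P S c1 s t1 s1 \<Longrightarrow> exec P S c2 s1 t2 s2 \<Longrightarrow> exec P S (Seq c1 c2) s (t1 + t2) s2"
| IfTrue: "test_defined S b s \<Longrightarrow> test_val S b s \<Longrightarrow> exec P S c1 s t s1 \<Longrightarrow>
    exec P S (If b c1 c2) s (t + 1) s1"
| IfFalse: "test_defined S b s \<Longrightarrow> \<not> test_val S b s \<Longrightarrow> exec P S c2 s t s1 \<Longrightarrow>
    exec P S (If b c1 c2) s (t + 1) s1"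
| WhileFalse: "test_defined S b s \<Longrightarrow> \<not> test_val S b s \<Longrightarrow> exec P S (While b c) s 1 s"
| WhileTrue: "test_defined S b s \<Longrightarrow> test_val S b s \<Longrightarrow> exec P S c s t1 s1 \<Longrightarrow>
    exec P S (While b c) s1 t2 s2 \<Longrightarrow> exec P S (While b c) s (t1 + t2 + 1) s2"
| Call: "p < length P \<Longrightarrow> exec P S (P ! p) s t s1 \<Longrightarrow> exec P S (Call p) s (t + 1) s1"

inductive_cases exec_InstrE: "exec P S (Instr a) s t s'"
inductive_cases exec_SeqE: "exec P S (Seq c1 c2) s t s'"
inductive_cases exec_IfE: "exec P S (If b c1 c2) s t s'"
inductive_cases exec_WhileE: "exec P S (While b c) s t s'"
inductive_cases exec_CallE: "exec P S (Call p) s t s'"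

lemma exec_deterministic:
  "exec P S c s t s1 \<Longrightarrow> exec P S c s u s2 \<Longrightarrow> u = t \<and> s2 = s1"
proof (induction arbitrary: u s2 rule: exec.induct)
  case (Instr a s)
  from Instr.prems show ?case by (rule exec_InstrE) simp
next
  case (Seq c1 s t1 s1 c2 t2 s2')
  from Seq.prems obtain v1 q v2 where
    "exec P S c1 s v1 q" "exec P S c2 q v2 s2" "u = v1 + v2" by (rule exec_SeqE)
  with Seq.IH(1)[of v1 q] Seq.IH(2)[of v2 s2] show ?case by simp
next
  case (IfTrue b s c1 t s1 c2)
  from IfTrue.prems obtain v where "exec P S c1 s v s2" "u = v + 1"
    by (rule exec_IfE) (use IfTrue.hyps(2) in simp_all)
  with IfTrue.IH[of v s2] show ?case by simp
next
  case (IfFalse b s c2 t s1 c1)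
  from IfFalse.prems obtain v where "exec P S c2 s v s2" "u = v + 1"
    by (rule exec_IfE) (use IfFalse.hyps(2) in simp_all)
  with IfFalse.IH[of v s2] show ?case by simp
next
  case (WhileFalse b s c)
  from WhileFalse.prems show ?case
    by (rule exec_WhileE) (use WhileFalse.hyps(2) in simp_all)
next
  case (WhileTrue b s c t1 s1 t2 s2')
  from WhileTrue.prems obtain v1 q v2 where
    "exec P S c s v1 q" "exec P S (While b c) q v2 s2" "u = v1 + v2 + 1"
    by (rule exec_WhileE) (use WhileTrue.hyps(2) in simp_all)
  with WhileTrue.IH(1)[of v1 q] WhileTrue.IH(2)[of v2 s2] show ?case by simp
next
  case (Call p s t s1)
  from Call.prems obtain v where "exec P S (P ! p) s v s2" "u = v + 1"
    by (rule exec_CallE) simp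
  with Call.IH[of v s2] show ?case by simp
qed

text \<open>
  Initially \<open>R[0] = n\<close>, \<open>R[1] = k\<close> and the memory starts with \<open>l\<^sub>1, r\<^sub>1, \<dots>, l\<^sub>k, r\<^sub>k\<close>;
  everything else is 0.  The positions of \<open>x\<^sub>1, \<dots>, x\<^sub>k\<close> are read off the first \<open>k\<close> memory
  cells at the end.
\<close>

definition initial :: "nat \<Rightarrow> (nat \<times> nat) list \<Rightarrow> state" where
  "initial n Q =
     ((\<lambda>_. 0)(0 := n, 1 := length Q),
      (\<lambda>a. if a < 2 * length Q
           then (if even a then fst (Q ! (a div 2)) else snd (Q ! (a div 2)))
           else 0))"

definition runs ::
  "program \<Rightarrow> 'a::linorder list \<Rightarrow> (nat \<times> nat) list \<Rightarrow> nat \<Rightarrow> nat list \<Rightarrow> bool" where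
  "runs P S Q t ps \<longleftrightarrow>
     (\<exists>R M. exec P S (Call 0) (initial (length S) Q) t (R, M) \<and> ps = map M [0..<length Q])"


section \<open>The comparison model\<close>

text \<open>
  For a given array length and query sequence, a deterministic algorithm in the comparison
  model is a comparison tree: \<open>Compare i j T U\<close> compares the elements at positions \<open>i\<close> and
  \<open>j\<close> and continues with \<open>T\<close> if \<open>S[i] < S[j]\<close> and with \<open>U\<close> otherwise.
\<close>

datatype ctree = Output "nat list" | Compare nat nat ctree ctree

fun positions :: "ctree \<Rightarrow> nat set" where
  "positions (Output ps) = {}"
| "positions (Compare i j T U) = {i, j} \<union> positions T \<union> positions U"

fun result :: "ctree \<Rightarrow> 'a::linorder list \<Rightarrow> nat list" where
  "result (Output ps) S = ps"
| "result (Compare i j T U) S = (if elem S i < elem S j then result T S else result U S)"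

fun comparisons :: "ctree \<Rightarrow> 'a::linorder list \<Rightarrow> nat" where
  "comparisons (Output ps) S = 0"
| "comparisons (Compare i j T U) S =
     1 + (if elem S i < elem S j then comparisons T S else comparisons U S)"

text \<open>
  A comparison algorithm for arrays of length \<open>n\<close> may choose its tree depending in any way
  on the query sequence.  It solves the problem if it is correct for all arrays of length
  \<open>n\<close> over the type \<open>'a\<close> and all sequences of \<open>k\<close> queries.
\<close>

definition solves ::
  "'a::linorder itself \<Rightarrow> nat \<Rightarrow> nat \<Rightarrow> ((nat \<times> nat) list \<Rightarrow> ctree) \<Rightarrow> bool" where
  "solves _ n k A \<longleftrightarrow>
     (\<forall>Q \<in> queries n k. positions (A Q) \<subseteq> {1..n} \<and>
        (\<forall>S \<in> (arrays n :: 'a list set). solution S Q (result (A Q) S)))"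

end

theory Submission
  imports Defs
begin

text \<open>
  Upper bound: all queries are answered together by divide and conquer on the values.  The elements
  are split, in linear time and preserving their order in the array, by the median of the medians
  of groups of five, and prefix counts translate every query into a query on one of the two parts.
  The pivot is itself found by a recursive call with one query.  Parts without queries are dropped,
  so at depth \<open>i\<close> only \<open>min (2 ^ i) k\<close> parts of geometrically decreasing size remain; this gives
  \<open>O(n log k + k log n)\<close>.

  Lower bound: padding with small and large elements turns range medians into selection of \<open>b\<close>
  equidistant ranks among \<open>m\<close> elements.  Two inputs that reach the same leaf agree on
  which block every element lies in, since otherwise an element and a splitter are incomparable in
  the order revealed by the comparisons and could be exchanged.  Hence there are at least
  \<open>fact b ^ (m div b)\<close> leaves.
\<close>

section \<open>Total correctness with time bounds\<close>

text \<open>Keeping the order of the array is what closes the recursion: filtering a list maps an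
  interval of it to an interval, so a range query stays a range query on either part, its rank
  unchanged or lowered by the number of low elements in the range. The machine has no stack and no
  parameters, so frames, and the proof that calls leave them intact, are explicit: below the first
  free cell a call changes only the answer cells of its own queries. For the lower bound, counting
  outputs would be too weak: b positions among m carry about b log m bits, far fewer than m log b
  when b is small. The leaves are counted instead, because a leaf has to certify the ranks it
  outputs and thereby determines the partition into blocks. Only about n distinct ranks can be asked
  for, so the number of useful queries is capped at b = min k (n div 3), and k \<le> n ^ d keeps log
  b within a constant factor of log k. Without such a restriction the bound fails, since sorting
  answers any number of queries with O(n log n) comparisons.\<close>

definition achieves ::
  "program \<Rightarrow> 'a::linorder list \<Rightarrow> com \<Rightarrow> (nat \<Rightarrow> nat) \<Rightarrow> (nat \<Rightarrow> nat) \<Rightarrow> nat \<Rightarrow>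
   ((nat \<Rightarrow> nat) \<Rightarrow> (nat \<Rightarrow> nat) \<Rightarrow> bool) \<Rightarrow> bool" where
  "achieves P S c R M T Q \<longleftrightarrow> (\<exists>t R' M'. exec P S c (R, M) t (R', M') \<and> t \<le> T \<and> Q R' M')"

lemma achieves_mono:
  assumes "achieves P S c R M T Q" "T \<le> T'" "\<And>R' M'. Q R' M' \<Longrightarrow> Q' R' M'"
  shows "achieves P S c R M T' Q'"
  using assms unfolding achieves_def by (meson order_trans)

lemma achieves_Seq:
  assumes "achieves P S c R M T1 Q1"
    and "\<And>R1 M1. Q1 R1 M1 \<Longrightarrow> achieves P S d R1 M1 T2 Q" and "T1 + T2 \<le> T"
  shows "achieves P S (Seq c d) R M T Q"
proof -
  obtain t1 R1 M1 where 1: "exec P S c (R, M) t1 (R1, M1)" "t1 \<le> T1" "Q1 R1 M1"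
    using assms(1) unfolding achieves_def by blast
  obtain t2 R2 M2 where 2: "exec P S d (R1, M1) t2 (R2, M2)" "t2 \<le> T2" "Q R2 M2"
    using assms(2)[OF 1(3)] unfolding achieves_def by blast
  have "exec P S (Seq c d) (R, M) (t1 + t2) (R2, M2)"
    using 1 2 by (blast intro: exec.Seq)
  then show ?thesis unfolding achieves_def using 1 2 assms(3) by (meson add_mono order_trans)
qed

lemma achieves_If:
  assumes "test_defined S b (R, M)"
    and "test_val S b (R, M) \<Longrightarrow> achieves P S c R M T Q"
    and "\<not> test_val S b (R, M) \<Longrightarrow> achieves P S d R M T Q"
    and "T + 1 \<le> T'"
  shows "achieves P S (If b c d) R M T' Q"
proof (cases "test_val S b (R, M)")
  case True
  then obtain t R1 M1 where 1: "exec P S c (R, M) t (R1, M1)" "t \<le> T" "Q R1 M1"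
    using assms(2) unfolding achieves_def by blast
  have "exec P S (If b c d) (R, M) (t + 1) (R1, M1)"
    using True assms(1) 1(1) by (blast intro: exec.IfTrue)
  then show ?thesis unfolding achieves_def using 1 assms(4) by (meson add_le_mono1 order_trans)
next
  case False
  then obtain t R1 M1 where 1: "exec P S d (R, M) t (R1, M1)" "t \<le> T" "Q R1 M1"
    using assms(3) unfolding achieves_def by blast
  have "exec P S (If b c d) (R, M) (t + 1) (R1, M1)"
    using False assms(1) 1(1) by (blast intro: exec.IfFalse)
  then show ?thesis unfolding achieves_def using 1 assms(4) by (meson add_le_mono1 order_trans)
qed

lemma achieves_While_stop:
  assumes "\<not> R i < R j" "Q R M" "1 \<le> T"
  shows "achieves P S (While (Less i j) c) R M T Q"
  unfolding achieves_def using assms exec.WhileFalse[of S "Less i j" "(R, M)" P c] by force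

lemma achieves_While_step:
  assumes "R i < R j" "achieves P S c R M T1 Q1"
    and "\<And>R1 M1. Q1 R1 M1 \<Longrightarrow> achieves P S (While (Less i j) c) R1 M1 T2 Q"
    and "T1 + T2 + 1 \<le> T"
  shows "achieves P S (While (Less i j) c) R M T Q"
proof -
  obtain t1 R1 M1 where 1: "exec P S c (R, M) t1 (R1, M1)" "t1 \<le> T1" "Q1 R1 M1"
    using assms(2) unfolding achieves_def by blast
  obtain t2 R2 M2 where 2: "exec P S (While (Less i j) c) (R1, M1) t2 (R2, M2)" "t2 \<le> T2" "Q R2 M2"
    using assms(3)[OF 1(3)] unfolding achieves_def by blast
  have "exec P S (While (Less i j) c) (R, M) (t1 + t2 + 1) (R2, M2)"
    using 1 2 assms(1) by (intro exec.WhileTrue) auto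
  moreover have "t1 + t2 + 1 \<le> T" using 1 2 assms(4) by linarith
  ultimately show ?thesis unfolding achieves_def using 2(3) by blast
qed

text \<open>The ghost parameter \<open>x\<close> carries what the registers do not show, such as the
  unprocessed rest of a list. Each unit of \<open>\<mu> x\<close> pays for one body and one test;
  the final failing test costs one more.\<close>

lemma achieves_While:
  assumes "I x R M"
    and step: "\<And>x R M. I x R M \<Longrightarrow> R i < R j \<Longrightarrow> \<exists>y. \<mu> y < \<mu> x \<and> achieves P S c R M T (I y)"
    and stop: "\<And>x R M. I x R M \<Longrightarrow> \<not> R i < R j \<Longrightarrow> Q R M"
  shows "achieves P S (While (Less i j) c) R M ((T + 1) * \<mu> x + 1) Q"
  using assms(1)
proof (induction "\<mu> x" arbitrary: x R M rule: less_induct)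
  case less
  show ?case
  proof (cases "R i < R j")
    case True
    obtain y where y: "\<mu> y < \<mu> x" "achieves P S c R M T (I y)"
      using step[OF less.prems True] by blast
    have "(T + 1) * Suc (\<mu> y) \<le> (T + 1) * \<mu> x" by (rule mult_le_mono2) (use y(1) in simp)
    then have "T + ((T + 1) * \<mu> y + 1) + 1 \<le> (T + 1) * \<mu> x + 1" by simp
    with True y show ?thesis by (intro achieves_While_step[OF True y(2) less.hyps[OF y(1)]])
  next
    case False
    then show ?thesis using stop[OF less.prems] by (intro achieves_While_stop) auto
  qed
qed

lemma achieves_While_list:
  assumes "I xs R M"
    and step: "\<And>x xs R M. I (x # xs) R M \<Longrightarrow> R i < R j \<and> achieves P S c R M T (I xs)"
    and stop: "\<And>R M. I [] R M \<Longrightarrow> \<not> R i < R j \<and> Q R M"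
  shows "achieves P S (While (Less i j) c) R M ((T + 1) * length xs + 1) Q"
proof (rule achieves_While[where I = I and \<mu> = length])
  fix xs R M assume I: "I xs R M" and "R i < R j"
  then obtain y ys where "xs = y # ys" using stop by (cases xs) auto
  then show "\<exists>ys. length ys < length xs \<and> achieves P S c R M T (I ys)"
    using step I by (intro exI[of _ ys]) auto
next
  fix xs R M assume I: "I xs R M" and "\<not> R i < R j"
  then show "Q R M" using step stop by (cases xs) auto
qed (rule assms(1))

lemma achieves_Call:
  assumes "p < length P" "achieves P S (P ! p) R M T Q"
  shows "achieves P S (Call p) R M (T + 1) Q"
  using assms unfolding achieves_def by (meson add_le_mono1 exec.Call)

text \<open>Straight-line code given as a list has a \<open>fold\<close> of \<open>step\<close> as
  its effect, which the simplifier evaluates symbolically. The language has no empty command, so the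
  clause for the empty list is a filler and the later rules ask for
  \<open>as \<noteq> []\<close>.\<close>

fun blk :: "instr list \<Rightarrow> com" where
  "blk [] = Instr (Const 0 0)"
| "blk [a] = Instr a"
| "blk (a # b # as) = Seq (Instr a) (blk (b # as))"

lemma exec_blk: "as \<noteq> [] \<Longrightarrow> exec P S (blk as) s (length as) (fold step as s)"
proof (induction as arbitrary: s rule: blk.induct)
  case (2 a)
  then show ?case using exec.Instr by simp
next
  case (3 a b as)
  then show ?case
    using exec.Seq[OF exec.Instr[of P S a s], of "blk (b # as)" "length (b # as)"] by simp
qed simp

lemma achieves_blk:
  assumes "as \<noteq> []" "length as \<le> T"
    and "\<And>R1 M1. fold step as (R, M) = (R1, M1) \<Longrightarrow> Q R1 M1"
  shows "achieves P S (blk as) R M T Q"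
  unfolding achieves_def using exec_blk[OF assms(1), of P S "(R, M)"] assms(2,3)
  by (metis surj_pair)

lemma achieves_blk_Seq:
  assumes "as \<noteq> []" "\<And>R1 M1. fold step as (R, M) = (R1, M1) \<Longrightarrow> achieves P S c R1 M1 T1 Q"
    and "length as + T1 \<le> T"
  shows "achieves P S (Seq (blk as) c) R M T Q"
  by (rule achieves_Seq[OF achieves_blk[where Q = "\<lambda>R1 M1. fold step as (R, M) = (R1, M1)"]])
    (use assms in auto)

text \<open>Recursion along the list, rather than a statement about all indices, lets simplification
  read off one cell per \<open>Cons\<close>; \<open>qarr\<close> does the same with four cells per
  query.\<close>

fun arr :: "(nat \<Rightarrow> nat) \<Rightarrow> nat \<Rightarrow> nat list \<Rightarrow> bool" where
  "arr M a [] \<longleftrightarrow> True"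
| "arr M a (x # xs) \<longleftrightarrow> M a = x \<and> arr M (Suc a) xs"

fun qarr :: "(nat \<Rightarrow> nat) \<Rightarrow> nat \<Rightarrow> (nat \<times> nat \<times> nat \<times> nat) list \<Rightarrow> bool" where
  "qarr M a [] \<longleftrightarrow> True"
| "qarr M a ((l, r, c, p) # qs) \<longleftrightarrow>
     M a = l \<and> M (Suc a) = r \<and> M (Suc (Suc a)) = c \<and> M (Suc (Suc (Suc a))) = p \<and> qarr M (a + 4) qs"

lemma arr_append: "arr M a (xs @ ys) \<longleftrightarrow> arr M a xs \<and> arr M (a + length xs) ys"
  by (induction xs arbitrary: a) auto

lemma qarr_append: "qarr M a (xs @ ys) \<longleftrightarrow> qarr M a xs \<and> qarr M (a + 4 * length xs) ys"
  by (induction M a xs rule: qarr.induct) (auto simp: algebra_simps)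

lemma arr_cong:
  "arr M a xs \<Longrightarrow> (\<And>i. a \<le> i \<Longrightarrow> i < a + length xs \<Longrightarrow> M' i = M i) \<Longrightarrow> arr M' a xs"
  by (induction xs arbitrary: a) auto

lemma qarr_cong:
  "qarr M a qs \<Longrightarrow> (\<And>i. a \<le> i \<Longrightarrow> i < a + 4 * length qs \<Longrightarrow> M' i = M i) \<Longrightarrow> qarr M' a qs"
  by (induction M a qs rule: qarr.induct) auto

section \<open>Ranks, group medians and splitting of queries\<close>

text \<open>Ranks start at 0 here. In the program proofs \<open>f\<close> is \<open>elem S\<close>:
  lists hold positions, compared through their elements. Counting over a list fits slices and
  filters better than indexing into a sorted set.\<close>

definition has_rank :: "('b \<Rightarrow> 'a::linorder) \<Rightarrow> 'b list \<Rightarrow> nat \<Rightarrow> 'b \<Rightarrow> bool" where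
  "has_rank f xs c p \<longleftrightarrow> p \<in> set xs \<and> length (filter (\<lambda>z. f z < f p) xs) = c"

lemma length_filter_mono:
  "(\<And>x. x \<in> set xs \<Longrightarrow> P x \<Longrightarrow> Q x) \<Longrightarrow> length (filter P xs) \<le> length (filter Q xs)"
  by (induction xs) (auto simp: le_SucI)

lemma length_filter_strict_mono:
  "(\<And>x. x \<in> set xs \<Longrightarrow> P x \<Longrightarrow> Q x) \<Longrightarrow> y \<in> set xs \<Longrightarrow> Q y \<Longrightarrow> \<not> P y \<Longrightarrow>
   length (filter P xs) < length (filter Q xs)"
proof (induction xs)
  case (Cons a xs)
  have le: "length (filter P xs) \<le> length (filter Q xs)"
    by (rule length_filter_mono) (use Cons.prems in auto)
  show ?case
  proof (cases "y = a")
    case True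
    then show ?thesis using Cons.prems le by simp
  next
    case False
    then have "length (filter P xs) < length (filter Q xs)" using Cons by auto
    then show ?thesis using Cons.prems(1)[of a] by auto
  qed
qed simp

lemma has_rank_unique:
  assumes "inj_on f (set xs)" "has_rank f xs c p" "has_rank f xs c q"
  shows "p = q"
proof (rule ccontr)
  assume "p \<noteq> q"
  then have "f p < f q \<or> f q < f p"
    using assms by (meson has_rank_def inj_onD linorder_neqE)
  moreover have "\<not> f x < f y" if "has_rank f xs c x" "has_rank f xs c y" for x y
  proof
    assume "f x < f y"
    then have "length (filter (\<lambda>z. f z < f x) xs) < length (filter (\<lambda>z. f z < f y) xs)"
      using that(1) by (intro length_filter_strict_mono[of _ _ _ x]) (auto simp: has_rank_def)
    then show False using that by (simp add: has_rank_def)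
  qed
  ultimately show False using assms by blast
qed

text \<open>Sorting by \<open>f\<close> provides the witness: the entry with index
  \<open>c\<close>.\<close>

lemma has_rank_ex:
  assumes "inj_on f (set xs)" "distinct xs" "c < length xs"
  shows "\<exists>p. has_rank f xs c p"
proof -
  define ys where "ys = sort_key f xs"
  have ys: "set ys = set xs" "distinct ys" "length ys = length xs" "sorted (map f ys)"
    using assms by (simp_all add: ys_def)
  have *: "f (ys ! i) < f (ys ! c) \<longleftrightarrow> i < c" if "i < length ys" for i
  proof -
    have "ys ! i \<noteq> ys ! c" if "i \<noteq> c"
      using that \<open>i < length ys\<close> ys assms(3) by (simp add: nth_eq_iff_index_eq)
    then have "f (ys ! i) \<noteq> f (ys ! c)" if "i \<noteq> c"
      using that \<open>i < length ys\<close> assms(1,3) ys by (metis inj_onD nth_mem)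
    moreover have "f (ys ! i) \<le> f (ys ! c)" if "i \<le> c"
      using sorted_nth_mono[OF ys(4) that] assms(3) ys(3) that by simp
    moreover have "f (ys ! c) \<le> f (ys ! i)" if "c \<le> i"
      using sorted_nth_mono[OF ys(4) that] ys(3) \<open>i < length ys\<close> that by simp
    ultimately show ?thesis
      by (metis dual_order.strict_iff_order linorder_le_cases linorder_not_le)
  qed
  have "{i. i < length ys \<and> f (ys ! i) < f (ys ! c)} = {..<c}"
    using * assms(3) ys(3) by auto
  then have "length (filter (\<lambda>z. f z < f (ys ! c)) ys) = c"
    by (simp add: length_filter_conv_card)
  moreover have "length (filter Q ys) = length (filter Q xs)" for Q
    using ys(1,2) assms(2) by (metis distinct_card distinct_filter set_filter)
  ultimately have "has_rank f xs c (ys ! c)"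
    using ys assms(3) unfolding has_rank_def by (metis nth_mem)
  then show ?thesis by blast
qed

lemma length_filter_le_gt:
  "length (filter (\<lambda>z. f z \<le> (a::'a::linorder)) xs) + length (filter (\<lambda>z. a < f z) xs) = length xs"
  using sum_length_filter_compl[of "\<lambda>z. f z \<le> a" xs] by (simp add: not_le)

lemma has_rank_le:
  assumes "inj_on f (set xs)" "distinct xs" "has_rank f xs c p"
  shows "length (filter (\<lambda>z. f z \<le> f p) xs) = Suc c"
proof -
  have "{z \<in> set xs. f z \<le> f p} = insert p {z \<in> set xs. f z < f p}"
    using assms by (auto simp: has_rank_def inj_on_def order_le_less)
  then have "card {z \<in> set xs. f z \<le> f p} = Suc (card {z \<in> set xs. f z < f p})" by simp
  moreover have "length (filter Q xs) = card {z \<in> set xs. Q z}" for Q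
    using assms(2) by (metis distinct_card distinct_filter set_filter)
  ultimately show ?thesis using assms(3) by (simp add: has_rank_def)
qed

definition rank_of :: "('b \<Rightarrow> 'a::linorder) \<Rightarrow> 'b list \<Rightarrow> nat \<Rightarrow> 'b" where
  "rank_of f xs c = (THE p. has_rank f xs c p)"

lemma rank_of_eqI:
  "inj_on f (set xs) \<Longrightarrow> has_rank f xs c p \<Longrightarrow> rank_of f xs c = p"
  unfolding rank_of_def by (rule the_equality) (auto dest: has_rank_unique)

lemma has_rank_rank_of:
  assumes "inj_on f (set xs)" "distinct xs" "c < length xs"
  shows "has_rank f xs c (rank_of f xs c)"
  using has_rank_ex[OF assms] rank_of_eqI[OF assms(1)] by metis

text \<open>The last group may have fewer than five entries and still contributes its lower median.
  The equation is withdrawn from the simplifier below, as it would unfold forever.\<close>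

function group_medians :: "('b \<Rightarrow> 'a::linorder) \<Rightarrow> 'b list \<Rightarrow> 'b list" where
  "group_medians f xs =
     (if xs = [] then []
      else rank_of f (take 5 xs) ((length (take 5 xs) - 1) div 2) # group_medians f (drop 5 xs))"
  by auto
termination by (relation "measure (\<lambda>(f, xs). length xs)") auto

declare group_medians.simps [simp del]

lemma group_medians_Nil [simp]: "group_medians f [] = []"
  by (simp add: group_medians.simps)

lemma length_group_medians: "length (group_medians f xs) = (length xs + 4) div 5"
proof (induction xs rule: length_induct)
  case (1 xs)
  show ?case
  proof (cases "xs = []")
    case False
    then have "length (group_medians f xs) = Suc ((length xs - 5 + 4) div 5)"
      using 1[rule_format, of "drop 5 xs"] by (subst group_medians.simps) simp
    moreover obtain n where "length xs = Suc n" using False by (cases xs) auto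
    moreover have "Suc ((Suc n - 5 + 4) div 5) = (Suc n + 4) div 5"
      by (cases "n < 4") auto
    ultimately show ?thesis by simp
  qed simp
qed

text \<open>A full group whose median lies on one side of \<open>a\<close> has at least three
  entries on that side. A short group guarantees only one, which the slack covers by 3 \<le> 1 + 2;
  only the last group can be short, so the slack is spent once.\<close>

lemma group_medians_props:
  assumes "inj_on f (set xs)" "distinct xs"
  shows "set (group_medians f xs) \<subseteq> set xs" "distinct (group_medians f xs)"
    "3 * length (filter (\<lambda>z. f z \<le> a) (group_medians f xs)) \<le> length (filter (\<lambda>z. f z \<le> a) xs) + 2"
    "3 * length (filter (\<lambda>z. a < f z) (group_medians f xs)) \<le> length (filter (\<lambda>z. a < f z) xs) + 2"
proof -
  have "set (group_medians f xs) \<subseteq> set xs \<and> distinct (group_medians f xs) \<and>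
    3 * length (filter (\<lambda>z. f z \<le> a) (group_medians f xs)) \<le> length (filter (\<lambda>z. f z \<le> a) xs) + 2 \<and>
    3 * length (filter (\<lambda>z. a < f z) (group_medians f xs)) \<le> length (filter (\<lambda>z. a < f z) xs) + 2"
    using assms
  proof (induction xs rule: length_induct)
    case (1 xs)
    show ?case
    proof (cases "xs = []")
      case False
      define g where "g = take 5 xs"
      define h where "h = drop 5 xs"
      define c where "c = (length g - 1) div 2"
      define m where "m = rank_of f g c"
      have xs: "xs = g @ h" by (simp add: g_def h_def)
      have g: "inj_on f (set g)" "distinct g" and dis: "set g \<inter> set h = {}"
        using 1(2,3) by (auto simp: xs inj_on_Un)
      have h: "inj_on f (set h)" "distinct h"
        using 1(2,3) by (auto simp: xs inj_on_Un)
      have hlen: "length h < length xs" using False by (simp add: h_def)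
      note IH = 1(1)[rule_format, OF hlen h]
      have gpos: "0 < length g" using False by (simp add: g_def)
      then have cl: "c < length g" unfolding c_def by linarith
      from has_rank_rank_of[OF g this] have m: "has_rank f g c m" by (simp add: m_def)
      have eq: "group_medians f xs = m # group_medians f h"
        using False by (subst group_medians.simps) (simp add: m_def c_def g_def h_def)
      have e: "length (filter Q (group_medians f xs)) =
          length (filter Q [m]) + length (filter Q (group_medians f h))"
        "length (filter Q xs) = length (filter Q g) + length (filter Q h)" for Q
        by (simp add: eq, simp add: xs)
      have mg: "m \<in> set g" using m by (simp add: has_rank_def)
      have le: "length (filter (\<lambda>z. f z \<le> f m) g) = Suc c"
        using has_rank_le[OF g m] .
      have lt: "length (filter (\<lambda>z. f z < f m) g) = c"
        using m by (simp add: has_rank_def)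
      have ge: "length (filter (\<lambda>z. f m \<le> f z) g) + c = length g"
        using sum_length_filter_compl[of "\<lambda>z. f z < f m" g] lt by (simp add: not_less)
      \<comment> \<open>Everything up to the median follows it to the low side, everything from the
        median on follows it to the high side.\<close>
      have A: "Suc c \<le> length (filter (\<lambda>z. f z \<le> a) g)" if "f m \<le> a"
        using length_filter_mono[of g "\<lambda>z. f z \<le> f m" "\<lambda>z. f z \<le> a"] that le by fastforce
      have B: "length g - c \<le> length (filter (\<lambda>z. a < f z) g)" if "a < f m"
        using length_filter_mono[of g "\<lambda>z. f m \<le> f z" "\<lambda>z. a < f z"] that ge by fastforce
      consider "length g = 5" | "length g < 5" "h = []"
        unfolding g_def h_def by (cases "length xs < 5") auto
      then show ?thesis
      proof cases
        case 1
        then have c: "c = 2" by (simp add: c_def)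
        have sub: "set (group_medians f xs) \<subseteq> set xs" "distinct (group_medians f xs)"
          using IH mg dis unfolding eq by (auto simp: xs)
        have "3 * length (filter (\<lambda>z. f z \<le> a) [m]) \<le> length (filter (\<lambda>z. f z \<le> a) g)"
          "3 * length (filter (\<lambda>z. a < f z) [m]) \<le> length (filter (\<lambda>z. a < f z) g)"
          using A B 1 c by (simp_all add: not_le)
        moreover have add: "3 * x \<le> y \<Longrightarrow> 3 * u \<le> v + 2 \<Longrightarrow> 3 * (x + u) \<le> y + v + 2" for x y u v :: nat
          by simp
        ultimately show ?thesis using IH sub unfolding e by (blast intro: add)
      next
        case 2
        have "Suc c \<ge> 1" "length g - c \<ge> 1" using cl by auto
        then have "length (filter (\<lambda>z. f z \<le> a) [m]) \<le> length (filter (\<lambda>z. f z \<le> a) g)"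
          "length (filter (\<lambda>z. a < f z) [m]) \<le> length (filter (\<lambda>z. a < f z) g)"
          using A B by (auto simp: not_le dest: order_trans)
        moreover have "length (filter Q [m]) \<le> 1" for Q by simp
        moreover have "set (group_medians f xs) \<subseteq> set xs" "distinct (group_medians f xs)"
          using mg 2(2) unfolding eq by (auto simp: xs)
        moreover have add: "x \<le> 1 \<Longrightarrow> x \<le> y \<Longrightarrow> 3 * (x + 0) \<le> y + 0 + 2" for x y :: nat
          by simp
        ultimately show ?thesis unfolding e 2(2) group_medians_Nil filter.simps(1) list.size(3)
          by (blast intro: add)
      qed
    qed simp
  qed
  then show "set (group_medians f xs) \<subseteq> set xs" "distinct (group_medians f xs)"
    "3 * length (filter (\<lambda>z. f z \<le> a) (group_medians f xs)) \<le> length (filter (\<lambda>z. f z \<le> a) xs) + 2"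
    "3 * length (filter (\<lambda>z. a < f z) (group_medians f xs)) \<le> length (filter (\<lambda>z. a < f z) xs) + 2"
    by blast+
qed

text \<open>From 3 * |ms| \<le> 2 * hi + 7 and |xs| \<le> 5 * |ms| follows 3 * |xs| \<le> 10 * hi +
  35, which is the bound on \<open>lo\<close> because \<open>lo + hi = length xs\<close>. For short
  lists these bounds say nothing, so nonemptiness of both parts is stated separately; the recursion
  needs it to terminate.\<close>

lemma median_of_medians_split:
  assumes "inj_on f (set xs)" "distinct xs" "2 \<le> length xs"
    and "has_rank f (group_medians f xs) ((length (group_medians f xs) - 1) div 2) p"
  defines "lo \<equiv> length (filter (\<lambda>z. f z \<le> f p) xs)" and "hi \<equiv> length (filter (\<lambda>z. f p < f z) xs)"
  shows "p \<in> set xs" "lo + hi = length xs" "0 < lo" "0 < hi"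
    "10 * lo \<le> 7 * length xs + 35" "10 * hi \<le> 7 * length xs + 35"
proof -
  define ms where "ms = group_medians f xs"
  note gm = group_medians_props[OF assms(1,2), folded ms_def]
  have len: "length ms = (length xs + 4) div 5" by (simp add: ms_def length_group_medians)
  have mspos: "0 < length ms" using assms(3) len by auto
  have inj: "inj_on f (set ms)" using gm(1) assms(1) by (meson inj_on_subset)
  have p: "has_rank f ms ((length ms - 1) div 2) p" using assms(4) by (simp add: ms_def)
  have pms: "p \<in> set ms" using p by (simp add: has_rank_def)
  then show pxs: "p \<in> set xs" using gm by blast
  show sum: "lo + hi = length xs" by (simp add: lo_def hi_def length_filter_le_gt)
  have a: "length (filter (\<lambda>z. f z \<le> f p) ms) = Suc ((length ms - 1) div 2)"
    using has_rank_le[OF inj gm(2) p] .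
  then have b: "length (filter (\<lambda>z. f p < f z) ms) = length ms - Suc ((length ms - 1) div 2)"
    using length_filter_le_gt[of f "f p" ms] by linarith
  have half: "length ms \<le> 2 * Suc ((length ms - 1) div 2)" "2 * ((length ms - 1) div 2) < length ms"
    using mspos by presburger+
  have lo: "3 * Suc ((length ms - 1) div 2) \<le> lo + 2"
    using gm(3)[of "f p"] a by (simp add: lo_def)
  have hi: "3 * (length ms - Suc ((length ms - 1) div 2)) \<le> hi + 2"
    using gm(4)[of "f p"] b by (simp add: hi_def)
  show "0 < lo" using lo by (cases lo) auto
  show "0 < hi"
  proof (cases "length ms = 1")
    case False
    then have "1 \<le> length ms - Suc ((length ms - 1) div 2)" using mspos by linarith
    then show ?thesis using hi by linarith
  next
    \<comment> \<open>A single median makes the lower bound on \<open>hi\<close> vacuous. Here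
      \<open>xs\<close> is one group of at least two entries, and its lower median is not its
      maximum.\<close>
    case True
    then have l5: "length xs \<le> 5" using len by linarith
    define c where "c = (length xs - 1) div 2"
    have ms: "ms = [rank_of f xs c]"
      using l5 assms(3) unfolding ms_def c_def by (subst group_medians.simps) auto
    have "c < length xs" using assms(3) by (simp add: c_def)
    then have "has_rank f xs c p"
      using has_rank_rank_of[OF assms(1,2)] pms ms by simp
    then have "lo = Suc c" using has_rank_le[OF assms(1,2)] by (simp add: lo_def)
    then show ?thesis using sum assms(3) unfolding c_def by linarith
  qed
  have "length xs \<le> 5 * length ms" using len by linarith
  moreover have "3 * length ms \<le> 2 * lo + 4" using lo half by linarith
  moreover have "3 * length ms \<le> 2 * hi + 7" using hi half by linarith
  ultimately show "10 * lo \<le> 7 * length xs + 35" "10 * hi \<le> 7 * length xs + 35"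
    using sum by linarith+
qed

section \<open>Translating a range query to one part of a split\<close>

definition count_upto :: "('b \<Rightarrow> bool) \<Rightarrow> 'b list \<Rightarrow> nat \<Rightarrow> nat" where
  "count_upto P xs i = length (filter P (take i xs))"

text \<open>
  A query \<open>(l, r, c, p)\<close> asks for the element with \<open>c\<close> smaller ones among the entries with
  indices \<open>l \<le> i < r\<close> (counted from 0); the answer goes to memory cell \<open>p\<close>.
\<close>

fun valid_query :: "nat \<Rightarrow> nat \<times> nat \<times> nat \<times> nat \<Rightarrow> bool" where
  "valid_query n (l, r, c, p) \<longleftrightarrow> l < r \<and> r \<le> n \<and> c < r - l"

fun out :: "nat \<times> nat \<times> nat \<times> nat \<Rightarrow> nat" where
  "out (l, r, c, p) = p"

fun answered :: "(nat \<Rightarrow> 'a::linorder) \<Rightarrow> nat list \<Rightarrow> (nat \<Rightarrow> nat) \<Rightarrow> nat \<times> nat \<times> nat \<times> nat \<Rightarrow> bool" where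
  "answered f xs M (l, r, c, p) \<longleftrightarrow> has_rank f (drop l (take r xs)) c (M p)"

text \<open>Within the range all low elements are smaller than all high ones, so rank
  \<open>c\<close> belongs to a low element exactly when \<open>c\<close> is below their number, a
  difference of two prefix counts.\<close>

fun goes_low :: "('b \<Rightarrow> bool) \<Rightarrow> 'b list \<Rightarrow> nat \<times> nat \<times> nat \<times> nat \<Rightarrow> bool" where
  "goes_low P xs (l, r, c, p) \<longleftrightarrow> c < count_upto P xs r - count_upto P xs l"

fun low_query :: "('b \<Rightarrow> bool) \<Rightarrow> 'b list \<Rightarrow> nat \<times> nat \<times> nat \<times> nat \<Rightarrow> nat \<times> nat \<times> nat \<times> nat" where
  "low_query P xs (l, r, c, p) = (count_upto P xs l, count_upto P xs r, c, p)"

fun high_query :: "('b \<Rightarrow> bool) \<Rightarrow> 'b list \<Rightarrow> nat \<times> nat \<times> nat \<times> nat \<Rightarrow> nat \<times> nat \<times> nat \<times> nat" where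
  "high_query P xs (l, r, c, p) =
     (l - count_upto P xs l, r - count_upto P xs r, c - (count_upto P xs r - count_upto P xs l), p)"

text \<open>Under filtering, the boundaries of a slice turn into prefix counts; no search for the
  new interval is necessary.\<close>

lemma filter_slice:
  assumes "l \<le> r" "r \<le> length xs"
  shows "filter P (drop l (take r xs)) = drop (count_upto P xs l) (take (count_upto P xs r) (filter P xs))"
    and "count_upto P xs r = count_upto P xs l + length (filter P (drop l (take r xs)))"
    and "count_upto P xs r \<le> length (filter P xs)"
proof -
  have t: "take r xs = take l xs @ drop l (take r xs)"
    using append_take_drop_id[of l "take r xs"] assms(1) by (simp add: min_def)
  then have ft: "filter P (take r xs) = filter P (take l xs) @ filter P (drop l (take r xs))"
    by (metis filter_append)
  then show "count_upto P xs r = count_upto P xs l + length (filter P (drop l (take r xs)))"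
    by (simp add: count_upto_def)
  have "filter P xs = filter P (take r xs) @ filter P (drop r xs)"
    by (metis append_take_drop_id filter_append)
  then show "count_upto P xs r \<le> length (filter P xs)"
    "filter P (drop l (take r xs)) = drop (count_upto P xs l) (take (count_upto P xs r) (filter P xs))"
    using ft by (simp_all add: count_upto_def)
qed

lemma count_upto_compl:
  assumes "i \<le> length xs"
  shows "count_upto (\<lambda>z. \<not> P z) xs i = i - count_upto P xs i"
  using sum_length_filter_compl[of P "take i xs"] assms by (simp add: count_upto_def)

text \<open>Whatever is smaller than a low element is low, so filtering does not change the number
  of smaller elements in the range.\<close>

lemma low_query_correct:
  assumes "valid_query (length xs) q" "goes_low (\<lambda>z. f z \<le> a) xs q"
  defines "P \<equiv> \<lambda>z. f z \<le> a"
  shows "valid_query (length (filter P xs)) (low_query P xs q)"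
    "answered f (filter P xs) M (low_query P xs q) \<Longrightarrow> answered f xs M q"
proof -
  obtain l r c p where q: "q = (l, r, c, p)" by (metis prod_cases4)
  have lr: "l \<le> r" "r \<le> length xs" and c: "c < count_upto P xs r - count_upto P xs l"
    using assms by (auto simp: q)
  note fs = filter_slice[OF lr, of P]
  show "valid_query (length (filter P xs)) (low_query P xs q)"
    using fs(2,3) c by (auto simp: q)
  assume "answered f (filter P xs) M (low_query P xs q)"
  then have h: "has_rank f (filter P (drop l (take r xs))) c (M p)"
    by (simp add: q fs(1))
  then have "P (M p)" by (simp add: has_rank_def)
  then have "filter (\<lambda>z. f z < f (M p)) (filter P ys) = filter (\<lambda>z. f z < f (M p)) ys" for ys
    by (auto simp: P_def intro!: filter_cong)
  then show "answered f xs M q" using h by (simp add: q has_rank_def)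
qed

text \<open>All low elements of the range are smaller than a high answer; dropping them lowers its
  rank by exactly their number.\<close>

lemma high_query_correct:
  assumes "valid_query (length xs) q" "\<not> goes_low (\<lambda>z. f z \<le> a) xs q"
  defines "P \<equiv> \<lambda>z. f z \<le> a"
  shows "valid_query (length (filter (\<lambda>z. \<not> P z) xs)) (high_query P xs q)"
    "answered f (filter (\<lambda>z. \<not> P z) xs) M (high_query P xs q) \<Longrightarrow> answered f xs M q"
proof -
  obtain l r c p where q: "q = (l, r, c, p)" by (metis prod_cases4)
  let ?N = "\<lambda>z. \<not> P z"
  define mid where "mid = drop l (take r xs)"
  have lr: "l \<le> r" "r \<le> length xs" and c: "\<not> c < count_upto P xs r - count_upto P xs l"
    "c < r - l" using assms by (auto simp: q)
  note fs = filter_slice[OF lr, of P, folded mid_def]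
  note fn = filter_slice[OF lr, of ?N, folded mid_def]
  have w: "count_upto P xs r - count_upto P xs l = length (filter P mid)" using fs(2) by simp
  have len: "length (filter P mid) + length (filter ?N mid) = r - l"
    using sum_length_filter_compl[of P mid] lr by (simp add: mid_def)
  have e: "high_query P xs q =
    (count_upto ?N xs l, count_upto ?N xs r, c - length (filter P mid), p)"
    using lr w by (simp add: q count_upto_compl)
  show "valid_query (length (filter ?N xs)) (high_query P xs q)"
    using fn(2,3) c w len unfolding e by auto
  assume "answered f (filter ?N xs) M (high_query P xs q)"
  then have h: "has_rank f (filter ?N mid) (c - length (filter P mid)) (M p)"
    by (simp add: e fn(1))
  then have "a < f (M p)" by (simp add: has_rank_def P_def not_le)
  then have "filter P mid = filter P (filter (\<lambda>z. f z < f (M p)) mid)"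
    by (auto simp: P_def intro!: filter_cong)
  moreover have "filter (\<lambda>z. f z < f (M p)) (filter ?N mid) = filter ?N (filter (\<lambda>z. f z < f (M p)) mid)"
    by (simp add: conj_commute)
  ultimately have "length (filter (\<lambda>z. f z < f (M p)) mid) = c"
    using sum_length_filter_compl[of P "filter (\<lambda>z. f z < f (M p)) mid"] h c w
    unfolding has_rank_def by simp
  then show "answered f xs M q" using h by (simp add: q has_rank_def mid_def)
qed

section \<open>The selection program\<close>

text \<open>
  Registers 2 to 7 of the recursive procedure hold the base address and length of an array of
  positions, the base address and number of a list of queries, the first free memory cell, and the
  address of the caller's frame; the others are scratch.  Memory is never freed.
\<close>

definition count_smaller :: com where
  "count_smaller = While (Less 13 10)
     (Seq (blk [Load 15 13, Const 8 1, Add 13 13 8])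
       (If (LessElem 15 12) (blk [Add 14 14 8]) (blk [Const 8 0])))"

lemma count_smaller:
  assumes "arr M (R 13) zs" "R 10 = R 13 + length zs"
    and "set zs \<subseteq> {1..length S}" "R 12 \<in> {1..length S}"
  shows "achieves P S count_smaller R M (6 * length zs + 1) (\<lambda>R' M'. M' = M \<and>
    R' 14 = R 14 + length (filter (\<lambda>z. elem S z < elem S (R 12)) zs) \<and>
    (\<forall>i. i \<notin> {8, 13, 14, 15} \<longrightarrow> R' i = R i))"
proof -
  let ?I = "\<lambda>zs' R' M'. M' = M \<and> arr M (R' 13) zs' \<and> R 10 = R' 13 + length zs' \<and>
    set zs' \<subseteq> {1..length S} \<and>
    R' 14 + length (filter (\<lambda>z. elem S z < elem S (R 12)) zs') =
      R 14 + length (filter (\<lambda>z. elem S z < elem S (R 12)) zs) \<and>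
    (\<forall>i. i \<notin> {8, 13, 14, 15} \<longrightarrow> R' i = R i)"
  have "achieves P S count_smaller R M ((5 + 1) * length zs + 1) (?I [])"
    unfolding count_smaller_def
  proof (rule achieves_While_list[where I = ?I], goal_cases)
    case (2 z zs R1 M1)
    note h = this
    have "achieves P S (Seq (blk [Load 15 13, Const 8 1, Add 13 13 8])
       (If (LessElem 15 12) (blk [Add 14 14 8]) (blk [Const 8 0]))) R1 M1 5 (?I zs)"
    proof (rule achieves_blk_Seq[where ?T1.0 = 2], simp, rule achieves_If[where T = 1], goal_cases)
      case 1
      then show ?case using h assms(4) by auto
    next
      case 2
      then show ?case using h by (intro achieves_blk) auto
    next
      case 3
      then show ?case using h by (intro achieves_blk) auto
    qed auto
    then show ?case using h by auto
  qed (use assms in auto)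
  then show ?thesis by (rule achieves_mono) auto
qed

text \<open>Selection by counting is quadratic, but it is applied only to groups of at most five.
  Equality of counts is the failure of both strict tests, and \<open>Const 8 0\<close> on a scratch
  register serves as a skip.\<close>

definition pick_median :: com where
  "pick_median = While (Less 11 10)
     (Seq (blk [Load 12 11, Const 14 0, Add 13 9 14])
     (Seq count_smaller
     (Seq (If (Less 14 17) (blk [Const 8 0])
            (If (Less 17 14) (blk [Const 8 0]) (blk [Store 6 12])))
       (blk [Const 8 1, Add 11 11 8]))))"

lemma pick_median:
  assumes "arr M (R 9) g" "R 10 = R 9 + length g" "R 11 = R 9" "R 10 \<le> R 6"
    and g: "set g \<subseteq> {1..length S}" "inj_on (elem S) (set g)"
    and p: "has_rank (elem S) g (R 17) p"
  shows "achieves P S pick_median R M ((6 * length g + 10) * length g + 1) (\<lambda>R' M'.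
    M' = M(R 6 := p) \<and> (\<forall>i. i \<notin> {8, 11, 12, 13, 14, 15} \<longrightarrow> R' i = R i))"
proof -
  let ?I = "\<lambda>xs R' M'. arr M' (R' 11) xs \<and> R 10 = R' 11 + length xs \<and> set xs \<subseteq> set g \<and>
    arr M' (R 9) g \<and> (\<forall>a. a \<noteq> R 6 \<longrightarrow> M' a = M a) \<and> (p \<in> set xs \<or> M' (R 6) = p) \<and>
    (\<forall>i. i \<notin> {8, 11, 12, 13, 14, 15} \<longrightarrow> R' i = R i)"
  have "achieves P S pick_median R M ((6 * length g + 9 + 1) * length g + 1) (?I [])"
    unfolding pick_median_def
  proof (rule achieves_While_list[where I = ?I], goal_cases)
    case 1
    then show ?case using assms by (auto simp: has_rank_def)
  next
    case (2 x xs R1 M1)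
    note h = this
    have x: "x \<in> set g" and R1: "R1 9 = R 9" "R1 10 = R 10" "R1 6 = R 6" "R1 17 = R 17"
      using h by auto
    let ?c = "length (filter (\<lambda>z. elem S z < elem S x) g)"
    let ?Q = "\<lambda>R2 M2. M2 = M1 \<and> R2 12 = x \<and> R2 14 = ?c \<and>
      (\<forall>i. i \<notin> {8, 12, 13, 14, 15} \<longrightarrow> R2 i = R1 i)"
    have eq: "?c = R 17 \<longleftrightarrow> x = p"
      using x p g(2) has_rank_unique[of "elem S" g "R 17" x p] by (auto simp: has_rank_def)
    have "achieves P S (Seq (blk [Load 12 11, Const 14 0, Add 13 9 14])
     (Seq count_smaller
     (Seq (If (Less 14 17) (blk [Const 8 0])
            (If (Less 17 14) (blk [Const 8 0]) (blk [Store 6 12])))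
       (blk [Const 8 1, Add 11 11 8])))) R1 M1 (6 * length g + 9) (?I xs)"
    proof (rule achieves_blk_Seq[where ?T1.0 = "6 * length g + 6"], simp, goal_cases)
      case (1 R2 M2)
      then have e: "M2 = M1" "R2 12 = x" "R2 14 = 0" "R2 13 = R1 9"
        "\<And>i. i \<notin> {12, 13, 14} \<Longrightarrow> R2 i = R1 i" using h by auto
      show ?case
      proof (rule achieves_Seq[where ?Q1.0 = ?Q and ?T2.0 = 5])
        have "achieves P S count_smaller R2 M2 (6 * length g + 1) (\<lambda>R' M'. M' = M2 \<and>
          R' 14 = R2 14 + length (filter (\<lambda>z. elem S z < elem S (R2 12)) g) \<and>
          (\<forall>i. i \<notin> {8, 13, 14, 15} \<longrightarrow> R' i = R2 i))"
          by (rule count_smaller) (use e h x g(1) assms(2) in auto)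
        then show "achieves P S count_smaller R2 M2 (6 * length g + 1) ?Q"
          by (rule achieves_mono) (use e in auto)
      next
        fix R3 M3 assume q: "?Q R3 M3"
        show "achieves P S (Seq (If (Less 14 17) (blk [Const 8 0])
            (If (Less 17 14) (blk [Const 8 0]) (blk [Store 6 12])))
          (blk [Const 8 1, Add 11 11 8])) R3 M3 5 (?I xs)"
        proof (rule achieves_Seq[where ?T1.0 = 3 and ?T2.0 = 2 and ?Q1.0 = "\<lambda>R4 M4.
            M4 = (if x = p then M1(R 6 := p) else M1) \<and> (\<forall>i. i \<notin> {8} \<longrightarrow> R4 i = R3 i)"])
          show "achieves P S (If (Less 14 17) (blk [Const 8 0])
              (If (Less 17 14) (blk [Const 8 0]) (blk [Store 6 12]))) R3 M3 3
            (\<lambda>R4 M4. M4 = (if x = p then M1(R 6 := p) else M1) \<and> (\<forall>i. i \<notin> {8} \<longrightarrow> R4 i = R3 i))"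
          proof (rule achieves_If[where T = 2], goal_cases)
            case 2
            then show ?case using q eq R1 by (intro achieves_blk) auto
          next
            case 3
            show ?case
            proof (rule achieves_If[where T = 1], goal_cases)
              case 2
              then show ?case using q eq R1 by (intro achieves_blk) auto
            next
              case 3
              then show ?case using \<open>\<not> test_val S (Less 14 17) (R3, M3)\<close> q eq R1
                by (intro achieves_blk) auto
            qed auto
          qed auto
        next
          fix R4 M4
          assume r: "M4 = (if x = p then M1(R 6 := p) else M1) \<and> (\<forall>i. i \<notin> {8} \<longrightarrow> R4 i = R3 i)"
          have gM: "arr M4 (R 9) g"
            by (rule arr_cong[of M1]) (use r h assms(2,4) in auto)
          have xM: "arr M4 (Suc (R1 11)) xs"
            by (rule arr_cong[of M1]) (use r h assms(2,4) in auto)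
          have "p \<in> set xs \<or> M4 (R 6) = p" "\<forall>a. a \<noteq> R 6 \<longrightarrow> M4 a = M a"
            using r h by auto
          moreover have "\<And>i. i \<noteq> 8 \<Longrightarrow> R4 i = R3 i" using r by blast
          ultimately show "achieves P S (blk [Const 8 1, Add 11 11 8]) R4 M4 2 (?I xs)"
            using gM xM q h by (intro achieves_blk) auto
        qed simp
      qed simp
    qed simp
    then show ?case using h by auto
  qed (use assms in auto)
  then show ?thesis by (rule achieves_mono) (auto simp: algebra_simps)
qed

text \<open>Truncated subtraction computes a minimum: \<open>R[18] - (R[18] - (R[9] + 5))\<close> is
  the end of the next group even if fewer than five entries are left.\<close>

definition write_group_medians :: com where
  "write_group_medians = While (Less 9 18)
     (Seq (blk [Const 8 5, Add 10 9 8, Sub 8 18 10, Sub 10 18 8, Sub 17 10 9, Const 8 1,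
       Sub 17 17 8, Half 17 17, Const 8 0, Add 11 9 8])
     (Seq pick_median (blk [Const 8 1, Add 6 6 8, Const 8 0, Add 9 10 8])))"

text \<open>An iteration consumes up to five entries, but the bound charges one iteration per entry;
  linear time is all that is asked for. An iteration takes at most 10 + 201 + 4 units and a test,
  hence 216.\<close>

lemma write_group_medians:
  assumes "arr M (R 9) xs" "R 18 = R 9 + length xs" "R 18 \<le> R 6"
    and xs: "set xs \<subseteq> {1..length S}" "inj_on (elem S) (set xs)" "distinct xs"
  shows "achieves P S write_group_medians R M (216 * length xs + 1) (\<lambda>R' M'.
    arr M' (R 6) (group_medians (elem S) xs) \<and>
    R' 6 = R 6 + length (group_medians (elem S) xs) \<and> (\<forall>a < R 6. M' a = M a) \<and>
    (\<forall>i. i \<notin> {6, 8, 9, 10, 11, 12, 13, 14, 15, 17} \<longrightarrow> R' i = R i))"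
proof -
  let ?m = "group_medians (elem S)"
  let ?I = "\<lambda>ys R' M'. arr M' (R' 9) ys \<and> R 18 = R' 9 + length ys \<and> set ys \<subseteq> set xs \<and>
    distinct ys \<and> R 6 \<le> R' 6 \<and> (\<forall>a < R 6. M' a = M a) \<and>
    (\<exists>ms. arr M' (R 6) ms \<and> R' 6 = R 6 + length ms \<and> ms @ ?m ys = ?m xs) \<and>
    (\<forall>i. i \<notin> {6, 8, 9, 10, 11, 12, 13, 14, 15, 17} \<longrightarrow> R' i = R i)"
  have "achieves P S write_group_medians R M ((215 + 1) * length xs + 1) (?I [])"
    unfolding write_group_medians_def
  proof (rule achieves_While[where I = ?I and \<mu> = length], goal_cases)
    case 1
    then show ?case using assms by auto
  next
    case (2 ys R1 M1)
    note h = this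
    then have ys: "ys \<noteq> []" by auto
    define g where "g = take 5 ys"
    define c where "c = (length g - 1) div 2"
    define p where "p = rank_of (elem S) g c"
    have g: "set g \<subseteq> set xs" "g \<noteq> []" "length g \<le> 5"
      using ys h set_take_subset[of 5 ys] by (auto simp: g_def)
    have inj: "inj_on (elem S) (set g)" using g(1) xs(2) by (meson inj_on_subset)
    have "c < length g" using g(2) unfolding c_def by (cases g) auto
    then have p: "has_rank (elem S) g c p"
      unfolding p_def using inj h by (intro has_rank_rank_of) (auto simp: g_def)
    have m: "?m ys = p # ?m (drop 5 ys)"
      using ys by (subst group_medians.simps) (simp add: p_def c_def g_def)
    have arrs: "arr M1 (R1 9) (g @ drop 5 ys)" using h by (simp add: g_def)
    have len: "length g = min 5 (length ys)" "length g + (length ys - 5) = length ys"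
      by (auto simp: g_def)
    obtain ms where ms: "arr M1 (R 6) ms" "R1 6 = R 6 + length ms" "ms @ ?m ys = ?m xs"
      using h by blast
    let ?Q = "\<lambda>R3 M3. M3 = M1(R1 6 := p) \<and> R3 10 = R1 9 + length g \<and>
      (\<forall>i. i \<notin> {8, 10, 11, 12, 13, 14, 15, 17} \<longrightarrow> R3 i = R1 i)"
    have "achieves P S (Seq (blk [Const 8 5, Add 10 9 8, Sub 8 18 10, Sub 10 18 8, Sub 17 10 9,
       Const 8 1, Sub 17 17 8, Half 17 17, Const 8 0, Add 11 9 8])
     (Seq pick_median (blk [Const 8 1, Add 6 6 8, Const 8 0, Add 9 10 8]))) R1 M1 215
     (?I (drop 5 ys))"
    proof (rule achieves_blk_Seq[where ?T1.0 = 205], simp, goal_cases)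
      case (1 R2 M2)
      have "R1 18 = R1 9 + length ys" using h by auto
      then have e: "M2 = M1" "R2 10 = R1 9 + length g" "R2 11 = R1 9" "R2 17 = c"
        "\<And>i. i \<notin> {8, 10, 11, 17} \<Longrightarrow> R2 i = R1 i"
        using 1 len(1) by (auto simp: c_def)
      show ?case
      proof (rule achieves_Seq[where ?Q1.0 = ?Q and ?T1.0 = 201 and ?T2.0 = 4])
        have "achieves P S pick_median R2 M2 ((6 * length g + 10) * length g + 1) (\<lambda>R' M'.
          M' = M2(R2 6 := p) \<and> (\<forall>i. i \<notin> {8, 11, 12, 13, 14, 15} \<longrightarrow> R' i = R2 i))"
          by (rule pick_median) (use e h assms(3) p g xs(1) inj arrs len in \<open>auto simp: arr_append\<close>)
        moreover have "(6 * length g + 10) * length g + 1 \<le> (6 * 5 + 10) * 5 + 1"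
          by (intro add_mono mult_mono) (use g(3) in auto)
        ultimately show "achieves P S pick_median R2 M2 201 ?Q"
          by (elim achieves_mono) (use e in auto)
      next
        fix R3 M3 assume q: "?Q R3 M3"
        have "arr M3 (R 6) ms" by (rule arr_cong[OF ms(1)]) (use q ms(2) in auto)
        moreover have "arr M3 (R1 9 + length g) (drop 5 ys)"
          by (rule arr_cong[of M1]) (use arrs q h assms(3) len in \<open>auto simp: arr_append\<close>)
        moreover have "set (drop 5 ys) \<subseteq> set xs" using h by (meson order_trans set_drop_subset)
        ultimately show "achieves P S (blk [Const 8 1, Add 6 6 8, Const 8 0, Add 9 10 8]) R3 M3 4
          (?I (drop 5 ys))"
          using q h ms m len
          by (intro achieves_blk) (auto simp: arr_append intro!: exI[of _ "ms @ [p]"])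
      qed simp
    qed simp
    then show ?case using ys by (intro exI[of _ "drop 5 ys"]) simp
  qed auto
  then show ?thesis by (rule achieves_mono) auto
qed

definition write_answers :: com where
  "write_answers = Seq (blk [Load 9 2, Add 10 5 5, Add 10 10 10, Add 10 4 10])
     (While (Less 4 10)
       (blk [Const 8 3, Add 11 4 8, Load 11 11, Store 11 9, Const 8 4, Add 4 4 8]))"

text \<open>This serves arrays with one element, which answers every valid query. Answers are
  written while queries are still being read, so no answer cell may lie in the query list.\<close>

lemma write_answers:
  assumes "qarr M (R 4) qs" "R 5 = length qs"
    and "\<forall>q \<in> set qs. out q \<notin> {R 4..<R 4 + 4 * length qs}"
  shows "achieves P S write_answers R M (7 * length qs + 5) (\<lambda>R' M'.
    (\<forall>q \<in> set qs. M' (out q) = M (R 2)) \<and> (\<forall>a. a \<notin> out ` set qs \<longrightarrow> M' a = M a) \<and>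
    R' 6 = R 6 \<and> R' 7 = R 7)"
  unfolding write_answers_def
proof (rule achieves_blk_Seq[where ?T1.0 = "(6 + 1) * length qs + 1"], simp, goal_cases)
  case (1 R0 M0)
  then have e: "M0 = M" "R0 9 = M (R 2)" "R0 10 = R 4 + 4 * length qs" "R0 4 = R 4" "R0 6 = R 6"
    "R0 7 = R 7" using assms by auto
  show ?case
  proof (rule achieves_While_list[where I = "\<lambda>xs R' M'. qarr M' (R' 4) xs \<and>
      R 4 \<le> R' 4 \<and> R 4 + 4 * length qs = R' 4 + 4 * length xs \<and> R' 10 = R 4 + 4 * length qs \<and>
      set xs \<subseteq> set qs \<and> R' 9 = M (R 2) \<and> (\<forall>a. a \<notin> out ` set qs \<longrightarrow> M' a = M a) \<and>
      (\<forall>q \<in> set qs. q \<in> set xs \<or> M' (out q) = M (R 2)) \<and> R' 6 = R 6 \<and> R' 7 = R 7"],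
      goal_cases)
    case 1
    then show ?case using e assms by auto
  next
    case (2 q qs' R1 M1)
    obtain l r c p where q: "q = (l, r, c, p)" by (metis prod_cases4)
    have "q \<in> set qs" "out q = p" using 2 q by auto
    then have pq: "p \<in> out ` set qs" "p \<notin> {R 4..<R 4 + 4 * length qs}"
      using assms(3) by blast+
    have m: "qarr (M1(p := M (R 2))) (R1 4 + 4) qs'"
      by (rule qarr_cong[of M1]) (use 2 q pq(2) in auto)
    have p: "M1 (R1 4 + 3) = p" using 2 q by (simp add: numeral_3_eq_3)
    show ?case
    proof (intro conjI achieves_blk)
      show "R1 4 < R1 10" using 2 by auto
    next
      fix R2 M2
      assume "fold step [Const 8 3, Add 11 4 8, Load 11 11, Store 11 9, Const 8 4, Add 4 4 8] (R1, M1) =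
        (R2, M2)"
      then have "M2 = M1(p := M (R 2))" "R2 4 = R1 4 + 4" "\<And>i. i \<notin> {4, 8, 11} \<Longrightarrow> R2 i = R1 i"
        using 2 p by auto
      then show "qarr M2 (R2 4) qs'" "R 4 \<le> R2 4" "R 4 + 4 * length qs = R2 4 + 4 * length qs'"
        "R2 10 = R 4 + 4 * length qs" "set qs' \<subseteq> set qs" "R2 9 = M (R 2)"
        "\<forall>a. a \<notin> out ` set qs \<longrightarrow> M2 a = M a" "R2 6 = R 6" "R2 7 = R 7"
        "\<forall>q\<in>set qs. q \<in> set qs' \<or> M2 (out q) = M (R 2)"
        using 2 m pq q by auto
    qed auto
  next
    case (3 R1 M1)
    then show ?case by auto
  qed
qed simp

text \<open>Three areas are filled in step: low entries, high entries, and prefix counts, each count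
  being the current fill level of the low area. The test asks whether the pivot is smaller, so the
  pivot itself goes to the low part.\<close>

definition partition_elements :: com where
  "partition_elements = While (Less 16 17)
     (Seq (blk [Load 18 16, Const 8 1, Add 16 16 8, Add 15 15 8])
     (Seq (If (LessElem 12 18) (blk [Store 14 18, Add 14 14 8]) (blk [Store 13 18, Add 13 13 8]))
       (blk [Sub 19 13 6, Store 15 19])))"

text \<open>The loop does not write the count of the empty prefix, hence the premise
  \<open>M (R 15) = 0\<close>.\<close>

lemma partition_elements:
  fixes S :: "'a::linorder list"
  assumes "arr M (R 16) xs" "R 17 = R 16 + length xs" "R 17 \<le> R 6" "R 13 = R 6"
    "R 14 = R 6 + length xs" "R 15 = R 6 + 2 * length xs" "M (R 15) = 0"
    "set xs \<subseteq> {1..length S}" "R 12 \<in> {1..length S}"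
  defines "Q \<equiv> \<lambda>z. elem S z \<le> elem S (R 12)"
  shows "achieves P S partition_elements R M (10 * length xs + 1) (\<lambda>R' M'.
    arr M' (R 6) (filter Q xs) \<and> arr M' (R 6 + length xs) (filter (\<lambda>z. \<not> Q z) xs) \<and>
    (\<forall>i \<le> length xs. M' (R 6 + 2 * length xs + i) = count_upto Q xs i) \<and>
    R' 13 = R 6 + length (filter Q xs) \<and>
    R' 14 = R 6 + length xs + length (filter (\<lambda>z. \<not> Q z) xs) \<and>
    R' 15 = R 6 + 3 * length xs \<and> (\<forall>a < R 6. M' a = M a) \<and>
    (\<forall>i. i \<notin> {8, 13, 14, 15, 16, 18, 19} \<longrightarrow> R' i = R i))"
proof -
  let ?I = "\<lambda>zs R' M'. \<exists>ys. xs = ys @ zs \<and> arr M' (R' 16) zs \<and> R 17 = R' 16 + length zs \<and>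
    arr M' (R 6) (filter Q ys) \<and> arr M' (R 6 + length xs) (filter (\<lambda>z. \<not> Q z) ys) \<and>
    (\<forall>i \<le> length ys. M' (R 6 + 2 * length xs + i) = count_upto Q xs i) \<and>
    R' 13 = R 6 + length (filter Q ys) \<and>
    R' 14 = R 6 + length xs + length (filter (\<lambda>z. \<not> Q z) ys) \<and>
    R' 15 = R 6 + 2 * length xs + length ys \<and> (\<forall>a < R 6. M' a = M a) \<and>
    (\<forall>i. i \<notin> {8, 13, 14, 15, 16, 18, 19} \<longrightarrow> R' i = R i)"
  have "achieves P S partition_elements R M ((9 + 1) * length xs + 1) (?I [])"
    unfolding partition_elements_def
  proof (rule achieves_While_list[where I = ?I], goal_cases)
    case 1
    then show ?case using assms(1-7) by (intro exI[of _ "[]"]) (auto simp: count_upto_def)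
  next
    case (2 z zs R1 M1)
    then obtain ys where h: "xs = ys @ z # zs" "arr M1 (R1 16) (z # zs)"
      "R 17 = R1 16 + length (z # zs)" "arr M1 (R 6) (filter Q ys)"
      "arr M1 (R 6 + length xs) (filter (\<lambda>z. \<not> Q z) ys)"
      "\<forall>i \<le> length ys. M1 (R 6 + 2 * length xs + i) = count_upto Q xs i"
      "R1 13 = R 6 + length (filter Q ys)"
      "R1 14 = R 6 + length xs + length (filter (\<lambda>z. \<not> Q z) ys)"
      "R1 15 = R 6 + 2 * length xs + length ys" "\<forall>a < R 6. M1 a = M a"
      "\<forall>i. i \<notin> {8, 13, 14, 15, 16, 18, 19} \<longrightarrow> R1 i = R i" by blast
    have R1: "R1 12 = R 12" "R1 6 = R 6" "R1 17 = R 17" using h by auto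
    have z: "z \<in> {1..length S}" using assms(8) h(1) by auto
    have len: "length (filter Q ys) \<le> length ys" "length (filter (\<lambda>z. \<not> Q z) ys) \<le> length ys"
      "length xs = Suc (length ys + length zs)"
      using h(1) by auto
    have cnt: "count_upto Q xs (Suc (length ys)) = length (filter Q ys) + (if Q z then 1 else 0)"
      "count_upto Q xs (Suc (length ys)) = length (filter Q (ys @ [z]))"
      using h(1) by (auto simp: count_upto_def)
    define M2 where "M2 = (if Q z then M1(R1 13 := z) else M1(R1 14 := z))"
    define M3 where "M3 = M2(Suc (R1 15) := count_upto Q xs (Suc (length ys)))"
    have M3: "M3 a = M1 a" if "a \<noteq> R1 13" "a \<noteq> R1 14" "a \<noteq> Suc (R1 15)" for a
      using that unfolding M3_def M2_def by simp
    have bounds: "R 6 \<le> R1 13" "R1 13 < R 6 + length xs" "R 6 + length xs \<le> R1 14"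
      "R1 14 < R 6 + 2 * length xs" "R 6 + 2 * length xs \<le> R1 15"
      unfolding h(7-9) using len by linarith+
    then have M3z: "M3 (if Q z then R1 13 else R1 14) = z"
      unfolding M3_def M2_def by auto
    have "arr M3 (R 6) (filter Q ys)"
      by (rule arr_cong[OF h(4)], rule M3) (use bounds h(7) in linarith)+
    then have a1: "arr M3 (R 6) (filter Q (ys @ [z]))"
      using M3z h(7) by (auto simp: arr_append)
    have "arr M3 (R 6 + length xs) (filter (\<lambda>z. \<not> Q z) ys)"
      by (rule arr_cong[OF h(5)], rule M3) (use bounds h(8) in linarith)+
    then have a2: "arr M3 (R 6 + length xs) (filter (\<lambda>z. \<not> Q z) (ys @ [z]))"
      using M3z h(8) by (auto simp: arr_append)
    have a3: "arr M3 (Suc (R1 16)) zs"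
      proof (rule arr_cong[of M1], goal_cases)
      case (2 i)
      show ?case by (rule M3) (use 2 bounds h(3) assms(3) in auto)
    qed (use h(2) in simp)
    have a4: "\<forall>i \<le> length (ys @ [z]). M3 (R 6 + 2 * length xs + i) = count_upto Q xs i"
    proof (intro allI impI)
      fix i assume "i \<le> length (ys @ [z])"
      then consider "i \<le> length ys" | "i = Suc (length ys)" by fastforce
      then show "M3 (R 6 + 2 * length xs + i) = count_upto Q xs i"
      proof cases
        case 1
        then show ?thesis using M3[of "R 6 + 2 * length xs + i"] h(6,9) bounds by auto
      next
        case 2
        then show ?thesis using h(9) by (simp add: M3_def)
      qed
    qed
    have a5: "\<forall>a < R 6. M3 a = M a" using M3 h(10) bounds by auto
    have "achieves P S (Seq (blk [Load 18 16, Const 8 1, Add 16 16 8, Add 15 15 8])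
     (Seq (If (LessElem 12 18) (blk [Store 14 18, Add 14 14 8]) (blk [Store 13 18, Add 13 13 8]))
       (blk [Sub 19 13 6, Store 15 19]))) R1 M1 9
       (\<lambda>R' M'. M' = M3 \<and> R' 13 = R1 13 + (if Q z then 1 else 0) \<and>
          R' 14 = R1 14 + (if Q z then 0 else 1) \<and> R' 15 = Suc (R1 15) \<and> R' 16 = Suc (R1 16) \<and>
          (\<forall>i. i \<notin> {8, 13, 14, 15, 16, 18, 19} \<longrightarrow> R' i = R1 i))"
    proof (rule achieves_blk_Seq[where ?T1.0 = 5], simp, goal_cases)
      case (1 R2 M2')
      then have e: "M2' = M1" "R2 18 = z" "R2 8 = 1" "R2 16 = Suc (R1 16)" "R2 15 = Suc (R1 15)"
        "\<And>i. i \<notin> {8, 15, 16, 18} \<Longrightarrow> R2 i = R1 i" using h(2) by auto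
      show ?case
      proof (rule achieves_Seq[where ?T1.0 = 3 and ?T2.0 = 2 and ?Q1.0 = "\<lambda>R' M'. M' = M2 \<and>
          R' 13 = R1 13 + (if Q z then 1 else 0) \<and> R' 14 = R1 14 + (if Q z then 0 else 1) \<and>
          (\<forall>i. i \<notin> {13, 14} \<longrightarrow> R' i = R2 i)"], goal_cases)
        case 1
        show ?case
        proof (rule achieves_If[where T = 2], goal_cases)
          case 1
          then show ?case using e z R1 assms(9) by auto
        next
          case 2
          then show ?case using e R1 by (intro achieves_blk) (auto simp: M2_def Q_def)
        next
          case 3
          then show ?case using e R1 by (intro achieves_blk) (auto simp: M2_def Q_def)
        qed simp
      next
        case (2 R3 M3')
        have "R3 13 - R1 6 = count_upto Q xs (Suc (length ys))"
          using 2 h(7) R1 cnt(1) by auto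
        then show ?case using 2 e by (intro achieves_blk) (auto simp: M3_def)
      qed simp
    qed simp
    then have "achieves P S (Seq (blk [Load 18 16, Const 8 1, Add 16 16 8, Add 15 15 8])
     (Seq (If (LessElem 12 18) (blk [Store 14 18, Add 14 14 8]) (blk [Store 13 18, Add 13 13 8]))
       (blk [Sub 19 13 6, Store 15 19]))) R1 M1 9 (?I zs)"
      by (elim achieves_mono, simp, intro exI[of _ "ys @ [z]"])
        (use h a1 a2 a3 a4 a5 in \<open>auto simp: arr_append\<close>)
    then show ?case using h(3) R1 by auto
  qed auto
  then show ?thesis by (rule achieves_mono) auto
qed

text \<open>Register 24 holds the base of the prefix counts, so a boundary is translated by one
  load. Registers 21 and 22 point into two areas that each get room for all queries, since it is not
  known beforehand how many go low.\<close>

definition split_queries :: com where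
  "split_queries = While (Less 4 23)
     (Seq (blk [Const 8 1, Load 25 4, Add 4 4 8, Load 26 4, Add 4 4 8, Load 27 4, Add 4 4 8,
         Load 28 4, Add 4 4 8, Add 29 24 25, Load 29 29, Add 30 24 26, Load 30 30, Sub 31 30 29])
       (If (Less 27 31)
         (blk [Store 21 29, Add 21 21 8, Store 21 30, Add 21 21 8, Store 21 27, Add 21 21 8,
           Store 21 28, Add 21 21 8])
         (blk [Sub 25 25 29, Sub 26 26 30, Sub 27 27 31, Store 22 25, Add 22 22 8, Store 22 26,
           Add 22 22 8, Store 22 27, Add 22 22 8, Store 22 28, Add 22 22 8])))"

lemma split_queries:
  assumes "qarr M (R 4) qs" "R 23 = R 4 + 4 * length qs" "R 23 \<le> R 21"
    "\<forall>i \<le> length xs. M (R 24 + i) = count_upto Q xs i" "R 24 + length xs < R 21"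
    "\<forall>q \<in> set qs. valid_query (length xs) q" "R 21 + 4 * length qs \<le> R 22"
  defines "ls \<equiv> map (low_query Q xs) (filter (goes_low Q xs) qs)"
    and "hs \<equiv> map (high_query Q xs) (filter (\<lambda>q. \<not> goes_low Q xs q) qs)"
  shows "achieves P S split_queries R M (27 * length qs + 1) (\<lambda>R' M'.
    qarr M' (R 21) ls \<and> qarr M' (R 22) hs \<and>
    R' 21 = R 21 + 4 * length ls \<and> R' 22 = R 22 + 4 * length hs \<and> (\<forall>a < R 21. M' a = M a) \<and>
    (\<forall>i. i \<notin> {4, 8, 21, 22, 25, 26, 27, 28, 29, 30, 31} \<longrightarrow> R' i = R i))"
proof -
  let ?l = "\<lambda>qs. map (low_query Q xs) (filter (goes_low Q xs) qs)"
  let ?h = "\<lambda>qs. map (high_query Q xs) (filter (\<lambda>q. \<not> goes_low Q xs q) qs)"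
  let ?I = "\<lambda>zs R' M'. qarr M' (R' 4) zs \<and> R 23 = R' 4 + 4 * length zs \<and> set zs \<subseteq> set qs \<and>
    (\<exists>l h. l @ ?l zs = ls \<and> h @ ?h zs = hs \<and> qarr M' (R 21) l \<and> qarr M' (R 22) h \<and>
      R' 21 = R 21 + 4 * length l \<and> R' 22 = R 22 + 4 * length h \<and>
      length l + length h + length zs = length qs) \<and> (\<forall>a < R 21. M' a = M a) \<and>
    (\<forall>i. i \<notin> {4, 8, 21, 22, 25, 26, 27, 28, 29, 30, 31} \<longrightarrow> R' i = R i)"
  have "achieves P S split_queries R M ((26 + 1) * length qs + 1) (?I [])"
    unfolding split_queries_def
  proof (rule achieves_While_list[where I = ?I], goal_cases)
    case 1
    then show ?case using assms by auto
  next
    case (2 q zs R1 M1)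
    obtain l r c p where q: "q = (l, r, c, p)" by (metis prod_cases4)
    obtain lo hi where h: "lo @ ?l (q # zs) = ls" "hi @ ?h (q # zs) = hs"
      "qarr M1 (R 21) lo" "qarr M1 (R 22) hi" "R1 21 = R 21 + 4 * length lo"
      "R1 22 = R 22 + 4 * length hi" "length lo + length hi + length (q # zs) = length qs"
      using 2 by blast
    have g: "qarr M1 (R1 4) (q # zs)" "R 23 = R1 4 + 4 * length (q # zs)"
      "set (q # zs) \<subseteq> set qs" "\<And>a. a < R 21 \<Longrightarrow> M1 a = M a"
      "\<And>i. i \<notin> {4, 8, 21, 22, 25, 26, 27, 28, 29, 30, 31} \<Longrightarrow> R1 i = R i"
      using 2 by blast+
    have v: "valid_query (length xs) (l, r, c, p)" using assms(6) g(3) q by auto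
    have cl: "M1 (R 24 + l) = count_upto Q xs l" "M1 (R 24 + r) = count_upto Q xs r"
      using v assms(4,5) g(4) by auto
    have R24: "R1 24 = R 24" "R1 23 = R 23" using g(5) by auto
    have qz: "qarr M' (R1 4 + 4) zs" if "\<And>a. a < R 21 \<Longrightarrow> M' a = M1 a" for M'
      by (rule qarr_cong[of M1]) (use g(1,2) q assms(3) that in auto)
    have "achieves P S (Seq (blk [Const 8 1, Load 25 4, Add 4 4 8, Load 26 4, Add 4 4 8, Load 27 4,
         Add 4 4 8, Load 28 4, Add 4 4 8, Add 29 24 25, Load 29 29, Add 30 24 26, Load 30 30,
         Sub 31 30 29])
       (If (Less 27 31)
         (blk [Store 21 29, Add 21 21 8, Store 21 30, Add 21 21 8, Store 21 27, Add 21 21 8,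
           Store 21 28, Add 21 21 8])
         (blk [Sub 25 25 29, Sub 26 26 30, Sub 27 27 31, Store 22 25, Add 22 22 8, Store 22 26,
           Add 22 22 8, Store 22 27, Add 22 22 8, Store 22 28, Add 22 22 8]))) R1 M1 26 (?I zs)"
    proof (rule achieves_blk_Seq[where ?T1.0 = 12], simp, goal_cases)
      case (1 R2 M2)
      then have e: "M2 = M1" "R2 25 = l" "R2 26 = r" "R2 27 = c" "R2 28 = p" "R2 4 = R1 4 + 4"
        "R2 8 = 1" "R2 29 = count_upto Q xs l" "R2 30 = count_upto Q xs r"
        "R2 31 = count_upto Q xs r - count_upto Q xs l"
        "\<And>i. i \<notin> {4, 8, 25, 26, 27, 28, 29, 30, 31} \<Longrightarrow> R2 i = R1 i"
        using g(1) q cl R24 by (auto simp: numeral_eq_Suc)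
      show ?case
      proof (rule achieves_If[where T = 11], goal_cases)
        case 2
        then have low: "goes_low Q xs q" using e q by simp
        show ?case
        proof (rule achieves_blk, simp, simp, goal_cases)
          case (1 R3 M3)
          then have m: "M3 = M1(R1 21 := count_upto Q xs l, Suc (R1 21) := count_upto Q xs r,
              Suc (Suc (R1 21)) := c, Suc (Suc (Suc (R1 21))) := p)"
            and r3: "R3 21 = R1 21 + 4" "\<And>i. i \<notin> {21} \<Longrightarrow> R3 i = R2 i"
            using e by auto
          have 1: "qarr M3 (R 21) lo"
            by (rule qarr_cong[OF h(3)]) (use m h(5) in auto)
          have 2: "qarr M3 (R 22) hi"
            by (rule qarr_cong[OF h(4)]) (use m h(5,7) assms(7) in auto)
          have 3: "\<And>a. a < R 21 \<Longrightarrow> M3 a = M1 a" using m h(5) by auto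
          have 4: "qarr M3 (R1 21) [low_query Q xs q]"
            using m by (simp add: q numeral_eq_Suc)
          have ex: "\<exists>l h. l @ ?l zs = ls \<and> h @ ?h zs = hs \<and> qarr M3 (R 21) l \<and> qarr M3 (R 22) h \<and>
              R3 21 = R 21 + 4 * length l \<and> R3 22 = R 22 + 4 * length h \<and>
              length l + length h + length zs = length qs"
            by (rule exI[of _ "lo @ [low_query Q xs q]"], rule exI[of _ "hi"])
              (use e(11) r3 1 2 4 h low in \<open>auto simp: qarr_append\<close>)
          show ?case using g(2-5) e r3 qz[OF 3] 3 by (intro conjI ex) auto
        qed
      next
        case 3
        then have high: "\<not> goes_low Q xs q" using e q by simp
        show ?case
        proof (rule achieves_blk, simp, simp, goal_cases)
          case (1 R3 M3)
          then have m: "M3 = M1(R1 22 := l - count_upto Q xs l,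
              Suc (R1 22) := r - count_upto Q xs r,
              Suc (Suc (R1 22)) := c - (count_upto Q xs r - count_upto Q xs l),
              Suc (Suc (Suc (R1 22))) := p)"
            and r3: "R3 22 = R1 22 + 4" "\<And>i. i \<notin> {22, 25, 26, 27} \<Longrightarrow> R3 i = R2 i"
            using e by auto
          have 1: "qarr M3 (R 21) lo"
            by (rule qarr_cong[OF h(3)]) (use m h(6,7) assms(7) in auto)
          have 2: "qarr M3 (R 22) hi"
            by (rule qarr_cong[OF h(4)]) (use m h(6) in auto)
          have 3: "\<And>a. a < R 21 \<Longrightarrow> M3 a = M1 a" using m h(6) assms(7) by auto
          have 4: "qarr M3 (R1 22) [high_query Q xs q]"
            using m by (simp add: q numeral_eq_Suc)
          have ex: "\<exists>l h. l @ ?l zs = ls \<and> h @ ?h zs = hs \<and> qarr M3 (R 21) l \<and> qarr M3 (R 22) h \<and>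
              R3 21 = R 21 + 4 * length l \<and> R3 22 = R 22 + 4 * length h \<and>
              length l + length h + length zs = length qs"
            by (rule exI[of _ "lo"], rule exI[of _ "hi @ [high_query Q xs q]"])
              (use e(11) r3 1 2 4 h high in \<open>auto simp: qarr_append\<close>)
          show ?case using g(2-5) e r3 qz[OF 3] 3 by (intro conjI ex) auto
        qed
      qed auto
    qed simp
    then show ?case using g(2) R24 by auto
  qed auto
  then show ?thesis by (rule achieves_mono) auto
qed

text \<open>List lengths are recovered from pointer differences; the machine divides by four by
  halving twice.\<close>

lemma quarter: "4 * n div 2 div 2 = (n::nat)" "((a + 4 * n) - a) div 2 div 2 = (n::nat)"
  by simp_all

text \<open>
  The frame at \<open>F\<close> holds registers 2, 3, 4, 5, 7 of the caller in \<open>F\<close> to \<open>F + 4\<close>, the pivot in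
  \<open>F + 5\<close>, and in \<open>F + 6\<close> to \<open>F + 9\<close> the query that asks for it.  Once the queries are
  distributed, \<open>F\<close> to \<open>F + 3\<close> are overwritten by the arguments of the second child.
\<close>

definition prepare_selection :: com where
  "prepare_selection =
     Seq (blk [Const 8 0, Add 9 2 8, Add 18 2 3, Add 19 6 8])
     (Seq write_group_medians
       (blk [Const 8 1, Const 10 0, Add 9 6 10, Store 9 2, Add 9 9 8, Store 9 3, Add 9 9 8,
         Store 9 4, Add 9 9 8, Store 9 5, Add 9 9 8, Store 9 7, Add 9 9 8, Add 11 9 10, Add 9 9 8,
         Add 4 9 10, Store 9 10, Add 9 9 8, Sub 3 6 19, Store 9 3, Add 9 9 8, Sub 12 3 8,
         Half 12 12, Store 9 12, Add 9 9 8, Store 9 11, Add 9 9 8, Const 5 1, Add 7 6 10,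
         Add 2 19 10, Add 6 9 10]))"

lemma prepare_selection:
  fixes S :: "'a::linorder list"
  assumes "arr M (R 2) xs" "R 3 = length xs" "R 2 + length xs \<le> R 6"
    and "set xs \<subseteq> {1..length S}" "inj_on (elem S) (set xs)" "distinct xs"
  defines "ms \<equiv> group_medians (elem S) xs"
  defines "F \<equiv> R 6 + length ms"
  shows "achieves P S prepare_selection R M (216 * length xs + 36) (\<lambda>R' M'.
    R' 2 = R 6 \<and> arr M' (R 6) ms \<and> R' 3 = length ms \<and> R' 4 = F + 6 \<and> R' 5 = 1 \<and>
    R' 6 = F + 10 \<and> R' 7 = F \<and> qarr M' (F + 6) [(0, length ms, (length ms - 1) div 2, F + 5)] \<and>
    M' F = R 2 \<and> M' (F + 1) = R 3 \<and> M' (F + 2) = R 4 \<and> M' (F + 3) = R 5 \<and> M' (F + 4) = R 7 \<and>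
    (\<forall>a < R 6. M' a = M a))"
  unfolding prepare_selection_def
proof (rule achieves_blk_Seq[where ?T1.0 = "216 * length xs + 32"], simp, goal_cases)
  case (1 R1 M1)
  then have e: "M1 = M" "R1 9 = R 2" "R1 18 = R 2 + R 3" "R1 19 = R 6"
    "\<And>i. i \<notin> {8, 9, 18, 19} \<Longrightarrow> R1 i = R i" by auto
  show ?case
  proof (rule achieves_Seq[where ?T2.0 = 31, OF write_group_medians[of M1 R1 xs]], goal_cases)
    case (7 R2 M2)
    have r: "R2 2 = R 2" "R2 3 = R 3" "R2 4 = R 4" "R2 5 = R 5" "R2 7 = R 7" "R2 19 = R 6"
      "R2 6 = F" "\<And>a. a < R 6 \<Longrightarrow> M2 a = M a" "arr M2 (R 6) ms"
      using 7 e by (auto simp: F_def ms_def)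
    show ?case
    proof (rule achieves_blk, simp, simp, goal_cases)
      case (1 R3 M3)
      then have m: "M3 = M2(F := R 2, F + 1 := R 3, F + 2 := R 4, F + 3 := R 5, F + 4 := R 7,
          F + 6 := 0, F + 7 := length ms, F + 8 := (length ms - 1) div 2, F + 9 := F + 5)"
        and r3: "R3 2 = R 6" "R3 3 = length ms" "R3 4 = F + 6" "R3 5 = 1" "R3 6 = F + 10" "R3 7 = F"
        using r by (auto simp: F_def numeral_eq_Suc)
      have "arr M3 (R 6) ms" by (rule arr_cong[OF r(9)]) (auto simp: m F_def)
      then show ?case using r3 r(8) by (auto simp: m F_def numeral_eq_Suc)
    qed
  qed (use assms(1-6) e in auto)
qed simp

text \<open>The pivot call has destroyed the registers, so the arguments are reloaded from the
  frame, whose address in register 7 survives every call. At the end the low part has its arguments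
  in registers and the high part has them in the frame.\<close>

definition distribute :: com where
  "distribute =
     Seq (blk [Const 8 1, Const 10 0, Add 9 7 10, Load 2 9, Add 9 9 8, Load 3 9, Add 9 9 8,
       Load 4 9, Add 9 9 8, Load 5 9, Add 9 9 8, Add 9 9 8, Load 12 9, Add 13 6 10, Add 14 6 3,
       Add 15 14 3, Add 16 2 10, Add 17 2 3, Store 15 10])
     (Seq partition_elements
     (Seq (blk [Const 8 1, Add 18 15 8, Add 20 5 5, Add 20 20 20, Add 19 18 20, Const 10 0,
       Add 21 18 10, Add 22 19 10, Add 23 4 20, Add 24 6 3, Add 24 24 3])
     (Seq split_queries
       (blk [Const 8 1, Const 10 0, Add 9 7 10, Add 11 6 3, Store 9 11, Add 9 9 8, Sub 11 14 11,
         Store 9 11, Add 9 9 8, Store 9 19, Add 9 9 8, Sub 11 22 19, Half 11 11, Half 11 11,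
         Store 9 11, Add 2 6 10, Sub 3 13 6, Add 4 18 10, Sub 5 21 18, Half 5 5, Half 5 5,
         Add 6 19 20]))))"

lemma distribute:
  fixes S :: "'a::linorder list"
  assumes "R 7 = F" "M (F + 1) = length xs" "M (F + 3) = length qs"
    and "arr M (M F) xs" "M F + length xs \<le> R 6" "qarr M (M (F + 2)) qs"
    and "M (F + 2) + 4 * length qs \<le> R 6" "F + 10 \<le> R 6" "M (F + 5) = p"
    and "set xs \<subseteq> {1..length S}" "p \<in> {1..length S}" "\<forall>q \<in> set qs. valid_query (length xs) q"
  defines "Q \<equiv> \<lambda>z. elem S z \<le> elem S p"
  defines "ls \<equiv> map (low_query Q xs) (filter (goes_low Q xs) qs)"
    and "hs \<equiv> map (high_query Q xs) (filter (\<lambda>q. \<not> goes_low Q xs q) qs)"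
  shows "achieves P S distribute R M (10 * length xs + 27 * length qs + 54) (\<lambda>R' M'.
    R' 2 = R 6 \<and> arr M' (R 6) (filter Q xs) \<and> R' 3 = length (filter Q xs) \<and>
    R 6 + length (filter Q xs) \<le> R' 6 \<and>
    R 6 \<le> R' 4 \<and> qarr M' (R' 4) ls \<and> R' 5 = length ls \<and> R' 4 + 4 * length ls \<le> R' 6 \<and>
    R' 7 = F \<and> R 6 \<le> M' F \<and> arr M' (M' F) (filter (\<lambda>z. \<not> Q z) xs) \<and>
    M' F + length (filter (\<lambda>z. \<not> Q z) xs) \<le> R' 6 \<and>
    M' (F + 1) = length (filter (\<lambda>z. \<not> Q z) xs) \<and>
    R 6 \<le> M' (F + 2) \<and> qarr M' (M' (F + 2)) hs \<and> M' (F + 2) + 4 * length hs \<le> R' 6 \<and>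
    M' (F + 3) = length hs \<and> (\<forall>a < R 6. a \<notin> {F..F + 3} \<longrightarrow> M' a = M a))"
  unfolding distribute_def
proof (rule achieves_blk_Seq[where ?T1.0 = "10 * length xs + 27 * length qs + 35"], simp, goal_cases)
  case (1 R1 M1)
  define n where "n = length xs"
  have e: "M1 = M(R 6 + 2 * n := 0)" "R1 2 = M F" "R1 3 = n" "R1 4 = M (F + 2)"
    "R1 5 = length qs" "R1 6 = R 6" "R1 7 = F" "R1 12 = p" "R1 13 = R 6" "R1 14 = R 6 + n"
    "R1 15 = R 6 + 2 * n" "R1 16 = M F" "R1 17 = M F + n"
    using 1 assms(1-3,9) by (auto simp: n_def numeral_eq_Suc)
  have axs: "arr M1 (M F) xs" by (rule arr_cong[OF assms(4)]) (use assms(5) in \<open>auto simp: e(1)\<close>)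
  show ?case
  proof (rule achieves_Seq[where ?T2.0 = "27 * length qs + 34", OF partition_elements[of M1 R1 xs]],
      goal_cases)
    case (10 R2 M2)
    then have f: "arr M2 (R 6) (filter Q xs)" "arr M2 (R 6 + n) (filter (\<lambda>z. \<not> Q z) xs)"
      "\<forall>i \<le> n. M2 (R 6 + 2 * n + i) = count_upto Q xs i" "R2 13 = R 6 + length (filter Q xs)"
      "R2 14 = R 6 + n + length (filter (\<lambda>z. \<not> Q z) xs)" "R2 15 = R 6 + 3 * n"
      "\<And>a. a < R 6 \<Longrightarrow> M2 a = M a"
      "\<And>i. i \<notin> {8, 13, 14, 15, 16, 18, 19} \<Longrightarrow> R2 i = R1 i"
      unfolding e(6,8) by (auto simp: e(1) Q_def n_def)
    \<comment> \<open>This is past both parts and past \<open>n + 1\<close> prefix counts, the one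
      of the empty prefix included.\<close>
    define L where "L = Suc (R 6 + 3 * n)"
    define H where "H = L + 4 * length qs"
    have qa: "qarr M2 (M (F + 2)) qs" by (rule qarr_cong[OF assms(6)]) (use assms(7) f(7) in auto)
    show ?case
    proof (rule achieves_blk_Seq[where ?T1.0 = "27 * length qs + 23"], simp, goal_cases)
      case (1 R3 M3)
      then have g: "M3 = M2" "R3 18 = L" "R3 19 = H" "R3 20 = 4 * length qs" "R3 21 = L"
        "R3 22 = H" "R3 23 = M (F + 2) + 4 * length qs" "R3 24 = R 6 + 2 * n"
        "R3 4 = M (F + 2)" "R3 5 = length qs" "R3 3 = n" "R3 6 = R 6" "R3 7 = F"
        "R3 13 = R 6 + length (filter Q xs)"
        "R3 14 = R 6 + n + length (filter (\<lambda>z. \<not> Q z) xs)"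
        using f e by (auto simp: L_def H_def)
      show ?case
      proof (rule achieves_Seq[where ?T2.0 = 22, OF split_queries[of M3 R3 qs xs Q]], goal_cases)
        case (8 R4 M4)
        then have h: "qarr M4 L ls" "qarr M4 H hs" "R4 21 = L + 4 * length ls"
          "R4 22 = H + 4 * length hs" "\<And>a. a < L \<Longrightarrow> M4 a = M2 a"
          "\<And>i. i \<notin> {4, 8, 21, 22, 25, 26, 27, 28, 29, 30, 31} \<Longrightarrow> R4 i = R3 i"
          unfolding ls_def[symmetric] hs_def[symmetric] g(1,5,6) by auto
        have len: "length ls + length hs = length qs"
          using sum_length_filter_compl[of "goes_low Q xs" qs] by (simp add: ls_def hs_def)
        have lenx: "length (filter Q xs) + length (filter (\<lambda>z. \<not> Q z) xs) = n"
          using sum_length_filter_compl[of Q xs] by (simp add: n_def)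
        show ?case
        proof (rule achieves_blk, simp, simp, goal_cases)
          case (1 R5 M5)
          have r4: "R4 3 = n" "R4 6 = R 6" "R4 7 = F" "R4 13 = R 6 + length (filter Q xs)"
            "R4 14 = R 6 + n + length (filter (\<lambda>z. \<not> Q z) xs)" "R4 18 = L" "R4 19 = H"
            "R4 20 = 4 * length qs"
            using h(6) g by auto
          have m: "M5 = M4(F := R 6 + n, F + 1 := length (filter (\<lambda>z. \<not> Q z) xs), F + 2 := H,
              F + 3 := length hs)"
            and r: "R5 2 = R 6" "R5 3 = length (filter Q xs)" "R5 4 = L" "R5 5 = length ls"
              "R5 6 = H + 4 * length qs" "R5 7 = F"
            using 1 r4 h(3,4) quarter by (auto simp: numeral_eq_Suc)
          have m': "M5 F = R 6 + n" "M5 (F + 1) = length (filter (\<lambda>z. \<not> Q z) xs)"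
            "M5 (F + 2) = H" "M5 (F + 3) = length hs" by (auto simp: m)
          have keep: "M5 a = M4 a" if "R 6 \<le> a" for a
            using that assms(8) by (simp add: m)
          have "arr M5 (R 6) (filter Q xs)"
            by (rule arr_cong[OF f(1)]) (use keep h(5) lenx in \<open>auto simp: L_def\<close>)
          moreover have "arr M5 (R 6 + n) (filter (\<lambda>z. \<not> Q z) xs)"
            by (rule arr_cong[OF f(2)]) (use keep h(5) lenx in \<open>auto simp: L_def\<close>)
          moreover have "qarr M5 L ls"
            by (rule qarr_cong[OF h(1)]) (use keep in \<open>auto simp: L_def\<close>)
          moreover have "qarr M5 H hs"
            by (rule qarr_cong[OF h(2)]) (use keep in \<open>auto simp: L_def H_def\<close>)
          moreover have "\<forall>a < R 6. a \<notin> {F..F + 3} \<longrightarrow> M5 a = M a"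
            using h(5) f(7) by (auto simp: m L_def)
          ultimately show ?case
            unfolding m' r using len lenx by (auto simp: L_def H_def)
        qed
      qed (use g qa f(3) assms(5,7,12) in \<open>auto simp: L_def H_def n_def\<close>)
    qed simp
  qed (use axs e assms(5,10,11) in \<open>auto simp: n_def\<close>)
qed simp

section \<open>The recursive procedure and its specification\<close>

definition solve :: com where
  "solve = Seq (blk [Const 8 0, Const 9 1])
     (If (Less 8 5)
       (If (Less 9 3)
         (Seq prepare_selection (Seq (Call 1) (Seq distribute (Seq (Call 1)
           (Seq (blk [Const 8 1, Const 10 0, Add 9 7 10, Load 2 9, Add 9 9 8, Load 3 9, Add 9 9 8,
              Load 4 9, Add 9 9 8, Load 5 9])
           (Seq (Call 1) (blk [Const 8 4, Add 9 7 8, Load 7 9])))))))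
         write_answers)
       (blk [Const 8 0]))"

text \<open>Distinct answer cells keep the two children from overwriting each other's answers. They
  lie outside the query list, which is still being read when answers are written, and below
  \<open>R 6\<close>, so they never hit newly allocated data.\<close>

definition solve_pre ::
  "'a::linorder list \<Rightarrow> nat list \<Rightarrow> (nat \<times> nat \<times> nat \<times> nat) list \<Rightarrow> (nat \<Rightarrow> nat) \<Rightarrow> (nat \<Rightarrow> nat) \<Rightarrow> bool"
where
  "solve_pre S xs qs R M \<longleftrightarrow> arr M (R 2) xs \<and> R 3 = length xs \<and> R 2 + length xs \<le> R 6 \<and>
     qarr M (R 4) qs \<and> R 5 = length qs \<and> R 4 + 4 * length qs \<le> R 6 \<and>
     set xs \<subseteq> {1..length S} \<and> distinct xs \<and> inj_on (elem S) (set xs) \<and>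
     (\<forall>q \<in> set qs. valid_query (length xs) q \<and> out q < R 6 \<and>
       out q \<notin> {R 4..<R 4 + 4 * length qs}) \<and> distinct (map out qs)"

text \<open>Everything allocated before the call survives, except in answer cells. Since register 6
  never decreases, frames and the data of a waiting sibling stay protected.\<close>

definition solve_post ::
  "'a::linorder list \<Rightarrow> nat list \<Rightarrow> (nat \<times> nat \<times> nat \<times> nat) list \<Rightarrow> (nat \<Rightarrow> nat) \<Rightarrow> (nat \<Rightarrow> nat) \<Rightarrow>
   (nat \<Rightarrow> nat) \<Rightarrow> (nat \<Rightarrow> nat) \<Rightarrow> bool"
where
  "solve_post S xs qs R M R' M' \<longleftrightarrow> (\<forall>q \<in> set qs. answered (elem S) xs M' q) \<and>
     (\<forall>a < R 6. a \<notin> out ` set qs \<longrightarrow> M' a = M a) \<and> R 6 \<le> R' 6 \<and> R' 7 = R 7"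

lemma answered_cong: "M' (out q) = M (out q) \<Longrightarrow> answered f xs M' q = answered f xs M q"
  by (cases q rule: prod_cases4) simp

lemma out_low_query [simp]: "out (low_query Q xs q) = out q"
  by (cases q rule: prod_cases4) simp

lemma out_high_query [simp]: "out (high_query Q xs q) = out q"
  by (cases q rule: prod_cases4) simp

text \<open>\<open>cost\<close> stays abstract: the induction over the program uses only these three
  inequalities, and the recurrence is solved afterwards. The factor 300 covers 216 + 10 units per
  entry, 27 per query and the constant overhead of a call.\<close>

lemma solve_achieves:
  fixes S :: "'a::linorder list" and cost :: "nat \<Rightarrow> nat \<Rightarrow> nat"
  assumes P: "1 < length P" "P ! 1 = solve"
    and c_empty: "\<And>s. 5 \<le> cost s 0"
    and c_leaf: "\<And>q. 0 < q \<Longrightarrow> 300 * (1 + q) \<le> cost 1 q"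
    and c_node: "\<And>s q s1 s2 q1 q2. \<lbrakk>2 \<le> s; 0 < q; s1 + s2 = s; q1 + q2 = q; 0 < s1; 0 < s2;
      10 * s1 \<le> 7 * s + 35; 10 * s2 \<le> 7 * s + 35\<rbrakk> \<Longrightarrow>
      300 * (s + q) + cost ((s + 4) div 5) 1 + cost s1 q1 + cost s2 q2 \<le> cost s q"
  shows "solve_pre S xs qs R M \<Longrightarrow>
    achieves P S (Call 1) R M (cost (length xs) (length qs)) (solve_post S xs qs R M)"
proof (induction "length xs" arbitrary: xs qs R M rule: less_induct)
  case less
  note pre = less.prems[unfolded solve_pre_def]
  have body: "achieves P S (Call 1) R M (T + 5) Q"
    if "achieves P S (If (Less 9 3)
         (Seq prepare_selection (Seq (Call 1) (Seq distribute (Seq (Call 1)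
           (Seq (blk [Const 8 1, Const 10 0, Add 9 7 10, Load 2 9, Add 9 9 8, Load 3 9, Add 9 9 8,
              Load 4 9, Add 9 9 8, Load 5 9])
           (Seq (Call 1) (blk [Const 8 4, Add 9 7 8, Load 7 9])))))))
         write_answers) (R(8 := 0, 9 := 1)) M (T + 1) Q" "0 < length qs" for T Q
  proof -
    have "achieves P S solve R M (T + 4) Q" unfolding solve_def
      by (rule achieves_blk_Seq[where ?T1.0 = "T + 2"], simp, rule achieves_If[where T = "T + 1"])
        (use that pre in auto)
    then show ?thesis using achieves_mono[OF achieves_Call[OF P(1)], of S R M "T + 4" Q "T + 5" Q]
      unfolding P(2) by simp
  qed
  consider "qs = []" | "qs \<noteq> []" "length xs = 1" | "qs \<noteq> []" "2 \<le> length xs"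
  proof (cases qs)
    case (Cons q qs')
    then have "valid_query (length xs) q" using pre by auto
    then have "length xs \<noteq> 0" by (cases q rule: prod_cases4) auto
    then show ?thesis using that Cons by linarith
  qed
  then show ?case
  proof cases
    case 1
    have "achieves P S solve R M 4 (solve_post S xs qs R M)" unfolding solve_def
    proof (rule achieves_blk_Seq[where ?T1.0 = 2], simp, rule achieves_If[where T = 1], goal_cases)
      case (3 R1 M1)
      then show ?case using 1 by (intro achieves_blk) (auto simp: solve_post_def)
    qed (use 1 pre in auto)
    then show ?thesis
      using achieves_mono[OF achieves_Call[OF P(1)], of S R M 4 "solve_post S xs qs R M"
        "cost (length xs) (length qs)"] c_empty[of "length xs"] 1
      unfolding P(2) by simp
  next
    case 2
    then obtain x where x: "xs = [x]" by (cases xs) auto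
    let ?R = "R(8 := 0, 9 := 1)"
    have "achieves P S write_answers ?R M (7 * length qs + 5) (solve_post S xs qs R M)"
    proof (rule achieves_mono[OF write_answers[of M ?R qs]], goal_cases)
      case (5 R' M')
      have "answered (elem S) xs M' q" if "q \<in> set qs" for q
      proof -
        obtain l r c p where q: "q = (l, r, c, p)" by (metis prod_cases4)
        have "valid_query 1 q" using pre that x by auto
        then have "l = 0" "r = 1" "c = 0" by (auto simp: q)
        moreover have "M' p = x" using 5 that pre x by (force simp: q)
        ultimately show ?thesis by (simp add: q x has_rank_def)
      qed
      then show ?case using 5 by (simp add: solve_post_def)
    qed (use pre in auto)
    then have "achieves P S (Call 1) R M (7 * length qs + 5 + 5) (solve_post S xs qs R M)"
      using 2 x pre by (intro body achieves_If[where T = "7 * length qs + 5"]) auto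
    then show ?thesis
      by (rule achieves_mono) (use c_leaf[of "length qs"] 2 in auto)
  next
    case 3
    let ?f = "elem S"
    define ms where "ms = group_medians ?f xs"
    define k where "k = (length ms - 1) div 2"
    define p where "p = rank_of ?f ms k"
    define Q where "Q = (\<lambda>z. ?f z \<le> ?f p)"
    define lo where "lo = filter Q xs"
    define hi where "hi = filter (\<lambda>z. \<not> Q z) xs"
    define ls where "ls = map (low_query Q xs) (filter (goes_low Q xs) qs)"
    define hs where "hs = map (high_query Q xs) (filter (\<lambda>q. \<not> goes_low Q xs q) qs)"
    have xs: "set xs \<subseteq> {1..length S}" "distinct xs" "inj_on ?f (set xs)" using pre by auto
    note gm = group_medians_props[OF xs(3,2), folded ms_def]
    have ms: "length ms = (length xs + 4) div 5" by (simp add: ms_def length_group_medians)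
    then have mslen: "0 < length ms" "length ms < length xs" using 3 by auto
    have mset: "set ms \<subseteq> {1..length S}" "inj_on ?f (set ms)"
      using gm xs by (auto intro: inj_on_subset)
    have "k < length ms" using mslen unfolding k_def by linarith
    then have p: "has_rank ?f ms k p"
      unfolding p_def using mset(2) gm(2) by (intro has_rank_rank_of)
    have pS: "p \<in> {1..length S}" using p mset(1) by (auto simp: has_rank_def)
    note sp = median_of_medians_split[OF xs(3,2) 3(2) p[unfolded k_def ms_def], folded ms_def]
    have hi_le: "hi = filter (\<lambda>z. \<not> ?f z \<le> ?f p) xs" by (simp add: hi_def Q_def)
    have hi_eq: "hi = filter (\<lambda>z. ?f p < ?f z) xs" by (simp add: hi_def Q_def not_le)
    have split: "length lo + length hi = length xs" "0 < length lo" "0 < length hi"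
      "10 * length lo \<le> 7 * length xs + 35" "10 * length hi \<le> 7 * length xs + 35"
      using sp unfolding lo_def Q_def hi_eq by auto
    have lens: "length ls + length hs = length qs"
      using sum_length_filter_compl[of "goes_low Q xs" qs] by (simp add: ls_def hs_def)
    have img: "out ` set ls = out ` {q \<in> set qs. goes_low Q xs q}"
      "out ` set hs = out ` {q \<in> set qs. \<not> goes_low Q xs q}"
      by (simp_all add: ls_def hs_def image_image)
    then have outs: "out ` set ls \<subseteq> out ` set qs" "out ` set hs \<subseteq> out ` set qs" by auto
    have inj: "inj_on out (set qs)" "distinct qs" using pre by (auto simp: distinct_map)
    have "map out ls = map out (filter (goes_low Q xs) qs)"
      "map out hs = map out (filter (\<lambda>q. \<not> goes_low Q xs q) qs)"
      by (auto simp: ls_def hs_def)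
    then have dist: "distinct (map out ls)" "distinct (map out hs)"
      using pre by (auto simp: distinct_map_filter)
    \<comment> \<open>This lets the answers for the low part outlive the call for the high
      part.\<close>
    have disj: "out ` set ls \<inter> out ` set hs = {}"
      unfolding img using inj(1) by (auto dest: inj_onD)
    have vls: "valid_query (length lo) q" if q: "q \<in> set ls" for q
    proof -
      obtain q' where "q = low_query Q xs q'" "q' \<in> set qs" "goes_low Q xs q'"
        using q unfolding ls_def by auto
      then show ?thesis using low_query_correct(1)[of xs q' ?f "?f p"] pre
        unfolding lo_def Q_def by blast
    qed
    have vhs: "valid_query (length hi) q" if q: "q \<in> set hs" for q
    proof -
      obtain q' where "q = high_query Q xs q'" "q' \<in> set qs" "\<not> goes_low Q xs q'"
        using q unfolding hs_def by auto
      then show ?thesis using high_query_correct(1)[of xs q' ?f "?f p"] pre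
        unfolding hi_def Q_def by blast
    qed
    have answered: "answered ?f xs M' q" if "q \<in> set qs" "\<forall>q \<in> set ls. answered ?f lo M' q"
      "\<forall>q \<in> set hs. answered ?f hi M' q" for q M'
    proof (cases "goes_low Q xs q")
      case True
      then have "low_query Q xs q \<in> set ls" using that(1) unfolding ls_def by simp
      then have "answered ?f lo M' (low_query Q xs q)" using that by blast
      then show ?thesis using low_query_correct(2)[of xs q ?f "?f p" M'] that(1) pre True
        unfolding lo_def Q_def by blast
    next
      case False
      then have "high_query Q xs q \<in> set hs" using that(1) unfolding hs_def by simp
      then have "answered ?f hi M' (high_query Q xs q)" using that by blast
      then show ?thesis using high_query_correct(2)[of xs q ?f "?f p" M'] that(1) pre False
        unfolding hi_def Q_def by blast
    qed
    define F where "F = R 6 + length ms"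
    let ?R = "R(8 := 0, 9 := 1)"
    define cm where "cm = cost (length ms) 1"
    define cl where "cl = cost (length lo) (length ls)"
    define ch where "ch = cost (length hi) (length hs)"
    have outR: "a < R 6" if "a \<in> out ` set qs" for a using pre that by auto
    have outl: "out q < R 6" if "q \<in> set ls" for q using that outs(1) outR by blast
    have outh: "out q < R 6" if "q \<in> set hs" for q using that outs(2) outR by blast
    have frame: "arr M' (R 2) xs \<and> qarr M' (R 4) qs" if "\<And>a. a < R 6 \<Longrightarrow> M' a = M a" for M'
      using that pre by (auto intro!: arr_cong[of M] qarr_cong[of M])
    have "achieves P S (Seq prepare_selection (Seq (Call 1) (Seq distribute (Seq (Call 1)
           (Seq (blk [Const 8 1, Const 10 0, Add 9 7 10, Load 2 9, Add 9 9 8, Load 3 9, Add 9 9 8,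
              Load 4 9, Add 9 9 8, Load 5 9])
           (Seq (Call 1) (blk [Const 8 4, Add 9 7 8, Load 7 9]))))))) ?R M
      ((216 * length xs + 36) + (cm + ((10 * length xs + 27 * length qs + 54) + (cl + (10 + (ch + 3))))))
      (solve_post S xs qs R M)"
    proof (rule achieves_Seq[where ?T2.0 = "cm + ((10 * length xs + 27 * length qs + 54) + (cl + (10 + (ch + 3))))",
          OF prepare_selection[of M ?R xs]], goal_cases)
      case (7 R1 M1)
      then have a: "R1 2 = R 6" "arr M1 (R 6) ms" "R1 3 = length ms" "R1 4 = F + 6" "R1 5 = 1"
        "R1 6 = F + 10" "R1 7 = F" "qarr M1 (F + 6) [(0, length ms, k, F + 5)]"
        "M1 F = R 2" "M1 (F + 1) = length xs" "M1 (F + 2) = R 4" "M1 (F + 3) = length qs"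
        "M1 (F + 4) = R 7" "\<And>a. a < R 6 \<Longrightarrow> M1 a = M a"
        using pre by (auto simp: F_def ms_def k_def)
      let ?q = "[(0, length ms, k, F + 5)]"
      have pre1: "solve_pre S ms ?q R1 M1"
        using a \<open>k < length ms\<close> mslen(1) mset gm(2) by (simp add: solve_pre_def F_def)
      show ?case
      proof (rule achieves_Seq[where ?T1.0 = cm and ?T2.0 = "(10 * length xs + 27 * length qs + 54) + (cl + (10 + (ch + 3)))" and
            ?Q1.0 = "solve_post S ms ?q R1 M1"], goal_cases)
        case 1
        show ?case using less.hyps[OF mslen(2) pre1] by (simp add: cm_def)
      next
        case (2 R2 M2)
        then have b: "\<And>a. a < F + 10 \<Longrightarrow> a \<noteq> F + 5 \<Longrightarrow> M2 a = M1 a" "F + 10 \<le> R2 6" "R2 7 = F"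
          "has_rank ?f ms k (M2 (F + 5))"
          using a(6,7) by (auto simp: solve_post_def)
        \<comment> \<open>A rank determines its element, so the stored pivot is the \<open>p\<close>
          by which the parts were defined.\<close>
        have piv: "M2 (F + 5) = p" using has_rank_unique[OF mset(2) b(4) p] .
        have M2: "M2 a = M a" if "a < R 6" for a using that a(14) b(1) by (simp add: F_def)
        have fr2: "M2 F = R 2" "M2 (F + 1) = length xs" "M2 (F + 2) = R 4" "M2 (F + 3) = length qs"
          "M2 (F + 4) = R 7" using a(9-13) b(1) by auto
        have R2_6: "R 6 \<le> R2 6" using b(2) by (simp add: F_def)
        show ?case
        proof (rule achieves_Seq[where ?T2.0 = "cl + (10 + (ch + 3))",
            OF distribute[of R2 F M2 xs qs p]], goal_cases)
          case (13 R3 M3)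
          note 13[folded Q_def, folded lo_def hi_le ls_def hs_def]
          then have h: "R3 2 = R2 6" "arr M3 (R2 6) lo" "R3 3 = length lo" "R2 6 + length lo \<le> R3 6"
            "R2 6 \<le> R3 4" "qarr M3 (R3 4) ls" "R3 5 = length ls" "R3 4 + 4 * length ls \<le> R3 6"
            "R3 7 = F" "M3 (F + 1) = length hi" "M3 (F + 3) = length hs"
            and R3M: "R2 6 \<le> M3 F" "M3 F + length hi \<le> R3 6" "R2 6 \<le> M3 (F + 2)"
              "M3 (F + 2) + 4 * length hs \<le> R3 6" "arr M3 (M3 F) hi" "qarr M3 (M3 (F + 2)) hs"
            and M3: "\<And>a. a < R2 6 \<Longrightarrow> a \<notin> {F..F + 3} \<Longrightarrow> M3 a = M2 a"
            by blast+
          have M3R: "M3 a = M a" if "a < R 6" for a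
            using that M3[of a] M2[of a] R2_6 by (simp add: F_def)
          have pre3: "solve_pre S lo ls R3 M3"
          proof -
            have "out q < R3 6 \<and> out q \<notin> {R3 4..<R3 4 + 4 * length ls}" if "q \<in> set ls" for q
            proof -
              have "out q < R 6" using outl[OF that] .
              then have "out q < R3 4" "out q < R3 6" using h(4,5) R2_6 by linarith+
              then show ?thesis by simp
            qed
            moreover have "set lo \<subseteq> set xs" "distinct lo" using xs(2) by (auto simp: lo_def)
            moreover have "set lo \<subseteq> {1..length S}" "inj_on ?f (set lo)"
              using xs calculation(2) by (blast, blast intro: inj_on_subset)
            ultimately show ?thesis unfolding solve_pre_def h(1,3,7)
              using h(2,4,6,8) vls dist(1) by blast
          qed
          show ?case
          proof (rule achieves_Seq[where ?T1.0 = cl and ?T2.0 = "10 + (ch + 3)" and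
                ?Q1.0 = "solve_post S lo ls R3 M3"], goal_cases)
            case 1
            show ?case using less.hyps[OF _ pre3] split by (simp add: cl_def)
          next
            case (2 R4 M4)
            \<comment> \<open>All answer cells lie below \<open>R 6\<close>. Whatever was allocated
              since then, including the frame and the arguments of the high part, is therefore
              untouched by the call for the low part.\<close>
            have keep4: "M4 a = M3 a" if "a < R3 6" "R 6 \<le> a \<or> a \<notin> out ` set ls" for a
            proof -
              have "a \<notin> out ` set ls" using that(2) outl leD by blast
              then show ?thesis using 2 that(1) by (auto simp: solve_post_def)
            qed
            have F3: "F + 10 \<le> R3 6" using h(4) b(2) by linarith
            have R4: "R4 7 = F" "R3 6 \<le> R4 6" using 2 h(9) by (auto simp: solve_post_def)
            have fr4: "M4 F = M3 F" "M4 (F + 1) = length hi" "M4 (F + 2) = M3 (F + 2)"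
              "M4 (F + 3) = length hs" "M4 (F + 4) = R 7"
              using h(10,11) keep4 F3 M3[of "F + 4"] fr2(5) b(2) by (auto simp: F_def)
            show ?case
            proof (rule achieves_blk_Seq[where ?T1.0 = "ch + 3"], simp, goal_cases)
              case (1 R5 M5)
              then have r5: "M5 = M4" "R5 2 = M3 F" "R5 3 = length hi" "R5 4 = M3 (F + 2)"
                "R5 5 = length hs" "R5 6 = R4 6" "R5 7 = F"
                using R4 fr4 by (auto simp: numeral_eq_Suc)
              have pre5: "solve_pre S hi hs R5 M5"
              proof -
                have "out q < R5 6 \<and> out q \<notin> {R5 4..<R5 4 + 4 * length hs}" if "q \<in> set hs" for q
                proof -
                  have "out q < R 6" using outh[OF that] .
                  then have "out q < R5 4" "out q < R5 6" using R3M(3) R4(2) r5(4,6) R2_6 F3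
                    by (simp_all add: F_def)
                  then show ?thesis by simp
                qed
                moreover have "set hi \<subseteq> set xs" "distinct hi" using xs(2) by (auto simp: hi_def)
                moreover have "set hi \<subseteq> {1..length S}" "inj_on ?f (set hi)"
                  using xs calculation(2) by (blast, blast intro: inj_on_subset)
                moreover have "arr M4 (M3 F) hi"
                  by (rule arr_cong[OF R3M(5)]) (use keep4 R3M(1,2) R2_6 in auto)
                moreover have "qarr M4 (M3 (F + 2)) hs"
                  by (rule qarr_cong[OF R3M(6)]) (use keep4 R3M(3,4) R2_6 in auto)
                moreover have "R5 2 + length hi \<le> R5 6" "R5 4 + 4 * length hs \<le> R5 6"
                  using r5 R3M(2,4) R4(2) by linarith+
                ultimately show ?thesis unfolding solve_pre_def using r5 vhs dist(2) by metis
              qed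
              show ?case
              proof (rule achieves_Seq[where ?T1.0 = ch and ?T2.0 = 3 and
                    ?Q1.0 = "solve_post S hi hs R5 M5"], goal_cases)
                case 1
                show ?case using less.hyps[OF _ pre5] split by (simp add: ch_def)
              next
                case (2 R6 M6)
                have keep6: "M6 a = M4 a" if "a < R4 6" "a \<notin> out ` set hs" for a
                  using 2 that r5 by (auto simp: solve_post_def)
                have R6: "R4 6 \<le> R6 6" "R6 7 = F" using 2 r5 by (auto simp: solve_post_def)
                have "F + 4 \<notin> out ` set hs" using outh unfolding F_def
                  by (metis imageE not_add_less1 add.assoc)
                then have "M6 (F + 4) = R 7" using keep6[of "F + 4"] R4 F3 fr4 by auto
                moreover have "R 6 \<le> R6 6" using R6 R4 F3 by (simp add: F_def)
                moreover have "M6 a = M a" if "a < R 6" "a \<notin> out ` set qs" for a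
                proof -
                  have "a < R3 6" "a < R4 6" using that(1) F3 R4 by (auto simp: F_def)
                  moreover have "a \<notin> out ` set ls" "a \<notin> out ` set hs" using that(2) outs by auto
                  ultimately show ?thesis using keep6 keep4 M3R that(1) by simp
                qed
                moreover have "answered ?f xs M6 q" if "q \<in> set qs" for q
                proof (rule answered[OF that])
                  show "\<forall>q \<in> set hs. answered ?f hi M6 q" using 2 by (simp add: solve_post_def)
                  show "\<forall>q \<in> set ls. answered ?f lo M6 q"
                  proof
                    fix q assume q: "q \<in> set ls"
                    then have "out q < R 6" by (rule outl)
                    then have "out q < R4 6" using F3 R4 by (simp add: F_def)
                    moreover have "out q \<notin> out ` set hs" using q disj by blast
                    ultimately have "M6 (out q) = M4 (out q)" using keep6 by blast
                    moreover have "answered ?f lo M4 q"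
                      using q \<open>solve_post S lo ls R3 M3 R4 M4\<close> by (simp add: solve_post_def)
                    ultimately show "answered ?f lo M6 q" using answered_cong by blast
                  qed
                qed
                ultimately show ?case using R6
                  by (intro achieves_blk) (auto simp: solve_post_def)
              qed simp
            qed simp
          qed simp
        qed (use b piv fr2 pS pre frame[OF M2] R2_6 in \<open>auto simp: F_def\<close>)
      qed simp
    qed (use pre xs in auto)
    then have "achieves P S (Call 1) R M (((216 * length xs + 36) + (cm +
      ((10 * length xs + 27 * length qs + 54) + (cl + (10 + (ch + 3)))))) + 5) (solve_post S xs qs R M)"
      using 3 pre by (intro body achieves_If) auto
    moreover have "300 * (length xs + length qs) + cm + cl + ch \<le> cost (length xs) (length qs)"
      using c_node[OF 3(2) _ split(1) lens split(2-5)] 3(1) unfolding cm_def cl_def ch_def ms by simp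
    moreover have "0 < length qs" using 3(1) by simp
    ultimately show ?thesis using 3(2) by (elim achieves_mono) auto
  qed
qed

section \<open>The cost recurrence\<close>

definition unit_cost :: real where
  "unit_cost = 300 * 4 ^ 100"

text \<open>
  If both children of a node receive queries, then the entropy-like term \<open>s * log 2 q\<close> drops by at
  least \<open>s / 4\<close>, which pays for the linear work; if only one does, the term \<open>100 * s\<close> drops enough.
  The last term pays for the queries, which move to a part of at most \<open>3 / 4\<close> of the size.  For
  \<open>s \<le> 100\<close> the bound on the size of the parts may be void, and a crude bound is absorbed
  in \<open>unit_cost\<close>.
\<close>

definition node_bound :: "nat \<Rightarrow> nat \<Rightarrow> real" where
  "node_bound s q = unit_cost *
     (100 * real s + 400 * real s * log 2 (real q) + real q * (1 + log 2 (real s)))"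

text \<open>The split bound gives parts of at most \<open>3 / 4\<close> of \<open>s\<close> once
  \<open>s \<ge> 70\<close>; the threshold 100 leaves room. A call without queries still pays for
  itself and its tests, hence 5.\<close>

definition cost :: "nat \<Rightarrow> nat \<Rightarrow> nat" where
  "cost s q = (if q = 0 then 5 else if s \<le> 100 then 300 * 4 ^ s * q else nat \<lfloor>node_bound s q\<rfloor>)"

lemma cost_empty: "5 \<le> cost s 0"
  by (simp add: cost_def)

lemma cost_leaf: "0 < q \<Longrightarrow> 300 * (1 + q) \<le> cost 1 q"
  by (simp add: cost_def)

lemma node_bound_ge: "1 \<le> s \<Longrightarrow> 1 \<le> q \<Longrightarrow> unit_cost * real q \<le> node_bound s q"
  unfolding node_bound_def
  by (intro mult_left_mono) (auto simp: unit_cost_def algebra_simps intro!: add_nonneg_nonneg)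

lemma cost_le_node_bound:
  assumes "1 \<le> s" "1 \<le> q"
  shows "real (cost s q) \<le> node_bound s q"
proof (cases "s \<le> 100")
  case True
  have "(4::real) ^ s \<le> 4 ^ 100" using True by (intro power_increasing) auto
  then have "300 * 4 ^ s * real q \<le> unit_cost * real q"
    unfolding unit_cost_def by (intro mult_right_mono mult_left_mono) auto
  moreover have "real (cost s q) = 300 * 4 ^ s * real q" using True assms by (simp add: cost_def)
  ultimately show ?thesis using node_bound_ge[OF assms] by linarith
next
  case False
  have "0 \<le> node_bound s q" using node_bound_ge[OF assms] by (smt (verit) unit_cost_def mult_nonneg_nonneg of_nat_0_le_iff zero_le_power)
  then show ?thesis using False assms by (simp add: cost_def)
qed

text \<open>Base 4 provides four shares of \<open>300 * X * q\<close>: one for the linear work,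
  three for the pivot call and the two children. Any proper split will do.\<close>

lemma cost_node_small:
  assumes "2 \<le> s" "s \<le> 100" "0 < q" "s1 + s2 = s" "q1 + q2 = q" "0 < s1" "0 < s2"
  shows "300 * (s + q) + cost ((s + 4) div 5) 1 + cost s1 q1 + cost s2 q2 \<le> cost s q"
proof -
  define X where "X = (4::nat) ^ (s - 1)"
  have Xs: "s + 1 \<le> X"
  proof -
    have "n + 3 \<le> 4 ^ (n + 1)" for n :: nat by (induction n) auto
    moreover obtain n where n: "s = n + 2" using assms(1) by (metis add.commute le_Suc_ex)
    ultimately have "n + 3 \<le> 4 ^ (n + 1)" by blast
    then show ?thesis by (simp add: X_def n)
  qed
  \<comment> \<open>\<open>max y 1\<close> also covers a child without queries, whose cost is the
    constant 5.\<close>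
  have le: "cost x y \<le> 300 * X * max y 1" if "x < s" for x y
  proof -
    have "(4::nat) ^ x \<le> X" unfolding X_def using that by (intro power_increasing) auto
    then have "300 * 4 ^ x * y \<le> 300 * X * y" by simp
    then show ?thesis using that assms(2) Xs by (cases "y = 0") (auto simp: cost_def max_absorb1)
  qed
  have q: "s + q \<le> X * q"
  proof -
    have "s + q \<le> (s + 1) * q" using assms(3) by (cases q) auto
    also have "\<dots> \<le> X * q" using Xs by (rule mult_le_mono1)
    finally show ?thesis .
  qed
  have m: "(s + 4) div 5 < s" using assms(1) by auto
  have "cost ((s + 4) div 5) 1 \<le> 300 * X" using le[OF m, of 1] by simp
  moreover have "cost s1 q1 \<le> 300 * X * max q1 1" "cost s2 q2 \<le> 300 * X * max q2 1"
    using assms(4,6,7) by (intro le; simp)+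
  moreover have "300 * X * max q1 1 + 300 * X * max q2 1 \<le> 300 * X * (q + 1)"
    unfolding distrib_left[symmetric] using assms(3,5) by (intro mult_le_mono2) auto
  moreover have "300 * X * (q + 1) + 300 * X \<le> 300 * X * (3 * q)"
    using assms(3) by (cases q) (auto simp: algebra_simps)
  moreover have "cost s q = 4 * (300 * (X * q))"
    using assms(1-3) unfolding cost_def X_def by (cases s) auto
  moreover have "300 * X * (3 * q) = 3 * (300 * (X * q))" by simp
  moreover have "300 * (s + q) \<le> 300 * (X * q)" using q by simp
  ultimately show ?thesis by linarith
qed

text \<open>The \<open>100 * s\<close> of the bound is divided into \<open>75 * s\<close> for the
  children, \<open>21 * s + 80\<close> for the pivot call and \<open>s / 4\<close> for the linear
  work. The work on queries is paid by \<open>q / 4\<close>, gained because the logarithm of the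
  size drops by \<open>1 / 4\<close>.\<close>

lemma cost_node_large:
  assumes "100 < s" "0 < q" "s1 + s2 = s" "q1 + q2 = q" "0 < s1" "0 < s2"
    and "10 * s1 \<le> 7 * s + 35" "10 * s2 \<le> 7 * s + 35"
  shows "300 * (s + q) + cost ((s + 4) div 5) 1 + cost s1 q1 + cost s2 q2 \<le> cost s q"
proof -
  define L where "L = log 2 (real s)"
  define K where "K = log 2 (real q)"
  define m where "m = (s + 4) div 5"
  have U: "1200 \<le> unit_cost" by (simp add: unit_cost_def)
  have K0: "0 \<le> K" using assms(2) by (simp add: K_def)
  have mr: "5 * real m \<le> real s + 4" "1 \<le> m" "m + 1 \<le> s"
    using assms(1) unfolding m_def by linarith+
  \<comment> \<open>The pivot call has one query, so its term with \<open>log 2 q\<close> vanishes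
    and this crude estimate is precise enough.\<close>
  have lm: "log 2 (real m) \<le> real m"
    using mr(2) less_exp[of m] by (simp add: log_le_iff powr_realpow less_imp_le)
  have bm: "real (cost m 1) \<le> unit_cost * (20 * real s + 80 + real s)"
  proof -
    have "real (cost m 1) \<le> node_bound m 1" using mr(2) by (intro cost_le_node_bound) auto
    also have "\<dots> \<le> unit_cost * (20 * real s + 80 + real s)"
      unfolding node_bound_def using lm mr U by (intro mult_left_mono) auto
    finally show ?thesis .
  qed
  \<comment> \<open>The reason is (3/4)^4 = 81/256 \<le> 1/2.\<close>
  have log34: "log 2 (3 / 4) \<le> - (1 / 4 :: real)"
  proof -
    have "4 * log 2 (3 / 4 :: real) = log 2 ((3 / 4) ^ 4)" by (simp add: log_nat_power)
    also have "\<dots> \<le> log 2 (1 / 2)" by (subst log_le_cancel_iff) (auto simp: power_divide)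
    also have "\<dots> = - 1" by (simp add: log_divide)
    finally show ?thesis by simp
  qed
  have part: "4 * real x \<le> 3 * real s" "log 2 (real x) \<le> L - 1 / 4"
    if "0 < x" "10 * x \<le> 7 * s + 35" for x
  proof -
    show x: "4 * real x \<le> 3 * real s" using that(2) assms(1) by linarith
    have "log 2 (real x) \<le> log 2 (real s * (3 / 4))"
      using x that(1) assms(1) by (subst log_le_cancel_iff) auto
    also have "\<dots> = L + log 2 (3 / 4)" unfolding L_def using assms(1) by (subst log_mult) auto
    finally show "log 2 (real x) \<le> L - 1 / 4" using log34 by linarith
  qed
  note p1 = part[OF assms(5,7)] and p2 = part[OF assms(6,8)]
  have s: "real s1 + real s2 = real s" "real q1 + real q2 = real q" using assms(3,4) by auto
  have child: "real (cost x y) \<le>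
      unit_cost * (100 * real x + 400 * real x * log 2 (real y) + real y * (3 / 4 + L))"
    if "0 < x" "0 < y" "log 2 (real x) \<le> L - 1 / 4" for x y
  proof -
    have "real (cost x y) \<le> node_bound x y" using that by (intro cost_le_node_bound) auto
    also have "\<dots> \<le> unit_cost * (100 * real x + 400 * real x * log 2 (real y) + real y * (3 / 4 + L))"
    proof -
      have "real y * (1 + log 2 (real x)) \<le> real y * (3 / 4 + L)"
        using that(3) by (intro mult_left_mono) auto
      then show ?thesis unfolding node_bound_def using U by (intro mult_left_mono) linarith+
    qed
    finally show ?thesis .
  qed
  \<comment> \<open>When all queries go to one side, the other call costs 5, and
    \<open>100 * x + 1 \<le> 75 * s\<close> leaves one \<open>unit_cost\<close> to pay for
    it.\<close>
  have one: "real (cost x q) + 5 \<le>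
      unit_cost * (75 * real s + 400 * real s * K + real q * (3 / 4 + L))"
    if "0 < x" "x \<le> s" "10 * x \<le> 7 * s + 35" for x
  proof -
    have "real (cost x q) \<le> unit_cost * (100 * real x + 400 * real x * K + real q * (3 / 4 + L))"
      using child[of x q] part[of x] that assms(2) by (auto simp: K_def)
    moreover have "unit_cost * (100 * real x + 400 * real x * K + real q * (3 / 4 + L)) + unit_cost
       \<le> unit_cost * (75 * real s + 400 * real s * K + real q * (3 / 4 + L))"
    proof -
      have "100 * real x + 1 \<le> 75 * real s" using that(3) assms(1) by linarith
      moreover have "400 * real x * K \<le> 400 * real s * K" using that(2) K0 by (intro mult_right_mono) auto
      ultimately have "100 * real x + 400 * real x * K + real q * (3 / 4 + L) + 1
        \<le> 75 * real s + 400 * real s * K + real q * (3 / 4 + L)" by linarith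
      then have "unit_cost * (100 * real x + 400 * real x * K + real q * (3 / 4 + L) + 1)
        \<le> unit_cost * (75 * real s + 400 * real s * K + real q * (3 / 4 + L))"
        using U by (intro mult_left_mono) auto
      then show ?thesis by (simp add: distrib_left)
    qed
    ultimately show ?thesis using U by linarith
  qed
  have main: "real (cost s1 q1) + real (cost s2 q2) \<le>
      unit_cost * (75 * real s + 400 * real s * K + real q * (3 / 4 + L))"
  proof -
    consider "q1 = 0" | "q2 = 0" | "0 < q1" "0 < q2" by blast
    then show ?thesis
    proof cases
      case 1
      then show ?thesis using one[of s2] assms by (simp add: cost_def)
    next
      case 2
      then show ?thesis using one[of s1] assms by (simp add: cost_def)
    next
      case 3
      have half: "log 2 (real y) \<le> K - 1" if "0 < y" "2 * y \<le> q" for y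
      proof -
        have "log 2 (real y) + 1 = log 2 (real y * 2)" using that(1) by (subst log_mult) auto
        also have "\<dots> \<le> K" unfolding K_def using that by (subst log_le_cancel_iff) auto
        finally show ?thesis by simp
      qed
      have le: "log 2 (real q1) \<le> K" "log 2 (real q2) \<le> K"
        unfolding K_def using 3 assms(4) by auto
      \<comment> \<open>The child with at most half of the queries loses a full bit, and it has at
        least \<open>s / 4\<close> entries because the other child has at most
        \<open>3 * s / 4\<close>. With factor 400 this gain cancels
        \<open>100 * s1 + 100 * s2\<close>.\<close>
      have "real s1 * log 2 (real q1) + real s2 * log 2 (real q2) \<le> real s * K - real s / 4"
      proof (cases "2 * q1 \<le> q")
        case True
        have "real s1 * log 2 (real q1) \<le> real s1 * (K - 1)"
          using half[OF 3(1) True] by (intro mult_left_mono) auto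
        moreover have "real s2 * log 2 (real q2) \<le> real s2 * K" using le by (intro mult_left_mono) auto
        moreover have "real s1 * (K - 1) + real s2 * K = real s * K - real s1"
          unfolding s(1)[symmetric] by (simp add: algebra_simps)
        ultimately show ?thesis using p2(1) s(1) by linarith
      next
        case False
        then have "2 * q2 \<le> q" using assms(4) by simp
        have "real s2 * log 2 (real q2) \<le> real s2 * (K - 1)"
          using half[OF 3(2) \<open>2 * q2 \<le> q\<close>] by (intro mult_left_mono) auto
        moreover have "real s1 * log 2 (real q1) \<le> real s1 * K" using le by (intro mult_left_mono) auto
        moreover have "real s2 * (K - 1) + real s1 * K = real s * K - real s2"
          unfolding s(1)[symmetric] by (simp add: algebra_simps)
        ultimately show ?thesis using p1(1) s(1) by linarith
      qed
      then have "(100 * real s1 + 400 * real s1 * log 2 (real q1) + real q1 * (3 / 4 + L)) +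
         (100 * real s2 + 400 * real s2 * log 2 (real q2) + real q2 * (3 / 4 + L))
         \<le> 400 * real s * K + real q * (3 / 4 + L)"
      proof -
        assume le: "real s1 * log 2 (real q1) + real s2 * log 2 (real q2) \<le> real s * K - real s / 4"
        have "real q * (3 / 4 + L) = real q1 * (3 / 4 + L) + real q2 * (3 / 4 + L)"
          unfolding s(2)[symmetric] by (rule distrib_right)
        moreover have "400 * real s1 * log 2 (real q1) = 400 * (real s1 * log 2 (real q1))"
          "400 * real s2 * log 2 (real q2) = 400 * (real s2 * log 2 (real q2))"
          "400 * real s * K = 400 * (real s * K)" by simp_all
        ultimately show ?thesis using le s(1) by linarith
      qed
      also have "\<dots> \<le> 75 * real s + 400 * real s * K + real q * (3 / 4 + L)" by simp
      finally have "unit_cost * ((100 * real s1 + 400 * real s1 * log 2 (real q1) + real q1 * (3 / 4 + L)) +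
         (100 * real s2 + 400 * real s2 * log 2 (real q2) + real q2 * (3 / 4 + L)))
         \<le> unit_cost * (75 * real s + 400 * real s * K + real q * (3 / 4 + L))"
        using U by (intro mult_left_mono) auto
      then show ?thesis
        using child[OF assms(5) 3(1) p1(2)] child[OF assms(6) 3(2) p2(2)] by (simp add: distrib_left)
    qed
  qed
  have total: "real (300 * (s + q) + cost m 1 + cost s1 q1 + cost s2 q2) \<le> node_bound s q"
  proof -
    have "1200 * (real s + real q) \<le> unit_cost * (real s + real q)"
      using U by (intro mult_right_mono) auto
    then have "300 * (real s + real q) \<le> unit_cost * (real s / 4 + real q / 4)"
      by (simp add: algebra_simps)
    moreover have "unit_cost * (real s / 4 + real q / 4) + unit_cost * (20 * real s + 80 + real s) +
        unit_cost * (75 * real s + 400 * real s * K + real q * (3 / 4 + L))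
      \<le> unit_cost * (100 * real s + 400 * real s * K + real q * (1 + L))"
      unfolding distrib_left[symmetric] using U assms(1)
      by (intro mult_left_mono) (auto simp: algebra_simps)
    ultimately show ?thesis using bm main unfolding node_bound_def K_def L_def by simp
  qed
  then have "300 * (s + q) + cost m 1 + cost s1 q1 + cost s2 q2 \<le> nat \<lfloor>node_bound s q\<rfloor>"
    by (simp add: le_nat_floor)
  then show ?thesis using assms(1,2) by (simp add: cost_def[of s q] m_def)
qed

lemma cost_node:
  assumes "2 \<le> s" "0 < q" "s1 + s2 = s" "q1 + q2 = q" "0 < s1" "0 < s2"
    and "10 * s1 \<le> 7 * s + 35" "10 * s2 \<le> 7 * s + 35"
  shows "300 * (s + q) + cost ((s + 4) div 5) 1 + cost s1 q1 + cost s2 q2 \<le> cost s q"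
  using cost_node_small[of s q s1 s2 q1 q2] cost_node_large[of s q s1 s2 q1 q2] assms
  by (cases "s \<le> 100") auto

text \<open>Both logarithms are at least 1, so each term of \<open>node_bound\<close> is absorbed by
  one of the two summands. The recurrence yields \<open>k * log 2 n\<close>; the further factor
  \<open>log 2 k\<close> is given away here.\<close>

lemma cost_bound:
  assumes "2 \<le> n" "2 \<le> k"
  shows "100 * real (n + k + 1) + real (cost n k) \<le> (600 * unit_cost) *
    (real n * log 2 (real k) + real k * log 2 (real k) * log 2 (real n))"
proof -
  define L where "L = log 2 (real n)"
  define K where "K = log 2 (real k)"
  have LK: "1 \<le> L" "1 \<le> K" using assms by (auto simp: L_def K_def)
  have U: "1200 \<le> unit_cost" by (simp add: unit_cost_def)
  have n: "real n \<le> real n * K" using LK by (simp add: mult_le_cancel_left1)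
  have "real k * (1 * 1) \<le> real k * (K * L)" using LK by (intro mult_left_mono mult_mono) auto
  moreover have "real k * (1 * L) \<le> real k * (K * L)"
    using LK by (intro mult_left_mono mult_right_mono) auto
  ultimately have k: "real k \<le> real k * (K * L)" "real k * L \<le> real k * (K * L)" by simp_all
  have "real (cost n k) \<le> node_bound n k" using assms by (intro cost_le_node_bound) auto
  also have "\<dots> = unit_cost * (100 * real n + 400 * (real n * K) + (real k + real k * L))"
    by (simp add: node_bound_def K_def L_def algebra_simps)
  finally have c: "real (cost n k) \<le> \<dots>" .
  have "100 * real (n + k + 1) \<le> 1200 * (real n + real k)" using assms by simp
  also have "\<dots> \<le> unit_cost * (real n + real k)" using U by (intro mult_right_mono) auto
  finally have "100 * real (n + k + 1) + real (cost n k) \<le> unit_cost * (real n + real k) +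
    unit_cost * (100 * real n + 400 * (real n * K) + (real k + real k * L))" using c by linarith
  also have "\<dots> = unit_cost *
      (real n + real k + (100 * real n + 400 * (real n * K) + (real k + real k * L)))"
    by (simp add: distrib_left)
  also have "\<dots> \<le> unit_cost * (600 * (real n * K + real k * (K * L)))"
  proof (rule mult_left_mono)
    show "real n + real k + (100 * real n + 400 * (real n * K) + (real k + real k * L))
      \<le> 600 * (real n * K + real k * (K * L))" unfolding distrib_left using n k by linarith
  qed (use U in simp)
  finally show ?thesis by (simp add: K_def L_def algebra_simps)
qed

section \<open>Range medians on the machine\<close>

text \<open>The answer cells 0 to k - 1 overlap the input queries in cells 0 to 2 * k - 1. This is
  harmless, because all queries are translated before the first answer is written.\<close>

definition main :: com where
  "main = Seq (blk [Const 8 0, Add 2 1 1, Add 10 2 8, Add 11 2 0, Const 12 1])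
     (Seq (While (Less 10 11) (blk [Const 9 1, Store 10 12, Add 10 10 9, Add 12 12 9]))
     (Seq (blk [Const 8 0, Add 3 0 8, Add 4 11 8, Add 5 1 8, Add 6 1 1, Add 6 6 6, Add 6 4 6,
       Const 13 0, Add 14 1 1, Add 15 4 8, Const 16 0])
     (Seq (While (Less 13 14) (blk [Const 9 1, Load 17 13, Add 13 13 9, Load 18 13, Add 13 13 9,
         Sub 19 18 17, Half 19 19, Sub 17 17 9, Store 15 17, Add 15 15 9, Store 15 18, Add 15 15 9,
         Store 15 19, Add 15 15 9, Store 15 16, Add 15 15 9, Add 16 16 9]))
       (Call 1))))"

text \<open>The range becomes half-open and counted from 0, and rank \<lceil>(r - l + 1) / 2\<rceil>
  becomes \<open>(r - l) div 2\<close> smaller elements.\<close>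

definition internal_query :: "(nat \<times> nat) list \<Rightarrow> nat \<Rightarrow> nat \<times> nat \<times> nat \<times> nat" where
  "internal_query Q j = (fst (Q ! j) - 1, snd (Q ! j), (snd (Q ! j) - fst (Q ! j)) div 2, j)"

text \<open>This links the counting of smaller elements in \<open>has_rank\<close> to the sorted
  list in \<open>rank_element\<close>.\<close>

lemma nth_sorted_list_of_set:
  fixes A :: "'a::linorder set"
  assumes "finite A" "a \<in> A"
  shows "sorted_list_of_set A ! card {b \<in> A. b < a} = a"
proof -
  define ys where "ys = sorted_list_of_set A"
  have ys: "sorted_wrt (<) ys" "set ys = A" using assms(1) by (simp_all add: ys_def)
  then obtain i where i: "i < length ys" "ys ! i = a" using assms(2) by (metis in_set_conv_nth)
  have "ys ! j < ys ! i \<longleftrightarrow> j < i" if "j < length ys" for j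
    using sorted_wrt_nth_less[OF ys(1)] that i(1) by (metis linorder_neqE_nat order_less_asym order_less_irrefl)
  then have "{j. j < length ys \<and> ys ! j < a} = {..<i}" using i by auto
  then have "length (filter (\<lambda>b. b < a) ys) = i" by (simp add: length_filter_conv_card)
  moreover have "distinct ys" by (simp add: ys_def)
  then have "length (filter (\<lambda>b. b < a) ys) = card {b \<in> A. b < a}"
    using ys(2) by (metis distinct_card distinct_filter set_filter)
  ultimately show ?thesis using i by (simp add: ys_def)
qed

lemma has_rank_range_median:
  assumes "inj_on (elem S) {l..r}" "l \<le> r"
    and "has_rank (elem S) [l..<Suc r] ((r - l) div 2) p"
  shows "p \<in> {l..r}" "elem S p = range_median S l r"
proof -
  show p: "p \<in> {l..r}" using assms(3) by (auto simp: has_rank_def)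
  have "nat \<lceil>real (r - l + 1) / 2\<rceil> - 1 = (r - l) div 2"
  proof -
    obtain m where "r - l = 2 * m \<or> r - l = 2 * m + 1" by (metis evenE oddE)
    moreover have "\<lceil>(2 * real m + 1) / 2\<rceil> = int m + 1" by (intro ceiling_unique) auto
    moreover have "\<lceil>(2 * real m + 2) / 2\<rceil> = int m + 1" by (intro ceiling_unique) auto
    ultimately show ?thesis by (auto simp: algebra_simps)
  qed
  moreover have "card {b \<in> elem S ` {l..r}. b < elem S p} = (r - l) div 2"
  proof -
    have "{b \<in> elem S ` {l..r}. b < elem S p} = elem S ` {z \<in> {l..r}. elem S z < elem S p}" by auto
    then have "card {b \<in> elem S ` {l..r}. b < elem S p} = card {z \<in> {l..r}. elem S z < elem S p}"
      using assms(1) by (simp add: card_image inj_on_def)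
    also have "\<dots> = card (set (filter (\<lambda>z. elem S z < elem S p) [l..<Suc r]))"
      by (rule arg_cong[where f = card]) auto
    also have "\<dots> = length (filter (\<lambda>z. elem S z < elem S p) [l..<Suc r])"
      by (rule distinct_card) simp
    finally show ?thesis using assms(3) unfolding has_rank_def by (elim conjE) (rule trans)
  qed
  ultimately show "elem S p = range_median S l r"
    unfolding range_median_def rank_element_def
    using nth_sorted_list_of_set[of "elem S ` {l..r}" "elem S p"] p by simp
qed

lemma inj_on_elem: "distinct S \<Longrightarrow> inj_on (elem S) {1..length S}"
  unfolding elem_def by (intro inj_onI) (auto simp: nth_eq_iff_index_eq)

lemma main_achieves:
  fixes S :: "'a::linorder list"
  assumes P: "P = [main, solve]" and S: "S \<in> arrays n" and Q: "Q \<in> queries n k"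
    and init: "initial (length S) Q = (R, M)"
    and sol: "\<And>xs qs R M. solve_pre S xs qs R M \<Longrightarrow>
      achieves P S (Call 1) R M (cost (length xs) (length qs)) (solve_post S xs qs R M)"
  shows "achieves P S (Call 0) R M (30 * (n + k + 1) + cost n k)
    (\<lambda>R' M'. solution S Q (map M' [0..<length Q]))"
proof -
  have n: "length S = n" "distinct S" and k: "length Q = k"
    using S Q by (simp_all add: arrays_def queries_def)
  have valid: "1 \<le> fst (Q ! j) \<and> fst (Q ! j) \<le> snd (Q ! j) \<and> snd (Q ! j) \<le> n" if "j < k" for j
  proof -
    have "\<forall>x \<in> set Q. 1 \<le> fst x \<and> fst x \<le> snd x \<and> snd x \<le> n"
      using Q by (simp add: queries_def case_prod_beta)
    then show ?thesis using nth_mem[of j Q] that k by simp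
  qed
  have "R = (\<lambda>_. 0)(0 := length S, 1 := length Q)"
    and M: "M = (\<lambda>a. if a < 2 * length Q
       then (if even a then fst (Q ! (a div 2)) else snd (Q ! (a div 2))) else 0)"
    using init unfolding initial_def prod.inject by - (elim conjE, rule sym, assumption)+
  then have R: "R 0 = n" "R 1 = k" using n k by simp_all
  have lr0: "M (2 * j) = fst (Q ! j)" "M (Suc (2 * j)) = snd (Q ! j)" if "j < k" for j
    unfolding M using that k by simp_all
  let ?q = "\<lambda>j. map (internal_query Q) [0..<j]"
  let ?B = "2 * k + n"
  have "achieves P S main R M (5 + ((5 * n + 1) + (11 + ((18 * k + 1) + (cost n k + 1)))))
    (\<lambda>R' M'. solution S Q (map M' [0..<length Q]))"
    unfolding main_def
  proof (rule achieves_blk_Seq[where ?T1.0 = "(5 * n + 1) + (11 + ((18 * k + 1) + (cost n k + 1)))"],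
      simp, goal_cases)
    case (1 R1 M1)
    then have a: "M1 = M" "R1 0 = n" "R1 1 = k" "R1 2 = 2 * k" "R1 10 = 2 * k" "R1 11 = ?B"
      "R1 12 = 1" using R by auto
    let ?I = "\<lambda>i R' M'. i \<le> n \<and> R' 0 = n \<and> R' 1 = k \<and> R' 2 = 2 * k \<and> R' 10 = 2 * k + i \<and>
      R' 11 = ?B \<and> R' 12 = Suc i \<and> arr M' (2 * k) [1..<Suc i] \<and> (\<forall>a < 2 * k. M' a = M a)"
    show ?case
    proof (rule achieves_Seq[where ?T1.0 = "5 * n + 1" and ?Q1.0 = "?I n" and
          ?T2.0 = "11 + ((18 * k + 1) + (cost n k + 1))"], goal_cases)
      case 1
      have "achieves P S (While (Less 10 11) (blk [Const 9 1, Store 10 12, Add 10 10 9, Add 12 12 9]))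
        R1 M1 ((4 + 1) * (n - 0) + 1) (?I n)"
      proof (rule achieves_While[where I = ?I and \<mu> = "\<lambda>i. n - i"], goal_cases)
        case 1
        then show ?case using a by auto
      next
        case (2 i R2 M2)
        have "achieves P S (blk [Const 9 1, Store 10 12, Add 10 10 9, Add 12 12 9]) R2 M2 4 (?I (Suc i))"
        proof (rule achieves_blk, simp, simp, goal_cases)
          case (1 R3 M3)
          then have m: "M3 = M2(2 * k + i := Suc i)" using 2 by auto
          have "arr M3 (2 * k) [1..<Suc i]"
            by (rule arr_cong[of M2]) (use 2 m in \<open>auto simp del: upt_Suc\<close>)
          moreover have "[1..<Suc (Suc i)] = [1..<Suc i] @ [Suc i]" by simp
          ultimately have "arr M3 (2 * k) [1..<Suc (Suc i)]" by (simp add: arr_append m del: upt_Suc)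
          then show ?case using 1 2 m by (auto simp del: upt_Suc)
        qed
        then show ?case using 2 by (intro exI[of _ "Suc i"]) auto
      next
        case (3 i R2 M2)
        then have "i = n" by auto
        then show ?case using 3(1) by blast
      qed
      then show ?case by simp
    next
      case (2 R2 M2)
      show ?case
      proof (rule achieves_blk_Seq[where ?T1.0 = "(18 * k + 1) + (cost n k + 1)"], simp, goal_cases)
        case (1 R3 M3)
        then have b: "M3 = M2" "R3 2 = 2 * k" "R3 3 = n" "R3 4 = ?B" "R3 5 = k" "R3 6 = ?B + 4 * k"
          "R3 13 = 0" "R3 14 = 2 * k" "R3 15 = ?B" "R3 16 = 0" using 2 by auto
        let ?J = "\<lambda>j R' M'. j \<le> k \<and> R' 2 = 2 * k \<and> R' 3 = n \<and> R' 4 = ?B \<and> R' 5 = k \<and>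
          R' 6 = ?B + 4 * k \<and> R' 13 = 2 * j \<and> R' 14 = 2 * k \<and> R' 15 = ?B + 4 * j \<and> R' 16 = j \<and>
          arr M' (2 * k) [1..<Suc n] \<and> qarr M' ?B (?q j) \<and> (\<forall>a < 2 * k. M' a = M a)"
        show ?case
        proof (rule achieves_Seq[where ?T1.0 = "18 * k + 1" and ?Q1.0 = "?J k" and
              ?T2.0 = "cost n k + 1"], goal_cases)
          case 1
          have "achieves P S (While (Less 13 14) (blk [Const 9 1, Load 17 13, Add 13 13 9, Load 18 13,
             Add 13 13 9, Sub 19 18 17, Half 19 19, Sub 17 17 9, Store 15 17, Add 15 15 9, Store 15 18,
             Add 15 15 9, Store 15 19, Add 15 15 9, Store 15 16, Add 15 15 9, Add 16 16 9]))
             R3 M3 ((17 + 1) * (k - 0) + 1) (?J k)"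
          proof (rule achieves_While[where I = ?J and \<mu> = "\<lambda>j. k - j"], goal_cases)
            case 1
            then show ?case using b 2 by auto
          next
            case (2 j R4 M4)
            then have j: "j < k" by auto
            have lr: "M4 (2 * j) = fst (Q ! j)" "M4 (Suc (2 * j)) = snd (Q ! j)"
              using 2 j lr0[OF j] by simp_all
            have "achieves P S (blk [Const 9 1, Load 17 13, Add 13 13 9, Load 18 13,
             Add 13 13 9, Sub 19 18 17, Half 19 19, Sub 17 17 9, Store 15 17, Add 15 15 9, Store 15 18,
             Add 15 15 9, Store 15 19, Add 15 15 9, Store 15 16, Add 15 15 9, Add 16 16 9])
             R4 M4 17 (?J (Suc j))"
            proof (rule achieves_blk, simp, simp, goal_cases)
              case (1 R5 M5)
              let ?p = "?B + 4 * j"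
              have r: "R5 2 = 2 * k" "R5 3 = n" "R5 4 = ?B" "R5 5 = k" "R5 6 = ?B + 4 * k"
                "R5 13 = 2 * Suc j" "R5 14 = 2 * k" "R5 15 = ?B + 4 * Suc j" "R5 16 = Suc j"
                and m: "M5 = M4(?p := fst (Q ! j) - 1, Suc ?p := snd (Q ! j),
                  Suc (Suc ?p) := (snd (Q ! j) - fst (Q ! j)) div 2, Suc (Suc (Suc ?p)) := j)"
                using 1 2 lr by auto
              have "arr M5 (2 * k) [1..<Suc n]" by (rule arr_cong[of M4]) (use 2 m in \<open>auto simp del: upt_Suc\<close>)
              moreover have "qarr M5 ?B (?q j)" by (rule qarr_cong[of M4]) (use 2 m in auto)
              then have "qarr M5 ?B (?q (Suc j))" by (simp add: qarr_append internal_query_def m)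
              moreover have "\<forall>a < 2 * k. M5 a = M a" using 2 m by auto
              ultimately show ?case using r j by auto
            qed
            then show ?case using j by (intro exI[of _ "Suc j"]) auto
          next
            case (3 j R4 M4)
            then have "j = k" by auto
            then show ?case using 3(1) by blast
          qed
          then show ?case by simp
        next
          case (2 R4 M4)
          have "solve_pre S [1..<Suc n] (?q k) R4 M4"
            unfolding solve_pre_def
          proof (intro conjI ballI)
            fix q assume "q \<in> set (?q k)"
            then obtain j where j: "q = internal_query Q j" "j < k" by auto
            show "valid_query (length [1..<Suc n]) q" "out q < R4 6"
              "out q \<notin> {R4 4..<R4 4 + 4 * length (?q k)}"
              using valid[OF j(2)] j 2 by (auto simp: internal_query_def)
          next
            have "map out (?q k) = [0..<k]" by (simp add: comp_def internal_query_def)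
            then show "distinct (map out (?q k))" by simp
            show "inj_on (elem S) (set [1..<Suc n])" "set [1..<Suc n] \<subseteq> {1..length S}"
              using inj_on_elem[OF n(2)] n(1)
              by (simp_all add: atLeastLessThanSuc_atLeastAtMost del: upt_Suc)
          qed (use 2 in \<open>simp_all del: upt_Suc\<close>)
          from sol[OF this] have "achieves P S (Call 1) R4 M4 (cost n k)
            (solve_post S [1..<Suc n] (?q k) R4 M4)" by (simp del: upt_Suc)
          then show ?case
          proof (rule achieves_mono, goal_cases)
            case (2 R5 M5)
            have "M5 j \<in> {1..length S} \<and> elem S (M5 j) = range_median S (fst (Q ! j)) (snd (Q ! j))"
              if j: "j < k" for j
            proof -
              define l where "l = fst (Q ! j)"
              define r where "r = snd (Q ! j)"
              have lr: "1 \<le> l" "l \<le> r" "r \<le> n" using valid[OF j] by (auto simp: l_def r_def)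
              have "internal_query Q j \<in> set (?q k)" using j by auto
              then have "answered (elem S) [1..<Suc n] M5 (internal_query Q j)"
                using 2 unfolding solve_post_def by blast
              moreover have "drop (l - 1) (take r [1..<Suc n]) = [l..<Suc r]"
                using lr by (simp add: take_upt drop_upt del: upt_Suc)
              ultimately have h: "has_rank (elem S) [l..<Suc r] ((r - l) div 2) (M5 j)"
                by (simp add: internal_query_def l_def r_def)
              have "inj_on (elem S) {l..r}"
                using inj_on_elem[OF n(2)] by (rule inj_on_subset) (use lr n in auto)
              from has_rank_range_median[OF this lr(2) h] show ?thesis
                using lr n by (auto simp: l_def r_def)
            qed
            then show ?case unfolding solution_def
              by (auto simp: list_all2_conv_all_nth k case_prod_beta)
          qed simp
        qed simp
      qed simp
    qed simp
  qed simp
  then have "achieves P S (Call 0) R M (5 + ((5 * n + 1) + (11 + ((18 * k + 1) + (cost n k + 1)))) + 1)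
    (\<lambda>R' M'. solution S Q (map M' [0..<length Q]))"
    by (intro achieves_Call) (simp_all add: P)
  then show ?thesis by (rule achieves_mono) auto
qed

section \<open>The lower bound\<close>

text \<open>Two arrays reach the same leaf. Equality of results would be weaker, as different leaves
  may output the same positions.\<close>

fun same_path :: "ctree \<Rightarrow> 'a::linorder list \<Rightarrow> 'a list \<Rightarrow> bool" where
  "same_path (Output ps) S S' \<longleftrightarrow> True"
| "same_path (Compare i j T U) S S' \<longleftrightarrow> (elem S i < elem S j \<longleftrightarrow> elem S' i < elem S' j) \<and>
     (if elem S i < elem S j then same_path T S S' else same_path U S S')"

lemma same_path_refl: "same_path T S S"
  by (induction T) auto

lemma same_path_sym: "same_path T S S' \<Longrightarrow> same_path T S' S"
  by (induction T) (auto split: if_splits)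

text \<open>A leaf holds at most one member of \<open>F\<close>, and the paths of members have
  length at most \<open>d\<close>; the induction splits \<open>F\<close> by the outcome at the
  root.\<close>

lemma card_le_comparisons:
  assumes "finite F" "\<And>S S'. S \<in> F \<Longrightarrow> S' \<in> F \<Longrightarrow> same_path T S S' \<Longrightarrow> S = S'"
    and "\<And>S. S \<in> F \<Longrightarrow> comparisons T S \<le> d"
  shows "card F \<le> 2 ^ d"
  using assms
proof (induction T arbitrary: F d)
  case (Output ps)
  then have "card F \<le> 1" by (subst card_le_Suc0_iff_eq[simplified One_nat_def[symmetric]]) auto
  then show ?case by (meson le_trans one_le_numeral one_le_power)
next
  case (Compare i j T U)
  show ?case
  proof (cases "F = {}")
    case False
    then obtain d' where d: "d = Suc d'" using Compare.prems(3) by (cases d) fastforce+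
    define F1 where "F1 = {S \<in> F. elem S i < elem S j}"
    define F2 where "F2 = {S \<in> F. \<not> elem S i < elem S j}"
    have "card F1 \<le> 2 ^ d'"
    proof (rule Compare.IH(1))
      show "comparisons T S \<le> d'" if "S \<in> F1" for S
        using Compare.prems(3)[of S] that by (simp add: F1_def d)
    qed (use Compare.prems(1,2) in \<open>auto simp: F1_def\<close>)
    moreover have "card F2 \<le> 2 ^ d'"
    proof (rule Compare.IH(2))
      show "comparisons U S \<le> d'" if "S \<in> F2" for S
        using Compare.prems(3)[of S] that by (simp add: F2_def d)
    qed (use Compare.prems(1,2) in \<open>auto simp: F2_def\<close>)
    moreover have "F = F1 \<union> F2" by (auto simp: F1_def F2_def)
    then have "card F \<le> card F1 + card F2" by (simp add: card_Un_le)
    ultimately show ?thesis by (simp add: d)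
  qed simp
qed

text \<open>The element type is an arbitrary linear order, perhaps finite, so a new array is
  obtained by permuting the entries of a given one according to the ranks of the keys.\<close>

lemma array_of_keys:
  fixes key :: "nat \<Rightarrow> 'k::linorder"
  assumes "(arrays n :: 'a::linorder list set) \<noteq> {}" "inj_on key {1..n}"
  shows "\<exists>S \<in> (arrays n :: 'a list set).
    \<forall>p \<in> {1..n}. \<forall>q \<in> {1..n}. elem S p < elem S q \<longleftrightarrow> key p < key q"
proof -
  obtain S0 :: "'a list" where S0: "length S0 = n" "distinct S0"
    using assms(1) by (auto simp: arrays_def)
  define e where "e = sort S0"
  have e: "length e = n" "sorted_wrt (<) e"
    using S0 by (auto simp: e_def strict_sorted_iff)
  define rk where "rk p = card {q \<in> {1..n}. key q < key p}" for p
  have rk: "rk p < rk q \<longleftrightarrow> key p < key q" if "p \<in> {1..n}" "q \<in> {1..n}" for p q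
  proof -
    have lt: "rk p < rk q" if "key p < key q" "p \<in> {1..n}" for p q
      unfolding rk_def
    proof (rule psubset_card_mono)
      have "p \<in> {q' \<in> {1..n}. key q' < key q}" "p \<notin> {q' \<in> {1..n}. key q' < key p}"
        using that by simp_all
      moreover have "{q' \<in> {1..n}. key q' < key p} \<subseteq> {q' \<in> {1..n}. key q' < key q}"
        using that(1) by (auto intro: less_trans)
      ultimately show "{q' \<in> {1..n}. key q' < key p} \<subset> {q' \<in> {1..n}. key q' < key q}" by blast
    qed simp
    show ?thesis
    proof (cases "key p" "key q" rule: linorder_cases)
      case equal
      then have "p = q" using inj_on_eq_iff[OF assms(2) that] by simp
      then show ?thesis by simp
    next
      case less
      then show ?thesis using lt[OF less that(1)] by simp
    next
      case greater
      then show ?thesis using lt[OF greater that(2)] by (meson less_asym)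
    qed
  qed
  have rkn: "rk p < n" if "p \<in> {1..n}" for p
  proof -
    have "p \<notin> {q \<in> {1..n}. key q < key p}" by simp
    then have "{q \<in> {1..n}. key q < key p} \<subset> {1..n}" using that by blast
    then have "rk p < card {1..n}" unfolding rk_def by (intro psubset_card_mono) simp_all
    then show ?thesis by simp
  qed
  define S where "S = map (\<lambda>p. e ! rk p) [1..<Suc n]"
  have el: "elem S p = e ! rk p" if "p \<in> {1..n}" for p
  proof -
    have "p - 1 < n" "1 + (p - 1) = p" using that by auto
    then show ?thesis by (simp add: S_def elem_def del: upt_Suc)
  qed
  have cmp: "elem S p < elem S q \<longleftrightarrow> key p < key q" if "p \<in> {1..n}" "q \<in> {1..n}" for p q
  proof -
    have "e ! i < e ! j \<longleftrightarrow> i < j" if "i < n" "j < n" for i j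
      using sorted_wrt_nth_less[OF e(2), of i j] sorted_wrt_nth_less[OF e(2), of j i] that e(1)
      by (cases i j rule: linorder_cases) auto
    then have "e ! rk p < e ! rk q \<longleftrightarrow> rk p < rk q" using rkn that by blast
    then show ?thesis using el rk that by simp
  qed
  have "inj_on (\<lambda>p. e ! rk p) {1..n}"
  proof (rule inj_onI)
    fix p q assume pq: "p \<in> {1..n}" "q \<in> {1..n}" "e ! rk p = e ! rk q"
    then have "\<not> key p < key q" "\<not> key q < key p" using cmp[of p q] cmp[of q p] el by auto
    then have "key p = key q" by simp
    then show "p = q" using inj_on_eq_iff[OF assms(2) pq(1,2)] by simp
  qed
  then have "S \<in> arrays n"
    by (simp add: arrays_def S_def distinct_map atLeastLessThanSuc_atLeastAtMost del: upt_Suc)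
  then show ?thesis using cmp by blast
qed

section \<open>Inputs that a leaf cannot tell apart\<close>

definition agrees :: "nat \<Rightarrow> 'a::linorder list \<Rightarrow> 'a list \<Rightarrow> 'a list \<Rightarrow> bool" where
  "agrees n S1 S2 S3 \<longleftrightarrow> (\<forall>p \<in> {1..n}. \<forall>q \<in> {1..n}.
     elem S1 p < elem S1 q \<and> elem S2 p < elem S2 q \<longrightarrow> elem S3 p < elem S3 q)"

lemma elem_linear:
  fixes S :: "'a::linorder list"
  assumes "S \<in> arrays n" "p \<in> {1..n}" "q \<in> {1..n}" "p \<noteq> q"
  shows "elem S p < elem S q \<or> elem S q < elem S p"
proof -
  have "inj_on (elem S) {1..n}" using inj_on_elem[of S] assms(1) by (auto simp: arrays_def)
  then have "elem S p \<noteq> elem S q" using inj_on_eq_iff[OF _ assms(2,3)] assms(4) by blast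
  then show ?thesis by (simp add: neq_iff)
qed

text \<open>Every comparison on the common path has the same outcome in \<open>S1\<close> and
  \<open>S2\<close>, so it is among the relations that \<open>S3\<close> inherits.\<close>

lemma result_agrees:
  assumes "S1 \<in> arrays n" "S2 \<in> arrays n" "agrees n S1 S2 S3"
    and "positions T \<subseteq> {1..n}" "same_path T S1 S2"
  shows "result T S3 = result T S1"
  using assms(4,5)
proof (induction T)
  case (Compare i j T U)
  have ij: "i \<in> {1..n}" "j \<in> {1..n}" using Compare.prems by auto
  have "elem S3 i < elem S3 j \<longleftrightarrow> elem S1 i < elem S1 j"
  proof (cases "i = j \<or> elem S1 i < elem S1 j")
    case True
    then show ?thesis using assms(3) ij Compare.prems(2) by (auto simp: agrees_def)
  next
    case False
    then have "elem S1 j < elem S1 i" "elem S2 j < elem S2 i"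
      using elem_linear[OF assms(1) ij] elem_linear[OF assms(2) ij] Compare.prems(2) by auto
    then have "elem S3 j < elem S3 i" using assms(3) ij by (auto simp: agrees_def)
    then show ?thesis using False by auto
  qed
  then show ?case using Compare by (auto split: if_splits)
qed simp

text \<open>
  With \<open>m\<close> small elements in front of the middle part and large ones behind it, the range
  \<open>[i + 1, 2 * m + i]\<close> contains \<open>m - i\<close> small and \<open>i\<close> large elements, so its median is the
  element of rank \<open>i\<close> of the middle part.
\<close>

definition padded :: "nat \<Rightarrow> nat \<Rightarrow> 'a::linorder list \<Rightarrow> bool" where
  "padded n m S \<longleftrightarrow> (\<forall>b \<in> {m+1..2*m}.
     (\<forall>a \<in> {1..m}. elem S a < elem S b) \<and> (\<forall>c \<in> {2*m+1..n}. elem S b < elem S c))"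

lemma padded_median:
  assumes S: "S \<in> arrays n" "padded n m S" and m: "3 * m \<le> n" "1 \<le> i" "i \<le> m"
    and sol: "solution S Q ps" "j < length Q" "Q ! j = (i + 1, 2 * m + i)"
  shows "has_rank (elem S) [m+1..<2*m+1] (i - 1) (ps ! j)"
proof -
  have n: "length S = n" "distinct S" using S by (auto simp: arrays_def)
  note inj = inj_on_elem[OF n(2), unfolded n(1)]
  have ps: "ps ! j \<in> {1..n}" "elem S (ps ! j) = range_median S (i + 1) (2 * m + i)"
    using sol n unfolding solution_def by (auto simp: list_all2_conv_all_nth case_prod_beta)
  have sub: "set [m+1..<2*m+1] \<subseteq> {1..n}" using m by auto
  have injm: "inj_on (elem S) (set [m+1..<2*m+1])" using inj sub by (rule inj_on_subset)
  have "i - 1 < length [m+1..<2*m+1]" using m by (simp del: upt_Suc)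
  then obtain z where z: "has_rank (elem S) [m+1..<2*m+1] (i - 1) z"
    using has_rank_ex[OF injm distinct_upt] by blast
  have zm: "z \<in> {m+1..2*m}" using z by (auto simp: has_rank_def)
  have "[i+1..<Suc (2*m+i)] = [i+1..<m+1] @ [m+1..<2*m+1] @ [2*m+1..<2*m+1+i]"
  proof -
    show ?thesis
      using upt_add_eq_append[of "i+1" "m+1" "m+i"] upt_add_eq_append[of "m+1" "2*m+1" i] m
      by (simp add: mult_2 add.assoc del: upt_Suc)
  qed
  moreover have "filter (\<lambda>x. elem S x < elem S z) [i+1..<m+1] = [i+1..<m+1]"
  proof (rule filter_True, rule ballI)
    fix x assume "x \<in> set [i+1..<m+1]"
    then have "x \<in> {1..m}" by (simp del: upt_Suc)
    then show "elem S x < elem S z" using S(2) zm unfolding padded_def by blast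
  qed
  moreover have "filter (\<lambda>x. elem S x < elem S z) [2*m+1..<2*m+1+i] = []"
  proof (rule filter_False, rule ballI)
    fix x assume "x \<in> set [2*m+1..<2*m+1+i]"
    then have "x \<in> {2*m+1..n}" using m by auto
    then have "elem S z < elem S x" using S(2) zm unfolding padded_def by blast
    then show "\<not> elem S x < elem S z" by simp
  qed
  \<comment> \<open>The range has \<open>2 * m\<close> positions, so \<open>m - 1\<close> elements
    are smaller than its median: the \<open>m - i\<close> small ones and \<open>i - 1\<close> from
    the middle part.\<close>
  ultimately have "has_rank (elem S) [i+1..<Suc (2*m+i)] ((2*m+i - (i+1)) div 2) z"
    using z zm m unfolding has_rank_def by (simp del: upt_Suc)
  then have "elem S z = range_median S (i+1) (2*m+i)"
  proof (rule has_rank_range_median(2)[rotated 2])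
    show "inj_on (elem S) {i+1..2*m+i}" using inj by (rule inj_on_subset) (use m in auto)
  qed (use m in simp)
  then have "elem S z = elem S (ps ! j)" using ps(2) by simp
  moreover have "z \<in> {1..n}" using zm m by auto
  ultimately have "z = ps ! j" using inj_onD[OF inj] ps(1) by blast
  then show ?thesis using z by simp
qed


text \<open>
  The relations common to \<open>S1\<close> and \<open>S2\<close> form a partial order in which \<open>x\<close> and \<open>y\<close> are
  incomparable, so it has linear extensions in which \<open>x\<close> and \<open>y\<close> are neighbours, in either order.
  Both reach the leaf of \<open>S1\<close>, but \<open>x\<close> has different ranks in them.
\<close>

lemma agreeing_neighbours:
  fixes S1 S2 :: "'a::linorder list"
  assumes S: "S1 \<in> arrays n" "S2 \<in> arrays n" and xy: "x \<in> {1..n}" "y \<in> {1..n}"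
    and less: "elem S1 y < elem S1 x" "elem S2 x < elem S2 y"
  obtains S3 S4 where "S3 \<in> arrays n" "S4 \<in> arrays n" "agrees n S1 S2 S3" "agrees n S1 S2 S4"
    "\<And>z. z \<in> {1..n} \<Longrightarrow> elem S3 z < elem S3 x \<Longrightarrow> elem S4 z < elem S4 x"
    "\<not> elem S3 y < elem S3 x" "elem S4 y < elem S4 x"
proof -
  define before where "before p q \<longleftrightarrow> elem S1 p < elem S1 q \<and> elem S2 p < elem S2 q" for p q
  define D where "D = {z \<in> {1..n}. before z x \<or> before z y}"
  define rk where "rk p = card {q \<in> {1..n}. elem S1 q < elem S1 p}" for p
  \<comment> \<open>The elements of \<open>D\<close> come first, then the pair, then the rest, both
    outer groups in the order of \<open>S1\<close>; ranks are below \<open>n\<close>, so the groups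
    do not mix. The flag \<open>b\<close> puts \<open>y\<close> in front of
    \<open>x\<close>.\<close>
  define key where "key b z = (if z \<in> D then rk z else if z = x then (if b then n + 1 else n)
    else if z = y then (if b then n else n + 1) else n + 2 + rk z)" for b z
  have ne: "x \<noteq> y" using less by auto
  have xyD: "x \<notin> D" "y \<notin> D" using less by (auto simp: D_def before_def)
  have rk: "rk p < rk q" if "elem S1 p < elem S1 q" "p \<in> {1..n}" for p q
    unfolding rk_def
  proof (rule psubset_card_mono)
    have "p \<in> {q' \<in> {1..n}. elem S1 q' < elem S1 q}" "p \<notin> {q' \<in> {1..n}. elem S1 q' < elem S1 p}"
      using that by simp_all
    moreover have "{q' \<in> {1..n}. elem S1 q' < elem S1 p} \<subseteq> {q' \<in> {1..n}. elem S1 q' < elem S1 q}"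
      using that(1) by (auto intro: less_trans)
    ultimately show "{q' \<in> {1..n}. elem S1 q' < elem S1 p} \<subset> {q' \<in> {1..n}. elem S1 q' < elem S1 q}"
      by blast
  qed simp
  have rkn: "rk p < n" if "p \<in> {1..n}" for p
  proof -
    have "p \<notin> {q \<in> {1..n}. elem S1 q < elem S1 p}" by simp
    then have "{q \<in> {1..n}. elem S1 q < elem S1 p} \<subset> {1..n}" using that by blast
    then have "rk p < card {1..n}" unfolding rk_def by (intro psubset_card_mono) simp_all
    then show ?thesis by simp
  qed
  have rk_inj: "p = q" if "rk p = rk q" "p \<in> {1..n}" "q \<in> {1..n}" for p q
    using rk[of p q] rk[of q p] elem_linear[OF S(1) that(2,3)] that by auto
  have inj: "inj_on (key b) {1..n}" for b
  proof (rule inj_onI)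
    fix p q assume "p \<in> {1..n}" "q \<in> {1..n}" "key b p = key b q"
    then show "p = q"
      using rkn[of p] rkn[of q] rk_inj[of p q] ne by (auto simp: key_def split: if_splits)
  qed
  have mono: "key b p < key b q" if pq: "before p q" "p \<in> {1..n}" "q \<in> {1..n}" for b p q
  proof (cases "q \<in> D")
    case True
    then have "p \<in> D" using pq unfolding D_def before_def by (auto intro: less_trans)
    then show ?thesis using True rk[of p q] pq by (simp add: key_def before_def)
  next
    case False
    then have "rk p < rk q" "p \<in> D \<or> (q \<noteq> x \<and> q \<noteq> y)"
      using rk[of p q] pq by (auto simp: D_def before_def)
    then show ?thesis using False rkn[OF pq(2)] by (auto simp: key_def)
  qed
  have arr: "(arrays n :: 'a list set) \<noteq> {}" using S by auto
  obtain S3 :: "'a list" where S3: "S3 \<in> arrays n"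
    "\<And>p q. p \<in> {1..n} \<Longrightarrow> q \<in> {1..n} \<Longrightarrow> elem S3 p < elem S3 q \<longleftrightarrow> key False p < key False q"
    using array_of_keys[OF arr inj[of False]] by blast
  obtain S4 :: "'a list" where S4: "S4 \<in> arrays n"
    "\<And>p q. p \<in> {1..n} \<Longrightarrow> q \<in> {1..n} \<Longrightarrow> elem S4 p < elem S4 q \<longleftrightarrow> key True p < key True q"
    using array_of_keys[OF arr inj[of True]] by blast
  show thesis
  proof (rule that[OF S3(1) S4(1)])
    show "agrees n S1 S2 S3" "agrees n S1 S2 S4"
      using mono S3(2) S4(2) unfolding agrees_def before_def by auto
    show "elem S4 z < elem S4 x" if "z \<in> {1..n}" "elem S3 z < elem S3 x" for z
      using that S3(2)[OF that(1) xy(1)] S4(2)[OF that(1) xy(1)] xyD rkn[OF that(1)]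
      by (auto simp: key_def split: if_splits)
    show "\<not> elem S3 y < elem S3 x" using S3(2)[OF xy(2,1)] xyD ne by (simp add: key_def)
    show "elem S4 y < elem S4 x" using S4(2)[OF xy(2,1)] xyD ne by (simp add: key_def)
  qed
qed

lemma padded_agrees:
  assumes "padded n m S1" "padded n m S2" "agrees n S1 S2 S3" "3 * m \<le> n"
  shows "padded n m S3"
  using assms unfolding padded_def agrees_def by (auto 4 4)

lemma splitter_separates:
  fixes S1 S2 :: "'a::linorder list"
  assumes T: "positions T \<subseteq> {1..n}" "\<And>S. S \<in> (arrays n :: 'a list set) \<Longrightarrow> solution S Q (result T S)"
    and S: "S1 \<in> arrays n" "S2 \<in> arrays n" "padded n m S1" "padded n m S2" "same_path T S1 S2"
    and m: "3 * m \<le> n" "1 \<le> i" "i \<le> m" and Q: "j < length Q" "Q ! j = (i + 1, 2 * m + i)"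
    and y: "y \<in> {m+1..2*m}" and less: "elem S1 y < elem S1 (result T S1 ! j)"
  shows "\<not> elem S2 (result T S1 ! j) < elem S2 y"
proof
  let ?x = "result T S1 ! j"
  assume gt: "elem S2 ?x < elem S2 y"
  have "has_rank (elem S1) [m+1..<2*m+1] (i - 1) ?x"
    using padded_median[OF S(1,3) m T(2)[OF S(1)] Q] .
  then have x: "?x \<in> {1..n}" using m by (auto simp: has_rank_def)
  have yn: "y \<in> {1..n}" using y m by auto
  obtain S3 S4 where *: "S3 \<in> arrays n" "S4 \<in> arrays n" "agrees n S1 S2 S3" "agrees n S1 S2 S4"
    "\<And>z. z \<in> {1..n} \<Longrightarrow> elem S3 z < elem S3 ?x \<Longrightarrow> elem S4 z < elem S4 ?x"
    "\<not> elem S3 y < elem S3 ?x" "elem S4 y < elem S4 ?x"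
    using agreeing_neighbours[OF S(1,2) x yn less gt] by blast
  have rank: "has_rank (elem S') [m+1..<2*m+1] (i - 1) ?x"
    if "S' \<in> arrays n" "agrees n S1 S2 S'" for S'
    using padded_median[OF that(1) padded_agrees[OF S(3,4) that(2) m(1)] m T(2)[OF that(1)] Q]
      result_agrees[OF S(1,2) that(2) T(1) S(5)] by simp
  \<comment> \<open>From \<open>S3\<close> to \<open>S4\<close> the element \<open>?x\<close> gains
    \<open>y\<close> as a smaller one and loses none, and \<open>y\<close> lies in the middle part,
    where the rank is counted.\<close>
  have "length (filter (\<lambda>z. elem S3 z < elem S3 ?x) [m+1..<2*m+1]) <
      length (filter (\<lambda>z. elem S4 z < elem S4 ?x) [m+1..<2*m+1])"
    by (rule length_filter_strict_mono[where y = y]) (use * y m in \<open>auto simp del: upt_Suc\<close>)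
  then show False using rank[OF *(1,3)] rank[OF *(2,4)] unfolding has_rank_def
    by (simp del: upt_Suc)
qed


section \<open>A large family of inputs on pairwise different leaves\<close>

definition block_perms :: "nat \<Rightarrow> nat list set" where
  "block_perms b = {xs. length xs = b \<and> distinct xs \<and> set xs \<subseteq> {..<b}}"

text \<open>Each entry of a word spreads \<open>b\<close> consecutive positions bijectively over the
  \<open>b\<close> blocks, so every block has size \<open>B\<close> whatever the word. Not every
  partition arises, but a product is easy to count and large enough.\<close>

definition words :: "nat \<Rightarrow> nat \<Rightarrow> nat list list set" where
  "words b B = {w. set w \<subseteq> block_perms b \<and> length w = B}"

lemma finite_block_perms: "finite (block_perms b)"
  by (rule finite_subset[OF _ finite_lists_length_eq[of "{..<b}" b]]) (auto simp: block_perms_def)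

lemma card_words: "card (words b B) = fact b ^ B"
proof -
  have "card (block_perms b) = fact b"
    using card_lists_distinct_length_eq[of "{..<b}" b] by (simp add: block_perms_def fact_prod)
  then show ?thesis using card_lists_length_eq[OF finite_block_perms, of b B] by (simp add: words_def)
qed

text \<open>
  Position \<open>m + 1 + (c * b + e)\<close> is put into block \<open>w ! c ! e\<close>, and \<open>c\<close> orders the elements of a
  block; so two words that give the same partition into blocks are equal.
\<close>

definition word_key :: "nat \<Rightarrow> nat \<Rightarrow> nat \<Rightarrow> nat list list \<Rightarrow> nat \<Rightarrow> nat" where
  "word_key m b B w p = (if m < p \<and> p \<le> m + b * B
     then m + 1 + (w ! ((p - m - 1) div b) ! ((p - m - 1) mod b) * B + (p - m - 1) div b) else p)"

text \<open>Injectivity: \<open>mod B\<close> recovers \<open>c\<close>, \<open>div B\<close>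
  recovers the block, and the block determines \<open>e\<close> because \<open>w ! c\<close> is a
  permutation.\<close>

lemma word_key_props:
  assumes w: "w \<in> words b B" and b: "b * B \<le> m"
  shows "m < p \<Longrightarrow> p \<le> m + b * B \<Longrightarrow> m < word_key m b B w p \<and> word_key m b B w p \<le> m + b * B"
    and "inj (word_key m b B w)"
    and "c < B \<Longrightarrow> e < b \<Longrightarrow> word_key m b B w (m + 1 + (c * b + e)) = m + 1 + (w ! c ! e * B + c)"
proof -
  have wc: "w ! c \<in> block_perms b" if "c < B" for c using w that by (auto simp: words_def)
  have range: "(p - m - 1) div b < B" "(p - m - 1) mod b < b"
    "w ! ((p - m - 1) div b) ! ((p - m - 1) mod b) < b"
    if "m < p" "p \<le> m + b * B" for p
  proof -
    have t: "p - m - 1 < B * b" using that by (simp add: mult.commute)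
    then show c: "(p - m - 1) div b < B" by (rule less_mult_imp_div_less)
    have "0 < b" using t by (cases b) auto
    then show e: "(p - m - 1) mod b < b" by simp
    then show "w ! ((p - m - 1) div b) ! ((p - m - 1) mod b) < b"
      using wc[OF c] by (force simp: block_perms_def)
  qed
  have bound: "x * B + c < b * B" if "x < b" "c < B" for x c
  proof -
    have "x * B + c < Suc x * B" using that(2) by simp
    also have "\<dots> \<le> b * B" using that(1) by (intro mult_le_mono1) simp
    finally show ?thesis .
  qed
  have *: "m < word_key m b B w p \<and> word_key m b B w p \<le> m + b * B" if "m < p" "p \<le> m + b * B" for p
    using range[OF that] bound[OF range(3)[OF that] range(1)[OF that]] that by (simp add: word_key_def)
  then show "m < p \<Longrightarrow> p \<le> m + b * B \<Longrightarrow> m < word_key m b B w p \<and> word_key m b B w p \<le> m + b * B" .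
  show "inj (word_key m b B w)"
  proof (rule injI)
    fix p q assume eq: "word_key m b B w p = word_key m b B w q"
    have out: "word_key m b B w p = p" if "\<not> (m < p \<and> p \<le> m + b * B)" for p
      using that by (auto simp: word_key_def)
    consider "m < p \<and> p \<le> m + b * B" "m < q \<and> q \<le> m + b * B"
      | "\<not> (m < p \<and> p \<le> m + b * B)" "\<not> (m < q \<and> q \<le> m + b * B)"
      using eq * out by metis
    then show "p = q"
    proof cases
      case 1
      define c where "c p = (p - m - 1) div b" for p
      define e where "e p = (p - m - 1) mod b" for p
      have rp: "c p < B" "e p < b" and rq: "c q < B" "e q < b"
        using range[of p] range[of q] 1 by (auto simp: c_def e_def)
      have "w ! c p ! e p * B + c p = w ! c q ! e q * B + c q"
        using eq 1 by (simp add: word_key_def c_def e_def)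
      then have "(w ! c p ! e p * B + c p) mod B = (w ! c q ! e q * B + c q) mod B"
        "(w ! c p ! e p * B + c p) div B = (w ! c q ! e q * B + c q) div B" by simp_all
      then have "c p = c q" "w ! c p ! e p = w ! c q ! e q" using rp rq by simp_all
      then have "e p = e q"
        using wc[OF rp(1)] rp rq by (simp add: block_perms_def nth_eq_iff_index_eq)
      with \<open>c p = c q\<close> have "p - m - 1 = q - m - 1"
        unfolding c_def e_def by (metis div_mult_mod_eq)
      then show ?thesis using 1 by arith
    qed (use eq out in simp)
  qed
  show "word_key m b B w (m + 1 + (c * b + e)) = m + 1 + (w ! c ! e * B + c)" if "c < B" "e < b"
  proof -
    have "c * b + e < B * b"
    proof -
      have "c * b + e < Suc c * b" using that(2) by simp
      also have "\<dots> \<le> B * b" using that(1) by (intro mult_le_mono1) simp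
      finally show ?thesis .
    qed
    then show ?thesis using that by (simp add: word_key_def mult.commute)
  qed
qed

lemma word_key_mid:
  assumes "w \<in> words b B" "b * B \<le> m"
  shows "word_key m b B w ` {m+1..2*m} = {m+1..2*m}"
proof (rule endo_inj_surj)
  show "word_key m b B w ` {m+1..2*m} \<subseteq> {m+1..2*m}"
  proof
    fix k assume "k \<in> word_key m b B w ` {m+1..2*m}"
    then obtain p where p: "p \<in> {m+1..2*m}" "k = word_key m b B w p" by blast
    show "k \<in> {m+1..2*m}"
      using word_key_props(1)[OF assms, of p] p assms(2)
      by (cases "p \<le> m + b * B") (auto simp: word_key_def)
  qed
  show "inj_on (word_key m b B w) {m+1..2*m}"
    using word_key_props(2)[OF assms] by (rule inj_on_subset) simp
qed simp

text \<open>The keys of the middle part are exactly \<open>m + 1\<close> to \<open>2 * m\<close>, so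
  a key there is a rank up to a shift.\<close>

lemma word_key_rank:
  assumes w: "w \<in> words b B" "b * B \<le> m" and n: "3 * m \<le> n"
    and S: "\<And>p q. p \<in> {1..n} \<Longrightarrow> q \<in> {1..n} \<Longrightarrow>
      elem S p < elem S q \<longleftrightarrow> word_key m b B w p < word_key m b B w q"
    and r: "has_rank (elem S) [m+1..<2*m+1] r x"
  shows "word_key m b B w x = m + 1 + r"
proof -
  let ?k = "word_key m b B w"
  have x: "x \<in> {m+1..2*m}" using r by (auto simp: has_rank_def)
  then have kx: "?k x \<in> {m+1..2*m}" using word_key_mid[OF w] by blast
  have "r = length (filter (\<lambda>z. elem S z < elem S x) [m+1..<2*m+1])"
    using r by (simp add: has_rank_def del: upt_Suc)
  also have "\<dots> = card {z \<in> {m+1..2*m}. elem S z < elem S x}"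
    by (subst distinct_card[symmetric]) (auto intro: arg_cong[where f = card])
  also have "{z \<in> {m+1..2*m}. elem S z < elem S x} = {z \<in> {m+1..2*m}. ?k z < ?k x}"
    using S x n by auto
  also have "card \<dots> = card (?k ` {z \<in> {m+1..2*m}. ?k z < ?k x})"
    using word_key_props(2)[OF w] by (intro card_image[symmetric]) (rule inj_on_subset, auto)
  also have "?k ` {z \<in> {m+1..2*m}. ?k z < ?k x} = {v \<in> ?k ` {m+1..2*m}. v < ?k x}" by auto
  also have "\<dots> = {m+1..<?k x}" using kx unfolding word_key_mid[OF w] by auto
  finally show ?thesis using kx by simp
qed

lemma padded_word_key:
  assumes w: "w \<in> words b B" "b * B \<le> m" and n: "3 * m \<le> n"
    and S: "\<And>p q. p \<in> {1..n} \<Longrightarrow> q \<in> {1..n} \<Longrightarrow>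
      elem S p < elem S q \<longleftrightarrow> word_key m b B w p < word_key m b B w q"
  shows "padded n m S"
  unfolding padded_def
proof (intro ballI conjI)
  fix q assume q: "q \<in> {m+1..2*m}"
  then have kq: "word_key m b B w q \<in> {m+1..2*m}" using word_key_mid[OF w] by blast
  show "elem S a < elem S q" if "a \<in> {1..m}" for a
    using S[of a q] that q kq n by (auto simp: word_key_def)
  show "elem S q < elem S c" if "c \<in> {2*m+1..n}" for c
  proof -
    have "word_key m b B w c = c" using that w(2) by (auto simp: word_key_def)
    then show ?thesis using S[of q c] that q kq n by auto
  qed
qed

text \<open>Rank \<open>(j + 1) * B\<close> is that of the largest element of block
  \<open>j\<close>, which serves as splitter. The \<open>min\<close> repeats the last query until
  there are exactly \<open>k\<close>.\<close>

definition splitter_queries :: "nat \<Rightarrow> nat \<Rightarrow> nat \<Rightarrow> nat \<Rightarrow> (nat \<times> nat) list" where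
  "splitter_queries m b B k =
     map (\<lambda>j. (Suc (min j (b - 1)) * B + 1, 2 * m + Suc (min j (b - 1)) * B)) [0..<k]"

lemma splitter_queries:
  assumes "1 \<le> m" "3 * m \<le> n" "1 \<le> b" "b * B \<le> m"
  shows "splitter_queries m b B k \<in> queries n k"
proof -
  have "Suc (min j (b - 1)) * B \<le> m" for j
  proof -
    have "Suc (min j (b - 1)) * B \<le> b * B" using assms(3) by (intro mult_le_mono1) auto
    then show ?thesis using assms(4) by simp
  qed
  then have "1 \<le> Suc (min j (b - 1)) * B + 1 \<and>
      Suc (min j (b - 1)) * B + 1 \<le> 2 * m + Suc (min j (b - 1)) * B \<and>
      2 * m + Suc (min j (b - 1)) * B \<le> n" for j
    using assms(1,2) by (smt (verit) add.commute add_le_cancel_left le_add2 le_trans mult_2 numeral_3_eq_3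
      mult_Suc numeral_2_eq_2 nat_add_left_cancel_le)
  then show ?thesis by (auto simp: queries_def splitter_queries_def simp del: mult_Suc)
qed

lemma words_need_comparisons:
  assumes ne: "(arrays n :: 'a::linorder list set) \<noteq> {}"
    and T: "positions T \<subseteq> {1..n}"
      "\<And>S. S \<in> (arrays n :: 'a list set) \<Longrightarrow> solution S (splitter_queries m b B k) (result T S)"
    and m: "1 \<le> m" "3 * m \<le> n" "2 \<le> b" "1 \<le> B" "b * B \<le> m" "b \<le> k"
  shows "\<exists>S \<in> (arrays n :: 'a list set). real B * log 2 (fact b) \<le> real (comparisons T S)"
proof -
  have "\<exists>S. S \<in> (arrays n :: 'a list set) \<and> (\<forall>p \<in> {1..n}. \<forall>q \<in> {1..n}. elem S p < elem S q \<longleftrightarrow>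
      word_key m b B w p < word_key m b B w q)" if "w \<in> words b B" for w
    using array_of_keys[OF ne, of "word_key m b B w"] word_key_props(2)[OF that m(5)]
    by (metis inj_on_subset subset_UNIV)
  then obtain arr where arr: "\<And>w. w \<in> words b B \<Longrightarrow> arr w \<in> (arrays n :: 'a list set)"
    "\<And>w p q. w \<in> words b B \<Longrightarrow> p \<in> {1..n} \<Longrightarrow> q \<in> {1..n} \<Longrightarrow> elem (arr w) p < elem (arr w) q \<longleftrightarrow>
      word_key m b B w p < word_key m b B w q"
    by metis
  \<comment> \<open>With \<open>j\<close> the block of position \<open>y\<close> under
    \<open>w\<close>, the splitter \<open>x\<close> of block \<open>j\<close> is not below
    \<open>y\<close> under \<open>w\<close> but below it under \<open>w'\<close>. On a common leaf
    \<open>splitter_separates\<close> excludes this.\<close>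
  have sep: "\<not> w ! c ! e < w' ! c ! e"
    if w: "w \<in> words b B" "w' \<in> words b B" "same_path T (arr w) (arr w')" "c < B" "e < b" for w w' c e
  proof
    assume lt: "w ! c ! e < w' ! c ! e"
    define j where "j = w ! c ! e"
    define i where "i = Suc j * B"
    define x where "x = result T (arr w) ! j"
    define y where "y = m + 1 + (c * b + e)"
    have "w' ! c \<in> block_perms b" using w by (auto simp: words_def)
    then have "w' ! c ! e < b" using w(5) by (force simp: block_perms_def)
    then have j: "j < b - 1" "j < k" using lt m(6) by (auto simp: j_def)
    have i: "1 \<le> i" "i \<le> m"
    proof -
      have "i \<le> b * B" unfolding i_def using j by (intro mult_le_mono1) simp
      then show "i \<le> m" using m(5) by simp
      show "1 \<le> i" using m(4) by (simp add: i_def)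
    qed
    have Q: "j < length (splitter_queries m b B k)"
      "splitter_queries m b B k ! j = (i + 1, 2 * m + i)"
      using j by (simp_all add: splitter_queries_def i_def)
    have pad: "padded n m (arr w)" "padded n m (arr w')"
      using padded_word_key[OF _ m(5,2)] w arr(2) by blast+
    \<comment> \<open>Taking the second array also as the third one shows that arrays on a common
      leaf have the same result.\<close>
    have res: "result T (arr w') = result T (arr w)"
      using result_agrees[of "arr w" n "arr w'" "arr w'" T] w arr(1) T(1) by (simp add: agrees_def)
    have x1: "has_rank (elem (arr w)) [m+1..<2*m+1] (i - 1) x"
      unfolding x_def using padded_median[OF arr(1)[OF w(1)] pad(1) m(2) i T(2)[OF arr(1)[OF w(1)]] Q] .
    have x2: "has_rank (elem (arr w')) [m+1..<2*m+1] (i - 1) x"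
      unfolding x_def res[symmetric]
      using padded_median[OF arr(1)[OF w(2)] pad(2) m(2) i T(2)[OF arr(1)[OF w(2)]] Q] .
    have xn: "x \<in> {1..n}" using x1 m(2) by (auto simp: has_rank_def)
    have kx: "word_key m b B w x = m + i" "word_key m b B w' x = m + i"
      using word_key_rank[OF w(1) m(5,2) arr(2)[OF w(1)] x1] word_key_rank[OF w(2) m(5,2) arr(2)[OF w(2)] x2]
        i(1) by simp_all
    have ym: "y \<in> {m+1..2*m}"
    proof -
      have "c * b + e < Suc c * b" using w(5) by simp
      also have "\<dots> \<le> B * b" using w(4) by (intro mult_le_mono1) simp
      also have "\<dots> \<le> m" using m(5) by (simp add: mult.commute)
      finally show ?thesis by (simp add: y_def)
    qed
    have yn: "y \<in> {1..n}" using ym m(2) by auto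
    have "word_key m b B w y \<le> m + i"
      using word_key_props(3)[OF w(1) m(5) w(4,5)] w(4) by (simp add: y_def i_def j_def)
    moreover have "m + i < word_key m b B w' y"
    proof -
      have "Suc j * B \<le> w' ! c ! e * B" using lt by (intro mult_le_mono1) (simp add: j_def)
      then show ?thesis
        using word_key_props(3)[OF w(2) m(5) w(4,5)] by (simp add: y_def i_def)
    qed
    ultimately have le: "word_key m b B w y \<le> word_key m b B w x"
      "word_key m b B w' x < word_key m b B w' y" using kx by simp_all
    \<comment> \<open>Under \<open>w\<close> the position \<open>y\<close> might be the splitter
      itself; the strict inequality under \<open>w'\<close> excludes \<open>x = y\<close>.\<close>
    then have "word_key m b B w y \<noteq> word_key m b B w x"
      using word_key_props(2)[OF w(1) m(5)] by (metis injD less_irrefl)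
    then have "elem (arr w) y < elem (arr w) x" "elem (arr w') x < elem (arr w') y"
      using le arr(2)[OF w(1) yn xn] arr(2)[OF w(2) xn yn] by auto
    then show False
      using splitter_separates[OF T arr(1)[OF w(1)] arr(1)[OF w(2)] pad w(3) m(2) i Q ym]
      unfolding x_def by blast
  qed
  have inj: "w = w'" if w: "w \<in> words b B" "w' \<in> words b B" "same_path T (arr w) (arr w')" for w w'
  proof (rule nth_equalityI)
    show "length w = length w'" using w by (simp add: words_def)
    fix c assume c: "c < length w"
    then have cB: "c < B" using w by (simp add: words_def)
    then have perms: "w ! c \<in> block_perms b" "w' ! c \<in> block_perms b" using w by (auto simp: words_def)
    show "w ! c = w' ! c"
    proof (rule nth_equalityI)
      show "length (w ! c) = length (w' ! c)" using perms by (simp add: block_perms_def)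
      fix e assume "e < length (w ! c)"
      then have "e < b" using perms by (simp add: block_perms_def)
      then show "w ! c ! e = w' ! c ! e"
        using sep[OF w cB] sep[OF w(2,1) same_path_sym[OF w(3)] cB] by (meson linorder_neqE_nat)
    qed
  qed
  define F where "F = arr ` words b B"
  have fin: "finite (words b B)"
    unfolding words_def using finite_lists_length_eq[OF finite_block_perms] by auto
  have "inj_on arr (words b B)"
    using inj same_path_refl by (metis inj_onI)
  then have cardF: "card F = fact b ^ B" by (simp add: F_def card_image card_words)
  have finF: "finite F" using fin by (simp add: F_def)
  have neF: "F \<noteq> {}" using cardF by auto
  define d where "d = Max (comparisons T ` F)"
  have "card F \<le> 2 ^ d"
    by (rule card_le_comparisons[OF finF]) (use inj finF in \<open>auto simp: F_def d_def\<close>)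
  then have "real (fact b ^ B) \<le> 2 ^ d" unfolding cardF by (metis of_nat_le_iff of_nat_numeral of_nat_power)
  then have "log 2 (real (fact b ^ B)) \<le> real d"
    by (simp add: log_le_iff powr_realpow)
  moreover have "log 2 (real (fact b ^ B)) = real B * log 2 (fact b)" by (simp add: log_nat_power)
  moreover have "d \<in> comparisons T ` F" unfolding d_def using finF neF by (intro Max_in) auto
  then obtain S where "S \<in> F" "comparisons T S = d" by auto
  ultimately show ?thesis using arr(1) by (auto simp: F_def)
qed

section \<open>Numerical estimates and the choice of parameters\<close>

lemma log_fact_ge: "real b / 2 * log 2 (real b) \<le> log 2 (fact b)"
proof (cases "b = 0")
  case False
  \<comment> \<open>The factors \<open>i\<close> and \<open>b + 1 - i\<close> of
    \<open>fact b * fact b\<close> are paired: for \<open>i = x + 1\<close> and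
    \<open>b = x + y + 1\<close> their product is \<open>(x + 1) * (y + 1)\<close>, which is at
    least \<open>b\<close>.\<close>
  have "b ^ b = (\<Prod>i = 1..b. b)" by simp
  also have "\<dots> \<le> (\<Prod>i = 1..b. i * (b + 1 - i))"
  proof (rule prod_mono)
    fix i assume "i \<in> {1..b}"
    then obtain x y where "i = Suc x" "b = Suc (x + y)"
      by (metis Suc_le_D Suc_le_mono add_Suc atLeastAtMost_iff le_Suc_ex One_nat_def)
    then show "0 \<le> b \<and> b \<le> i * (b + 1 - i)" by simp
  qed
  also have "\<dots> = fact b * fact b"
    using prod.atLeastAtMost_rev[of "\<lambda>i. i" 1 b] by (simp add: prod.distrib fact_prod)
  finally have "real (b ^ b) \<le> real (fact b * fact b)" by (rule of_nat_mono)
  then have "log 2 (real b ^ b) \<le> log 2 (fact b * fact b)"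
    using False by (subst log_le_cancel_iff) auto
  then show ?thesis using False by (simp add: log_nat_power log_mult)
qed simp

text \<open>A tree without comparisons always outputs the same position, but exchanging the elements
  at positions 1 and 2 moves the median of the range [1, 2]. This settles small \<open>n\<close>,
  where the block argument has too little room.\<close>

lemma one_comparison:
  assumes ne: "(arrays n :: 'a::linorder list set) \<noteq> {}" and nk: "2 \<le> n" "1 \<le> k"
    and A: "solves TYPE('a) n k A"
  shows "\<exists>Q \<in> queries n k. \<exists>S \<in> (arrays n :: 'a list set). 1 \<le> comparisons (A Q) S"
proof -
  define Q where "Q = replicate k (1 :: nat, 2 :: nat)"
  have Q: "Q \<in> queries n k" using nk by (auto simp: Q_def queries_def)
  define key where "key b p = (if b \<and> p = 1 then 2 else if b \<and> p = 2 then 1 else p)" for b and p :: nat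
  have inj: "inj_on (key b) {1..n}" for b
    by (auto simp: inj_on_def key_def split: if_splits)
  have first: "\<exists>S \<in> (arrays n :: 'a list set). result (A Q) S ! 0 = (if b then 2 else 1)" for b
  proof -
    obtain S :: "'a list" where S: "S \<in> arrays n"
      "\<And>p q. p \<in> {1..n} \<Longrightarrow> q \<in> {1..n} \<Longrightarrow> elem S p < elem S q \<longleftrightarrow> key b p < key b q"
      using array_of_keys[OF ne inj[of b]] by blast
    have S': "length S = n" "distinct S" using S(1) by (auto simp: arrays_def)
    note injS = inj_on_elem[OF S'(2), unfolded S'(1)]
    let ?p = "if b then 2 else 1 :: nat"
    have "[1..<Suc 2] = [1, 2]" by (simp add: upt_rec)
    then have "has_rank (elem S) [1..<Suc 2] ((2 - 1) div 2) ?p"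
      using S(2)[of 1 2] S(2)[of 2 1] nk by (auto simp: has_rank_def key_def)
    then have "elem S ?p = range_median S 1 2"
    proof (rule has_rank_range_median(2)[rotated 2])
      show "inj_on (elem S) {1..2}" using injS by (rule inj_on_subset) (use nk in auto)
    qed simp
    moreover have "solution S Q (result (A Q) S)" using A Q S(1) by (auto simp: solves_def)
    then have "result (A Q) S ! 0 \<in> {1..n}" "elem S (result (A Q) S ! 0) = range_median S 1 2"
      using nk S' by (auto simp: solution_def list_all2_conv_all_nth Q_def)
    moreover have "?p \<in> {1..n}" using nk by auto
    ultimately have "result (A Q) S ! 0 = ?p" using inj_onD[OF injS] by metis
    then show ?thesis using S(1) by blast
  qed
  have "\<exists>i j T U. A Q = Compare i j T U"
  proof (cases "A Q")
    case (Output ps)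
    then show ?thesis using first[of True] first[of False] by auto
  qed simp
  then show ?thesis using first[of True] Q by force
qed

lemma comparison_lower_bound:
  assumes ne: "(arrays n :: 'a::linorder list set) \<noteq> {}" and nk: "1 \<le> n" "1 \<le> k" "k \<le> n ^ d"
    and A: "solves TYPE('a) n k A"
  shows "\<exists>Q \<in> queries n k. \<exists>S \<in> (arrays n :: 'a list set).
    1 / (64 * (real d + 1)) * (real n * log 2 (real k)) \<le> real (comparisons (A Q) S)"
proof (cases "k = 1")
  case True
  have "[(1, 1)] \<in> queries n k" using nk True by (simp add: queries_def)
  then show ?thesis using ne True by auto
next
  case False
  then have k2: "2 \<le> k" using nk by simp
  have n2: "2 \<le> n"
  proof (rule ccontr)
    assume "\<not> 2 \<le> n"
    then have "n = 1" using nk by simp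
    then show False using nk k2 by simp
  qed
  define N where "N = log 2 (real n)"
  define K where "K = log 2 (real k)"
  have N1: "1 \<le> N" using n2 by (simp add: N_def)
  have KN: "K \<le> real d * N"
  proof -
    have "real k \<le> real n ^ d" using nk(3) by (metis of_nat_le_iff of_nat_power)
    then have "K \<le> log 2 (real n ^ d)" unfolding K_def using nk n2 by (subst log_le_cancel_iff) auto
    then show ?thesis using n2 by (simp add: log_nat_power N_def)
  qed
  have K1: "1 \<le> K" using k2 by (simp add: K_def)
  show ?thesis
  proof (cases "n < 16")
    \<comment> \<open>This case fixes the constant 64: \<open>log 2 n \<le> 4\<close> and
      \<open>n < 16\<close> give \<open>n * K \<le> 64 * d\<close>, so one comparison
      suffices.\<close>
    case True
    have "N \<le> log 2 16" unfolding N_def using True n2 by (subst log_le_cancel_iff) auto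
    also have "log 2 16 = (4::real)" using log_pow_cancel[of 2 4] by simp
    finally have "K \<le> real d * 4" using KN by (meson mult_left_mono of_nat_0_le_iff order_trans)
    then have "real n * K \<le> 16 * (real d * 4)" using True K1 by (intro mult_mono) auto
    then have "real n * K \<le> 64 * (real d + 1)" by simp
    then have "1 / (64 * (real d + 1)) * (real n * K) \<le> 1" by (simp add: field_simps)
    moreover obtain Q S where QS: "Q \<in> queries n k" "S \<in> (arrays n :: 'a list set)"
      "1 \<le> comparisons (A Q) S"
      using one_comparison[OF ne n2 nk(2) A] by blast
    then have "1 \<le> real (comparisons (A Q) S)" by simp
    ultimately have "1 / (64 * (real d + 1)) * (real n * K) \<le> real (comparisons (A Q) S)"
      by (rule order_trans)
    then show ?thesis using QS unfolding K_def by blast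
  next
    case False
    define m where "m = n div 3"
    \<comment> \<open>The middle part has only \<open>m\<close> ranks to ask for, so the number of
      blocks is capped at \<open>m\<close>.\<close>
    define b where "b = min k m"
    define B where "B = m div b"
    have m: "5 \<le> m" "3 * m \<le> n" "n \<le> 4 * m" using False by (auto simp: m_def)
    have b: "2 \<le> b" "b \<le> k" "b \<le> m" using m(1) k2 by (auto simp: b_def)
    have bB: "b * B \<le> m" "1 \<le> B" using b by (auto simp: B_def div_greater_zero_iff Suc_leI)
    \<comment> \<open>Rounding in \<open>m div b\<close> loses at most half, since the remainder is
      less than \<open>b \<le> b * B\<close>.\<close>
    have half: "m \<le> 2 * (b * B)"
    proof -
      have "m mod b < b" "b * B + m mod b = m" using b by (auto simp: B_def)
      moreover have "b \<le> b * B" using bB(2) by simp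
      ultimately show ?thesis by linarith
    qed
    define L where "L = log 2 (real b)"
    \<comment> \<open>If \<open>k\<close> exceeds \<open>m\<close>, then \<open>b = m\<close>, and
      \<open>n \<le> m * m\<close> turns \<open>K \<le> d * N\<close> into
      \<open>K \<le> 2 * d * L\<close>.\<close>
    have LK: "K \<le> 2 * (real d + 1) * L"
    proof (cases "k \<le> m")
      case True
      then have "L = K" by (simp add: L_def K_def b_def)
      moreover have "1 * K \<le> 2 * (real d + 1) * K" using K1 by (intro mult_right_mono) auto
      ultimately show ?thesis by simp
    next
      case False
      then have bm: "b = m" by (simp add: b_def)
      have "4 * m \<le> m * m" using m(1) by simp
      with m(3) have "n \<le> m * m" by (rule order_trans)
      then have "real n \<le> real m * real m" by (metis of_nat_le_iff of_nat_mult)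
      then have "N \<le> log 2 (real m * real m)" unfolding N_def using n2 m by (subst log_le_cancel_iff) auto
      then have "N \<le> 2 * L" using m by (simp add: log_mult L_def bm)
      then have "real d * N \<le> real d * (2 * L)" by (intro mult_left_mono) auto
      moreover have "0 \<le> L" using b by (simp add: L_def)
      ultimately show ?thesis using KN by (simp add: algebra_simps)
    qed
    define Q where "Q = splitter_queries m b B k"
    have Q: "Q \<in> queries n k" unfolding Q_def using m b bB by (intro splitter_queries) auto
    obtain S where S: "S \<in> (arrays n :: 'a list set)"
      "real B * log 2 (fact b) \<le> real (comparisons (A Q) S)"
      using words_need_comparisons[OF ne, of "A Q" m b B k] A Q m b bB
      unfolding solves_def Q_def by auto
    have "real n * K \<le> real n * (2 * (real d + 1) * L)" using LK by (intro mult_left_mono) auto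
    then have "1 / (64 * (real d + 1)) * (real n * K) \<le> real n * L / 32"
      by (simp add: field_simps)
    also have "\<dots> \<le> real B * (real b / 2 * L)"
    proof -
      have "n \<le> 8 * (b * B)" using half m(3) by simp
      then have "real n \<le> 8 * (real b * real B)" by (metis of_nat_le_iff of_nat_mult of_nat_numeral)
      moreover have "0 \<le> L" using b by (simp add: L_def)
      ultimately have "real n * L \<le> 8 * (real b * real B) * L" by (intro mult_right_mono) auto
      moreover have "0 \<le> real b * real B * L" using \<open>0 \<le> L\<close> by simp
      ultimately show ?thesis by (simp add: algebra_simps)
    qed
    also have "\<dots> \<le> real B * log 2 (fact b)"
      using log_fact_ge[of b] by (intro mult_left_mono) (auto simp: L_def)
    also note S(2)
    finally show ?thesis using Q S(1) unfolding K_def by blast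
  qed
qed

section \<open>The theorem\<close>

lemma runs_main_solve:
  fixes S :: "'a::linorder list"
  assumes "S \<in> arrays n" "Q \<in> queries n k"
  shows "\<exists>t ps. runs [main, solve] S Q t ps \<and> solution S Q ps \<and> t \<le> 30 * (n + k + 1) + cost n k"
proof -
  obtain R M where init: "initial (length S) Q = (R, M)" by (cases "initial (length S) Q")
  have "achieves [main, solve] S (Call 0) R M (30 * (n + k + 1) + cost n k)
      (\<lambda>R' M'. solution S Q (map M' [0..<length Q]))"
    by (rule main_achieves[OF refl assms init],
        rule solve_achieves[OF _ _ cost_empty cost_leaf cost_node]) simp_all
  then show ?thesis unfolding achieves_def runs_def init by blast
qed

text \<open>The theorem bounds every run, whereas \<open>achieves\<close> provides one; determinism
  of the machine closes the gap.\<close>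

lemma runs_deterministic: "runs P S Q t ps \<Longrightarrow> runs P S Q t' ps' \<Longrightarrow> t = t'"
  unfolding runs_def using exec_deterministic by blast

text \<open>The time bound starts at \<open>k = 2\<close> because \<open>log 2 1 = 0\<close> would
  make its right-hand side vanish. Over a finite type long arrays do not exist, and then there is no
  input on which comparisons could be exhibited; hence nonempty \<open>arrays n\<close>. The
  constant \<open>c\<close> depends on \<open>d\<close> alone.\<close>

theorem theorem1p1:
  shows "(\<exists>P :: program.
           (\<forall>n k. \<forall>S \<in> (arrays n :: 'a::linorder list set). \<forall>Q \<in> queries n k.
              \<exists>t ps. runs P S Q t ps \<and> solution S Q ps) \<and>
           (\<exists>C > 0. \<forall>n \<ge> 2. \<forall>k \<ge> 2.
              \<forall>S \<in> (arrays n :: 'a list set). \<forall>Q \<in> queries n k. \<forall>t ps. runs P S Q t ps \<longrightarrow>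
                real t \<le> C * (real n * log 2 (real k) + real k * log 2 (real k) * log 2 (real n))))
       \<and> (\<forall>d :: nat. \<exists>c > 0. \<forall>n \<ge> 1. \<forall>k. (arrays n :: 'a list set) \<noteq> {} \<and> 1 \<le> k \<and> k \<le> n ^ d \<longrightarrow>
           (\<forall>A. solves TYPE('a) n k A \<longrightarrow>
              (\<exists>Q \<in> queries n k. \<exists>S \<in> (arrays n :: 'a list set).
                 c * (real n * log 2 (real k)) \<le> real (comparisons (A Q) S))))"
proof (rule conjI)
  have total: "\<forall>n k. \<forall>S \<in> (arrays n :: 'a list set). \<forall>Q \<in> queries n k.
      \<exists>t ps. runs [main, solve] S Q t ps \<and> solution S Q ps"
    using runs_main_solve by blast
  have time: "real t \<le> 600 * unit_cost *
      (real n * log 2 (real k) + real k * log 2 (real k) * log 2 (real n))"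
    if h: "2 \<le> n" "2 \<le> k" "S \<in> arrays n" "Q \<in> queries n k" "runs [main, solve] S Q t ps"
    for n k t ps Q and S :: "'a list"
  proof -
    have "t \<le> 30 * (n + k + 1) + cost n k"
      using runs_main_solve[OF h(3,4)] runs_deterministic[OF h(5)] by auto
    then have "real t \<le> real (30 * (n + k + 1) + cost n k)" by (rule of_nat_mono)
    also have "\<dots> \<le> 100 * real (n + k + 1) + real (cost n k)" by simp
    finally show ?thesis using cost_bound[OF h(1,2)] by linarith
  qed
  have "0 < 600 * unit_cost" by (simp add: unit_cost_def)
  then show "\<exists>P :: program.
      (\<forall>n k. \<forall>S \<in> (arrays n :: 'a list set). \<forall>Q \<in> queries n k.
         \<exists>t ps. runs P S Q t ps \<and> solution S Q ps) \<and>
      (\<exists>C > 0. \<forall>n \<ge> 2. \<forall>k \<ge> 2.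
         \<forall>S \<in> (arrays n :: 'a list set). \<forall>Q \<in> queries n k. \<forall>t ps. runs P S Q t ps \<longrightarrow>
           real t \<le> C * (real n * log 2 (real k) + real k * log 2 (real k) * log 2 (real n)))"
    using total time by blast
  show "\<forall>d :: nat. \<exists>c > 0. \<forall>n \<ge> 1. \<forall>k. (arrays n :: 'a list set) \<noteq> {} \<and> 1 \<le> k \<and> k \<le> n ^ d \<longrightarrow>
      (\<forall>A. solves TYPE('a) n k A \<longrightarrow>
         (\<exists>Q \<in> queries n k. \<exists>S \<in> (arrays n :: 'a list set).
            c * (real n * log 2 (real k)) \<le> real (comparisons (A Q) S)))"
  proof
    fix d :: nat
    have "0 < 1 / (64 * (real d + 1))" by simp
    then show "\<exists>c > 0. \<forall>n \<ge> 1. \<forall>k. (arrays n :: 'a list set) \<noteq> {} \<and> 1 \<le> k \<and> k \<le> n ^ d \<longrightarrow>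
      (\<forall>A. solves TYPE('a) n k A \<longrightarrow>
         (\<exists>Q \<in> queries n k. \<exists>S \<in> (arrays n :: 'a list set).
            c * (real n * log 2 (real k)) \<le> real (comparisons (A Q) S)))"
      using comparison_lower_bound by blast
  qed
qed

end
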